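(* Let $S\in\mathcal{S}^1$ and $\mu\in M(\mathbb{R}^{2d})$. Then $$\big\langle(\mu\star S)\psi,\phi\big\rangle=\int_{\mathbb{R}^{2d}}\big\langle\pi(z)S\pi(z)^*\psi,\phi\big\rangle\,d\mu(z)\qquad\text{for all }\psi,\phi\in L^2(\mathbb{R}^d).$$
   Context: For $z=(x,\omega)\in\mathbb{R}^{2d}$, $\pi(z)\psi(t)=e^{2\pi i\omega\cdot t}\psi(t-x)$ on $L^2(\mathbb{R}^d)$. $\mathcal{S}^1$ is the Banach space of trace-class operators on $L^2(\mathbb{R}^d)$. $M(\mathbb{R}^{2d})$ is the Banach algebra (under convolution) of bounded complex measures with total variation norm. The measure-operator convolution $\star:M(\mathbb{R}^{2d})\times\mathcal{S}^1\to\mathcal{S}^1$ is the unique bilinear map with $\delta_z\star S=\pi(z)S\pi(z)^*$, $\|\mu\star S\|_{\mathcal{S}^1}\le\|\mu\|_M\|S\|_{\mathcal{S}^1}$, $\mu\star(\nu\star S)=(\mu*\nu)\star S$, and such that the closed linear span of $\{f\star S: f\in L^1(\mathbb{R}^{2d}),S\in\mathcal{S}^1\}$ is $\mathcal{S}^1$ (with $L^1(\mathbb{R}^{2d})$ embedded in $M(\mathbb{R}^{2d})$). The inner product on $L^2(\mathbb{R}^d)$ is linear in the first argument. *)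

theory Defs
  imports "HOL-Analysis.Analysis"
begin

section \<open>The Hilbert space \<open>L\<^sup>2\<close>\<close>

definition square_integrable :: "('a::euclidean_space \<Rightarrow> complex) \<Rightarrow> bool" where
  "square_integrable f \<longleftrightarrow>
     f \<in> borel_measurable lborel \<and> integrable lborel (\<lambda>x. (cmod (f x))\<^sup>2)"

definition l2_rel :: "('a::euclidean_space \<Rightarrow> complex) \<Rightarrow> ('a \<Rightarrow> complex) \<Rightarrow> bool" where
  "l2_rel f g \<longleftrightarrow> square_integrable f \<and> square_integrable g \<and> (AE x in lborel. f x = g x)"

lemma square_integrable_measurable [measurable_dest]:
  "square_integrable f \<Longrightarrow> f \<in> borel_measurable lborel"
  by (simp add: square_integrable_def)

lemma square_integrable_zero [simp]: "square_integrable (\<lambda>x. 0)"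
  by (simp add: square_integrable_def)

lemma square_integrable_add:
  assumes f: "square_integrable f" and g: "square_integrable g"
  shows "square_integrable (\<lambda>x. f x + g x)"
proof -
  have [measurable]: "f \<in> borel_measurable lborel" "g \<in> borel_measurable lborel"
    using assms by (auto simp: square_integrable_def)
  have bound: "(cmod (a + b))\<^sup>2 \<le> 2 * (cmod a)\<^sup>2 + 2 * (cmod b)\<^sup>2" for a b :: complex
  proof -
    have "(cmod (a + b))\<^sup>2 \<le> (cmod a + cmod b)\<^sup>2"
      by (intro power_mono norm_triangle_ineq) auto
    also have "\<dots> \<le> 2 * (cmod a)\<^sup>2 + 2 * (cmod b)\<^sup>2"
      using zero_le_power2[of "cmod a - cmod b"] by (simp add: power2_eq_square algebra_simps)
    finally show ?thesis .
  qed
  have "integrable lborel (\<lambda>x. (cmod (f x + g x))\<^sup>2)"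
    by (rule Bochner_Integration.integrable_bound
          [where f = "\<lambda>x. 2 * (cmod (f x))\<^sup>2 + 2 * (cmod (g x))\<^sup>2"])
       (use assms bound in \<open>auto simp: square_integrable_def\<close>)
  then show ?thesis
    by (simp add: square_integrable_def)
qed

lemma square_integrable_cmult:
  assumes "square_integrable f"
  shows "square_integrable (\<lambda>x. c * f x)"
  using assms by (auto simp: square_integrable_def norm_mult power_mult_distrib)

lemma square_integrable_uminus:
  "square_integrable f \<Longrightarrow> square_integrable (\<lambda>x. - f x)"
  using square_integrable_cmult[of f "-1"] by simp

lemma square_integrable_diff:
  "square_integrable f \<Longrightarrow> square_integrable g \<Longrightarrow> square_integrable (\<lambda>x. f x - g x)"
  using square_integrable_add[of f "\<lambda>x. - g x"] square_integrable_uminus[of g] by simp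

lemma measurable_cnj [measurable]: "cnj \<in> borel_measurable borel"
  by (intro borel_measurable_continuous_onI continuous_intros)

lemma square_integrable_mult_cnj:
  assumes "square_integrable f" "square_integrable g"
  shows "integrable lborel (\<lambda>x. f x * cnj (g x))"
proof -
  have [measurable]: "f \<in> borel_measurable lborel" "g \<in> borel_measurable lborel"
    using assms by (auto simp: square_integrable_def)
  have bound: "cmod (a * cnj b) \<le> (cmod a)\<^sup>2 + (cmod b)\<^sup>2" for a b :: complex
  proof -
    have "2 * (cmod a * cmod b) \<le> (cmod a)\<^sup>2 + (cmod b)\<^sup>2"
      using zero_le_power2[of "cmod a - cmod b"] by (simp add: power2_eq_square algebra_simps)
    moreover have "0 \<le> cmod a * cmod b"
      by simp
    ultimately show ?thesis
      unfolding norm_mult complex_mod_cnj by linarith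
  qed
  show ?thesis
    by (rule Bochner_Integration.integrable_bound
          [where f = "\<lambda>x. (cmod (f x))\<^sup>2 + (cmod (g x))\<^sup>2"])
       (use assms bound in \<open>auto simp: square_integrable_def\<close>)
qed

quotient_type (overloaded) 'a l2 = "'a::euclidean_space \<Rightarrow> complex" / partial: l2_rel
proof (rule part_equivpI)
  show "\<exists>f. l2_rel f f"
    by (rule exI[of _ "\<lambda>x. 0"]) (simp add: l2_rel_def)
  show "symp l2_rel"
    by (rule sympI) (auto simp: l2_rel_def elim: eventually_mono)
  show "transp l2_rel"
    by (rule transpI) (auto simp: l2_rel_def elim: eventually_elim2)
qed

lift_definition scaleC_l2 :: "complex \<Rightarrow> 'a::euclidean_space l2 \<Rightarrow> 'a l2" (infixr \<open>*\<^sub>C\<close> 75)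
  is "\<lambda>c f x. c * f x"
  by (auto simp: l2_rel_def intro: square_integrable_cmult elim: eventually_mono)

text \<open>Linear in the first argument.\<close>

lift_definition cinner :: "'a::euclidean_space l2 \<Rightarrow> 'a l2 \<Rightarrow> complex"
  is "\<lambda>f g. LINT x|lborel. f x * cnj (g x)"
proof -
  fix f f' g g' :: "'a \<Rightarrow> complex"
  assume *: "l2_rel f f'" "l2_rel g g'"
  then have [measurable]: "f \<in> borel_measurable lborel" "g \<in> borel_measurable lborel"
    "f' \<in> borel_measurable lborel" "g' \<in> borel_measurable lborel"
    by (auto simp: l2_rel_def square_integrable_def)
  have "AE x in lborel. f x = f' x" "AE x in lborel. g x = g' x"
    using * by (auto simp: l2_rel_def)
  then show "(LINT x|lborel. f x * cnj (g x)) = (LINT x|lborel. f' x * cnj (g' x))"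
    by (intro integral_cong_AE) auto
qed

text \<open>
  The real inner product below is the real part of \<^const>\<open>cinner\<close>; it induces the usual
  \<open>L\<^sup>2\<close> norm and makes the library's topological notions available on \<^typ>\<open>'a l2\<close>.
\<close>

instantiation l2 :: (euclidean_space) real_inner
begin

lift_definition zero_l2 :: "'a l2" is "\<lambda>x. 0"
  by (simp add: l2_rel_def)

lift_definition plus_l2 :: "'a l2 \<Rightarrow> 'a l2 \<Rightarrow> 'a l2" is "\<lambda>f g x. f x + g x"
  by (auto simp: l2_rel_def intro: square_integrable_add elim: eventually_elim2)

lift_definition uminus_l2 :: "'a l2 \<Rightarrow> 'a l2" is "\<lambda>f x. - f x"
  by (auto simp: l2_rel_def intro: square_integrable_uminus elim: eventually_mono)

lift_definition minus_l2 :: "'a l2 \<Rightarrow> 'a l2 \<Rightarrow> 'a l2" is "\<lambda>f g x. f x - g x"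
  by (auto simp: l2_rel_def intro: square_integrable_diff elim: eventually_elim2)

definition scaleR_l2 :: "real \<Rightarrow> 'a l2 \<Rightarrow> 'a l2" where
  "scaleR_l2 r f = complex_of_real r *\<^sub>C f"

definition inner_l2 :: "'a l2 \<Rightarrow> 'a l2 \<Rightarrow> real" where
  "inner_l2 f g = Re (cinner f g)"

definition norm_l2 :: "'a l2 \<Rightarrow> real" where
  "norm_l2 f = sqrt (inner f f)"

definition dist_l2 :: "'a l2 \<Rightarrow> 'a l2 \<Rightarrow> real" where
  "dist_l2 f g = norm (f - g)"

definition sgn_l2 :: "'a l2 \<Rightarrow> 'a l2" where
  "sgn_l2 f = scaleR (inverse (norm f)) f"

definition uniformity_l2 :: "('a l2 \<times> 'a l2) filter" where
  "uniformity_l2 = (INF e\<in>{0<..}. principal {(x, y). dist x y < e})"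

definition open_l2 :: "'a l2 set \<Rightarrow> bool" where
  "open_l2 U \<longleftrightarrow> (\<forall>x\<in>U. eventually (\<lambda>(x', y). x' = x \<longrightarrow> y \<in> U) uniformity)"

instance
proof
  fix f g h :: "'a l2" and a b r :: real and U :: "'a l2 set"
  show "f + g + h = f + (g + h)"
    by transfer (auto simp: l2_rel_def add.assoc intro!: square_integrable_add)
  show "f + g = g + f"
    by transfer (auto simp: l2_rel_def add.commute intro!: square_integrable_add)
  show "0 + f = f"
    by transfer (auto simp: l2_rel_def)
  show "- f + f = 0"
    by transfer (auto simp: l2_rel_def)
  show "f - g = f + - g"
    by transfer (auto simp: l2_rel_def intro!: square_integrable_diff)
  show "a *\<^sub>R (f + g) = a *\<^sub>R f + a *\<^sub>R g"
    unfolding scaleR_l2_def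
    by transfer (auto simp: l2_rel_def distrib_left distrib_right
        intro!: square_integrable_add square_integrable_cmult)
  show "(a + b) *\<^sub>R f = a *\<^sub>R f + b *\<^sub>R f"
    unfolding scaleR_l2_def
    by transfer (auto simp: l2_rel_def distrib_left distrib_right
        intro!: square_integrable_add square_integrable_cmult)
  show "a *\<^sub>R b *\<^sub>R f = (a * b) *\<^sub>R f"
    unfolding scaleR_l2_def
    by transfer (auto simp: l2_rel_def mult.assoc intro!: square_integrable_cmult)
  show "1 *\<^sub>R f = f"
    unfolding scaleR_l2_def by transfer (auto simp: l2_rel_def)
  show "dist f g = norm (f - g)"
    by (rule dist_l2_def)
  show "sgn f = scaleR (inverse (norm f)) f"
    by (rule sgn_l2_def)
  show "uniformity = (INF e\<in>{0<..}. principal {(x, y). dist x y < (e::real)} :: ('a l2 \<times> 'a l2) filter)"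
    by (rule uniformity_l2_def)
  show "open U \<longleftrightarrow> (\<forall>x\<in>U. eventually (\<lambda>(x', y). x' = x \<longrightarrow> y \<in> U) uniformity)"
    by (rule open_l2_def)
  show "norm f = sqrt (inner f f)"
    by (rule norm_l2_def)
  show "inner f g = inner g f"
  proof -
    have "cinner f g = cnj (cinner g f)"
      by transfer (subst Bochner_Integration.integral_cnj[symmetric], simp add: mult.commute)
    then show ?thesis
      by (simp add: inner_l2_def)
  qed
  show "inner (f + g) h = inner f h + inner g h"
  proof -
    have "cinner (f + g) h = cinner f h + cinner g h"
      by transfer (simp add: l2_rel_def distrib_right square_integrable_mult_cnj)
    then show ?thesis
      by (simp add: inner_l2_def)
  qed
  show "inner (r *\<^sub>R f) g = r * inner f g"
  proof -
    have "cinner (r *\<^sub>R f) g = complex_of_real r * cinner f g"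
      unfolding scaleR_l2_def by transfer (simp add: mult.assoc)
    then show ?thesis
      by (simp add: inner_l2_def)
  qed
  have eq: "f x * cnj (f x) = complex_of_real ((cmod (f x))\<^sup>2)" for f :: "'a \<Rightarrow> complex" and x
    by (simp add: complex_norm_square[symmetric])
  show "0 \<le> inner f f"
    unfolding inner_l2_def by transfer (simp add: eq del: of_real_power)
  show "inner f f = 0 \<longleftrightarrow> f = 0"
    unfolding inner_l2_def
  proof transfer
    fix f :: "'a \<Rightarrow> complex"
    assume "l2_rel f f"
    then have f: "square_integrable f"
      by (simp add: l2_rel_def)
    then have "Re (LINT x|lborel. f x * cnj (f x)) = 0 \<longleftrightarrow> (AE x in lborel. (cmod (f x))\<^sup>2 = 0)"
      by (simp add: eq integral_nonneg_eq_0_iff_AE square_integrable_def del: of_real_power)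
    also have "\<dots> \<longleftrightarrow> l2_rel f (\<lambda>x. 0)"
      using f by (simp add: l2_rel_def)
    finally show "Re (LINT x|lborel. f x * cnj (f x)) = 0 \<longleftrightarrow> l2_rel f (\<lambda>x. 0)" .
  qed
qed

end


section \<open>Time-frequency shifts\<close>

definition tf_shift_fun :: "'a \<times> 'a \<Rightarrow> ('a::euclidean_space \<Rightarrow> complex) \<Rightarrow> 'a \<Rightarrow> complex" where
  "tf_shift_fun z f t =
     exp (2 * complex_of_real pi * \<i> * complex_of_real (inner (snd z) t)) * f (t - fst z)"

lift_definition tf_shift :: "'a \<times> 'a \<Rightarrow> 'a::euclidean_space l2 \<Rightarrow> 'a l2" is tf_shift_fun
proof -
  fix z :: "'a \<times> 'a" and f g :: "'a \<Rightarrow> complex"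
  assume "l2_rel f g"
  then have f: "square_integrable f" and g: "square_integrable g"
    and ae: "AE x in lborel. f x = g x"
    by (auto simp: l2_rel_def)
  have shift: "distr lborel borel ((+) (- fst z)) = (lborel :: 'a measure)"
    by (rule lborel_distr_plus)
  have sq: "square_integrable (tf_shift_fun z h)" if h: "square_integrable h" for h
  proof -
    have [measurable]: "h \<in> borel_measurable borel"
      using h by (simp add: square_integrable_def)
    have "integrable (distr lborel borel ((+) (- fst z))) (\<lambda>x. (cmod (h x))\<^sup>2)"
      using h by (simp add: shift square_integrable_def)
    then have "integrable lborel (\<lambda>t. (cmod (h (t - fst z)))\<^sup>2)"
      by (subst (asm) integrable_distr_eq) (auto simp: algebra_simps)
    moreover have "cmod (tf_shift_fun z h t) = cmod (h (t - fst z))" for t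
      by (simp add: tf_shift_fun_def norm_mult)
    moreover have "tf_shift_fun z h \<in> borel_measurable lborel"
      unfolding tf_shift_fun_def by measurable
    ultimately show ?thesis
      by (simp add: square_integrable_def)
  qed
  have [measurable]: "f \<in> borel_measurable borel" "g \<in> borel_measurable borel"
    using f g by (simp_all add: square_integrable_def)
  have "AE x in distr lborel borel ((+) (- fst z)). f x = g x"
    unfolding shift by (rule ae)
  then have "AE t in lborel. f (t - fst z) = g (t - fst z)"
    by (subst (asm) AE_distr_iff) (auto simp: algebra_simps)
  then have "AE t in lborel. tf_shift_fun z f t = tf_shift_fun z g t"
    by (rule eventually_mono) (simp add: tf_shift_fun_def)
  then show "l2_rel (tf_shift_fun z f) (tf_shift_fun z g)"
    using sq f g by (simp add: l2_rel_def)
qed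


section \<open>Trace-class operators\<close>

definition bounded_clinear :: "('a::euclidean_space l2 \<Rightarrow> 'a l2) \<Rightarrow> bool" where
  "bounded_clinear T \<longleftrightarrow> bounded_linear T \<and> (\<forall>c \<psi>. T (c *\<^sub>C \<psi>) = c *\<^sub>C T \<psi>)"

definition cadjoint :: "('a::euclidean_space l2 \<Rightarrow> 'a l2) \<Rightarrow> 'a l2 \<Rightarrow> 'a l2" where
  "cadjoint T = (THE T'. \<forall>\<psi> \<phi>. cinner (T \<psi>) \<phi> = cinner \<psi> (T' \<phi>))"

definition positive_operator :: "('a::euclidean_space l2 \<Rightarrow> 'a l2) \<Rightarrow> bool" where
  "positive_operator P \<longleftrightarrow>
     bounded_clinear P \<and> (\<forall>\<psi>. cinner (P \<psi>) \<psi> \<in> \<real> \<and> 0 \<le> Re (cinner (P \<psi>) \<psi>))"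

text \<open>\<open>|T|\<close>, the unique positive square root of \<open>T\<^sup>*T\<close>.\<close>

definition abs_operator :: "('a::euclidean_space l2 \<Rightarrow> 'a l2) \<Rightarrow> 'a l2 \<Rightarrow> 'a l2" where
  "abs_operator T = (THE P. positive_operator P \<and> P \<circ> P = cadjoint T \<circ> T)"

text \<open>An orthonormal basis is an orthonormal set with trivial orthogonal complement.\<close>

definition orthonormal_basis :: "'a::euclidean_space l2 set \<Rightarrow> bool" where
  "orthonormal_basis E \<longleftrightarrow>
     (\<forall>e\<in>E. \<forall>e'\<in>E. cinner e e' = (if e = e' then 1 else 0)) \<and>
     (\<forall>\<psi>. (\<forall>e\<in>E. cinner \<psi> e = 0) \<longrightarrow> \<psi> = 0)"

text \<open>
  The trace \<open>\<Sum>e. \<langle>|T|e, e\<rangle>\<close> of the positive operator \<open>|T|\<close>, and its finiteness, do not depend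
  on the orthonormal basis, so both are expressed with one fixed basis.
\<close>

definition some_onb :: "'a::euclidean_space l2 set" where
  "some_onb = (SOME E. orthonormal_basis E)"

definition trace_class :: "('a::euclidean_space l2 \<Rightarrow> 'a l2) \<Rightarrow> bool" where
  "trace_class T \<longleftrightarrow>
     bounded_clinear T \<and> (\<lambda>e. Re (cinner (abs_operator T e) e)) summable_on some_onb"

definition trace_norm :: "('a::euclidean_space l2 \<Rightarrow> 'a l2) \<Rightarrow> real" where
  "trace_norm T = (\<Sum>\<^sub>\<infinity>e\<in>some_onb. Re (cinner (abs_operator T e) e))"

definition complex_span ::
    "('a::euclidean_space l2 \<Rightarrow> 'a l2) set \<Rightarrow> ('a l2 \<Rightarrow> 'a l2) set" where
  "complex_span A = {\<lambda>\<psi>. \<Sum>T\<in>F. c T *\<^sub>C T \<psi> |F c. finite F \<and> F \<subseteq> A}"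

text \<open>Closure in the trace norm, inside the space of trace-class operators.\<close>

definition trace_norm_closure ::
    "('a::euclidean_space l2 \<Rightarrow> 'a l2) set \<Rightarrow> ('a l2 \<Rightarrow> 'a l2) set" where
  "trace_norm_closure A =
     {T. trace_class T \<and> (\<forall>\<epsilon>>0. \<exists>L\<in>A. trace_norm (\<lambda>\<psi>. T \<psi> - L \<psi>) < \<epsilon>)}"


section \<open>Complex measures\<close>

text \<open>
  Countably additive complex-valued functions on the Borel sets, normalised to 0 elsewhere so
  that equality of complex measures is equality of functions. Boundedness is automatic.
\<close>

definition complex_measure :: "('b::topological_space set \<Rightarrow> complex) \<Rightarrow> bool" where
  "complex_measure \<mu> \<longleftrightarrow>
     (\<forall>A. A \<notin> sets borel \<longrightarrow> \<mu> A = 0) \<and>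
     (\<forall>A :: nat \<Rightarrow> 'b set. range A \<subseteq> sets borel \<and> disjoint_family A \<longrightarrow>
        (\<lambda>n. \<mu> (A n)) sums \<mu> (\<Union>n. A n))"

definition total_variation_norm :: "('b::topological_space set \<Rightarrow> complex) \<Rightarrow> real" where
  "total_variation_norm \<mu> =
     (SUP P \<in> {P. finite P \<and> partition_on UNIV P \<and> P \<subseteq> sets borel}. \<Sum>A\<in>P. cmod (\<mu> A))"

text \<open>
  Positive part of the Jordan decomposition of a real measure \<open>\<nu>\<close>:
  \<open>\<nu>\<^sup>+ A = sup {\<nu> B | B \<subseteq> A}\<close>. The negative part is the positive part of \<open>-\<nu>\<close>.
\<close>

definition positive_part_measure :: "('b::topological_space set \<Rightarrow> real) \<Rightarrow> 'b measure" where
  "positive_part_measure \<nu> =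
     measure_of UNIV (sets borel) (\<lambda>A. SUP B \<in> {B \<in> sets borel. B \<subseteq> A}. ennreal (\<nu> B))"

definition complex_measure_integrable ::
    "('b::topological_space set \<Rightarrow> complex) \<Rightarrow> ('b \<Rightarrow> complex) \<Rightarrow> bool" where
  "complex_measure_integrable \<mu> f \<longleftrightarrow>
     integrable (positive_part_measure (\<lambda>A. Re (\<mu> A))) f \<and>
     integrable (positive_part_measure (\<lambda>A. - Re (\<mu> A))) f \<and>
     integrable (positive_part_measure (\<lambda>A. Im (\<mu> A))) f \<and>
     integrable (positive_part_measure (\<lambda>A. - Im (\<mu> A))) f"

definition complex_measure_integral ::
    "('b::topological_space set \<Rightarrow> complex) \<Rightarrow> ('b \<Rightarrow> complex) \<Rightarrow> complex" where
  "complex_measure_integral \<mu> f =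
     (LINT x|positive_part_measure (\<lambda>A. Re (\<mu> A)). f x) -
     (LINT x|positive_part_measure (\<lambda>A. - Re (\<mu> A)). f x) +
     \<i> * ((LINT x|positive_part_measure (\<lambda>A. Im (\<mu> A)). f x) -
          (LINT x|positive_part_measure (\<lambda>A. - Im (\<mu> A)). f x))"

definition dirac_measure :: "'b::topological_space \<Rightarrow> 'b set \<Rightarrow> complex" where
  "dirac_measure z A = (if A \<in> sets borel then indicator A z else 0)"

definition measure_convolution ::
    "('b::euclidean_space set \<Rightarrow> complex) \<Rightarrow> ('b set \<Rightarrow> complex) \<Rightarrow> 'b set \<Rightarrow> complex" where
  "measure_convolution \<mu> \<nu> A =
     (if A \<in> sets borel
      then complex_measure_integral \<mu> (\<lambda>x. complex_measure_integral \<nu> (\<lambda>y. indicator A (x + y)))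
      else 0)"

text \<open>The embedding of \<open>L\<^sup>1\<close> into the complex measures.\<close>

definition L1_measure :: "('b::euclidean_space \<Rightarrow> complex) \<Rightarrow> 'b set \<Rightarrow> complex" where
  "L1_measure f A = (if A \<in> sets borel then (LINT x:A|lborel. f x) else 0)"


section \<open>The measure-operator convolution\<close>

definition measure_operator_convolution ::
    "((('a \<times> 'a) set \<Rightarrow> complex) \<Rightarrow> ('a l2 \<Rightarrow> 'a l2) \<Rightarrow> 'a::euclidean_space l2 \<Rightarrow> 'a l2) \<Rightarrow> bool" where
  "measure_operator_convolution conv \<longleftrightarrow>
     (\<forall>\<mu> S. complex_measure \<mu> \<and> trace_class S \<longrightarrow> trace_class (conv \<mu> S)) \<and>
     \<comment> \<open>bilinearity\<close>
     (\<forall>\<mu> \<nu> S. complex_measure \<mu> \<and> complex_measure \<nu> \<and> trace_class S \<longrightarrow>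
        conv (\<lambda>A. \<mu> A + \<nu> A) S = (\<lambda>\<psi>. conv \<mu> S \<psi> + conv \<nu> S \<psi>)) \<and>
     (\<forall>c \<mu> S. complex_measure \<mu> \<and> trace_class S \<longrightarrow>
        conv (\<lambda>A. c * \<mu> A) S = (\<lambda>\<psi>. c *\<^sub>C conv \<mu> S \<psi>)) \<and>
     (\<forall>\<mu> S T. complex_measure \<mu> \<and> trace_class S \<and> trace_class T \<longrightarrow>
        conv \<mu> (\<lambda>\<psi>. S \<psi> + T \<psi>) = (\<lambda>\<psi>. conv \<mu> S \<psi> + conv \<mu> T \<psi>)) \<and>
     (\<forall>c \<mu> S. complex_measure \<mu> \<and> trace_class S \<longrightarrow>
        conv \<mu> (\<lambda>\<psi>. c *\<^sub>C S \<psi>) = (\<lambda>\<psi>. c *\<^sub>C conv \<mu> S \<psi>)) \<and>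
     \<comment> \<open>point measures act by conjugation with time-frequency shifts\<close>
     (\<forall>z S. trace_class S \<longrightarrow>
        conv (dirac_measure z) S = tf_shift z \<circ> S \<circ> cadjoint (tf_shift z)) \<and>
     (\<forall>\<mu> S. complex_measure \<mu> \<and> trace_class S \<longrightarrow>
        trace_norm (conv \<mu> S) \<le> total_variation_norm \<mu> * trace_norm S) \<and>
     (\<forall>\<mu> \<nu> S. complex_measure \<mu> \<and> complex_measure \<nu> \<and> trace_class S \<longrightarrow>
        conv \<mu> (conv \<nu> S) = conv (measure_convolution \<mu> \<nu>) S) \<and>
     trace_norm_closure
       (complex_span {conv (L1_measure f) S |f S. integrable lborel f \<and> trace_class S})
       = Collect trace_class"

end

theory Submission
  imports Defs
begin

text \<open>
  Write \<open>\<mu> \<star> S\<close> for the convolution. The operator \<open>\<pi>(z) S \<pi>(z)\<^sup>*\<close> is \<open>\<delta>\<^sub>z \<star> S\<close>, so the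
  assertion is that the measure \<open>\<mu>\<close>, which is the superposition of the point measures \<open>\<delta>\<^sub>z\<close> with
  weights \<open>d\<mu>(z)\<close>, may be decomposed inside a matrix coefficient of \<open>\<mu> \<star> S\<close>. The convolution is
  continuous in the total variation norm of the measure, but in general the superposition does not
  converge in that norm. It does converge after smoothing. For \<open>S = g \<star> T\<close> with \<open>g\<close> integrable,
  associativity gives \<open>\<mu> \<star> S = (\<mu> * g) \<star> T\<close>. Translation is continuous in \<open>L\<^sup>1\<close>, so \<open>\<mu> * g\<close> is
  a limit in total variation of the measures \<open>\<Sum>w. \<mu> (s = w) (\<delta>\<^sub>w * g)\<close>, where \<open>s\<close> runs through
  simple maps converging pointwise to the identity (\<open>total_variation_discretisation_le\<close>). For each \<open>s\<close> the
  formula is bilinearity, and dominated convergence gives the formula for \<open>\<mu>\<close> itself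
  (\<open>weak_formula_L1\<close>). By assumption the operators \<open>g \<star> T\<close> span a dense subspace of the trace
  class, and both sides of the formula are continuous in \<open>S\<close> for the trace norm
  (\<open>weak_formula_trace_class\<close>).

  The argument uses two facts about the trace norm, which is defined by means of the modulus \<open>|T|\<close>:
  matrix coefficients are bounded by it (\<open>trace_class_cinner_le\<close>), and sums of trace-class operators
  are of trace class (\<open>trace_class_add\<close>). Both rest on the existence and uniqueness of positive
  square roots, first to know that \<open>|T|\<close> exists, and then to compare traces with Hilbert-Schmidt sums.
  This part takes place in real Hilbert spaces: \<open>L\<^sup>2\<close> is regarded as a real space, and complex
  linearity is commutation with multiplication by \<open>\<i>\<close>. The polar decomposition is replaced by an
  approximate one with the contraction \<open>T (|T| + \<epsilon>)\<inverse>\<close>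
  (\<open>approximate_polar_decomposition\<close>).

  On the side of measures, the four Jordan parts of a complex measure are shown to be finite
  measures that recombine to it, and continuity of translation in \<open>L\<^sup>1\<close> is derived from outer
  regularity of Lebesgue measure.
\<close>

section \<open>Orthogonal complements and adjoints in a real Hilbert space\<close>

text \<open>
  If \<open>x\<close> lies outside \<open>V\<close>, the parallelogram law makes every minimising sequence for the
  distance from \<open>x\<close> to \<open>V\<close> Cauchy; its limit \<open>z\<close> is a nearest point, and the minimality of
  \<open>\<parallel>x - z\<parallel>\<close> along each line through \<open>z\<close> in \<open>V\<close> makes \<open>x - z\<close> orthogonal to \<open>V\<close>.
  This single consequence of completeness drives the Riesz representation, the density of the span
  of an orthonormal basis and the surjectivity of \<open>P + \<epsilon>\<close> below.
\<close>

lemma closed_subspace_orthogonal_vector: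
  fixes V :: "'a::{real_inner, banach} set"
  assumes V: "subspace V" "closed V" "V \<noteq> UNIV"
  shows "\<exists>w. w \<noteq> 0 \<and> (\<forall>v\<in>V. inner v w = 0)"
proof -
  obtain x where x: "x \<notin> V"
    using V(3) by auto
  define q where "q y = (norm (x - y))\<^sup>2" for y
  define D where "D = (INF y\<in>V. q y)"
  have bdd: "bdd_below (q ` V)"
    by (rule bdd_belowI[of _ 0]) (auto simp: q_def)
  have D_le: "D \<le> q y" if "y \<in> V" for y
    unfolding D_def using bdd that by (rule cINF_lower)
  have "\<exists>y\<in>V. q y < D + 1 / real (Suc n)" for n
  proof -
    have "V \<noteq> {}"
      using subspace_0[OF V(1)] by auto
    moreover have "(INF y\<in>V. q y) < D + 1 / real (Suc n)"
      by (simp add: D_def)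
    ultimately show ?thesis
      using cINF_less_iff[OF _ bdd] by blast
  qed
  then obtain y where yV: "\<And>n. y n \<in> V" and y: "\<And>n. q (y n) < D + 1 / real (Suc n)"
    by metis
  have diff: "(norm (y m - y n))\<^sup>2 \<le> 2 / real (Suc m) + 2 / real (Suc n)" for m n
  proof -
    \<comment> \<open>The parallelogram law applies because the squared distance of the midpoint from \<open>x\<close> is at least \<open>D\<close>.\<close>
    have mid: "(1/2) *\<^sub>R (y m + y n) \<in> V"
      using V(1) yV by (intro subspace_scale subspace_add)
    have "(norm (y m - y n))\<^sup>2 = 2 * q (y m) + 2 * q (y n) - 4 * q ((1/2) *\<^sub>R (y m + y n))"
      unfolding q_def power2_norm_eq_inner
      by (simp add: inner_diff_left inner_diff_right inner_add_left inner_add_right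
          inner_commute algebra_simps)
    then show ?thesis
      using D_le[OF mid] y[of m] y[of n] by simp
  qed
  have "Cauchy y"
  proof (rule CauchyI')
    fix e :: real assume e: "0 < e"
    obtain N where N: "4 / e\<^sup>2 < real N"
      using reals_Archimedean2 by blast
    have "dist (y m) (y n) < e" if "m \<ge> N" "n > m" for m n
    proof -
      have "2 / real (Suc m) \<le> 2 / real (Suc N)" "2 / real (Suc n) \<le> 2 / real (Suc N)"
        using that by (auto intro!: divide_left_mono)
      moreover have "4 / real (Suc N) < e\<^sup>2"
      proof -
        have "4 < real N * e\<^sup>2"
          using N e by (simp add: field_simps)
        moreover have "0 < e\<^sup>2"
          using e by simp
        ultimately have "4 < e\<^sup>2 + real N * e\<^sup>2"
          by linarith
        then show ?thesis
          using e by (simp add: field_simps)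
      qed
      ultimately have "(norm (y m - y n))\<^sup>2 < e\<^sup>2"
        using diff[of m n] by linarith
      then show ?thesis
        using e by (simp add: dist_norm power2_less_imp_less)
    qed
    then show "\<exists>M. \<forall>m\<ge>M. \<forall>n>m. dist (y m) (y n) < e"
      by blast
  qed
  then obtain z where z: "y \<longlonglongrightarrow> z"
    using convergent_eq_Cauchy by blast
  have zV: "z \<in> V"
    using closed_sequentially[OF V(2)] yV z by blast
  have "q z \<le> D"
  proof (rule LIMSEQ_le)
    show "(\<lambda>n. q (y n)) \<longlonglongrightarrow> q z"
      unfolding q_def by (intro tendsto_intros z)
    show "(\<lambda>n. D + 1 / real (Suc n)) \<longlonglongrightarrow> D"
      using tendsto_add[OF tendsto_const LIMSEQ_inverse_real_of_nat, of D]
      by (simp add: inverse_eq_divide)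
    show "\<exists>N. \<forall>n\<ge>N. q (y n) \<le> D + 1 / real (Suc n)"
      using y less_imp_le by blast
  qed
  then have min: "q z \<le> q v" if "v \<in> V" for v
    using D_le[OF that] by linarith
  have "inner v (x - z) = 0" if v: "v \<in> V" for v
  proof (cases "v = 0")
    case False
    define t where "t = inner v (x - z) / inner v v"
    have vv: "inner v v > 0"
      using False by simp
    have "q z \<le> q (z + t *\<^sub>R v)"
      by (intro min subspace_add subspace_scale V(1) zV v)
    also have "q (z + t *\<^sub>R v) = q z - 2 * t * inner v (x - z) + t\<^sup>2 * inner v v"
      unfolding q_def power2_norm_eq_inner
      by (simp add: inner_diff_left inner_diff_right inner_add_left inner_add_right
          inner_commute algebra_simps power2_eq_square)
    also have "\<dots> = q z - (inner v (x - z))\<^sup>2 / inner v v"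
      using vv by (simp add: t_def power2_eq_square field_simps)
    finally show ?thesis
      using vv by (simp add: divide_le_0_iff)
  qed simp
  moreover have "x - z \<noteq> 0"
    using x zV by auto
  ultimately show ?thesis
    by blast
qed

lemma riesz_representation:
  fixes f :: "'a::{real_inner, banach} \<Rightarrow> real"
  assumes f: "bounded_linear f"
  shows "\<exists>y. \<forall>x. f x = inner x y"
proof (cases "\<forall>x. f x = 0")
  case True
  then show ?thesis
    by (intro exI[of _ 0]) simp
next
  case False
  interpret bounded_linear f by fact
  have "closed (f -` {0})"
    by (intro closed_vimage continuous_at_imp_continuous_on) (auto intro: isCont)
  moreover have "subspace (f -` {0})"
    by (auto simp: subspace_def add scaleR zero)
  ultimately obtain w where w: "w \<noteq> 0" "\<And>v. f v = 0 \<Longrightarrow> inner v w = 0"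
    using closed_subspace_orthogonal_vector[of "f -` {0}"] False
    by (metis UNIV_I vimage_singleton_eq)
  have fw: "f w \<noteq> 0"
    using w(1) w(2)[of w] by auto
  have "f x = inner x ((f w / inner w w) *\<^sub>R w)" for x
  proof -
    have "f (x - (f x / f w) *\<^sub>R w) = 0"
      using fw by (simp add: diff scaleR)
    then have "inner (x - (f x / f w) *\<^sub>R w) w = 0"
      by (rule w)
    then show ?thesis
      using fw w(1) by (simp add: inner_diff_left field_simps)
  qed
  then show ?thesis
    by blast
qed

lemma inner_adjoint:
  fixes T :: "'a::{real_inner, banach} \<Rightarrow> 'a"
  assumes T: "bounded_linear T"
  shows "inner (T x) y = inner x (adjoint T y)"
proof -
  have "\<exists>z. \<forall>x. inner (T x) y = inner x z" for y
    by (rule riesz_representation)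
       (rule bounded_linear_compose[OF bounded_linear_inner_left T])
  then have "\<exists>T'. \<forall>x y. inner (T x) y = inner x (T' y)"
    by metis
  then show ?thesis
    unfolding adjoint_def by (rule someI2_ex) blast
qed

lemma norm_adjoint_le:
  fixes T :: "'a::{real_inner, banach} \<Rightarrow> 'a"
  assumes T: "bounded_linear T" and K: "\<And>x. norm (T x) \<le> K * norm x"
  shows "norm (adjoint T y) \<le> K * norm y"
proof (cases "adjoint T y = 0")
  case True
  have "0 \<le> K * norm y"
    using order_trans[OF norm_ge_zero K] .
  then show ?thesis
    using True by simp
next
  case False
  let ?z = "adjoint T y"
  have "norm ?z * norm ?z = inner (T ?z) y"
    by (simp add: inner_adjoint[OF T] flip: power2_norm_eq_inner power2_eq_square)
  also have "\<dots> \<le> norm (T ?z) * norm y"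
    by (rule norm_cauchy_schwarz)
  also have "\<dots> \<le> K * norm ?z * norm y"
    by (intro mult_right_mono K) simp
  finally show ?thesis
    using False by (simp add: mult.commute mult.left_commute)
qed

lemma bounded_linear_adjoint:
  fixes T :: "'a::{real_inner, banach} \<Rightarrow> 'a"
  assumes T: "bounded_linear T"
  shows "bounded_linear (adjoint T)"
proof -
  obtain K where K: "\<And>x. norm (T x) \<le> norm x * K"
    using bounded_linear.bounded[OF T] by blast
  show ?thesis
  proof (rule bounded_linear_intro)
    fix x y :: 'a and r :: real
    have "\<forall>z. inner z (adjoint T (x + y)) = inner z (adjoint T x + adjoint T y)"
      by (simp add: inner_add_right flip: inner_adjoint[OF T])
    then show "adjoint T (x + y) = adjoint T x + adjoint T y"
      by (rule iffD1[OF vector_eq_ldot])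
    have "\<forall>z. inner z (adjoint T (r *\<^sub>R x)) = inner z (r *\<^sub>R adjoint T x)"
      by (simp flip: inner_adjoint[OF T])
    then show "adjoint T (r *\<^sub>R x) = r *\<^sub>R adjoint T x"
      by (rule iffD1[OF vector_eq_ldot])
    show "norm (adjoint T x) \<le> norm x * K"
      using norm_adjoint_le[OF T, of K x] K by (simp add: mult.commute)
  qed
qed

section \<open>Square roots of positive operators\<close>

text \<open>
  Operators on a complex Hilbert space are treated as real-linear maps for the real part of the inner
  product. Over the reals, nonnegativity of the quadratic form does not imply symmetry, so symmetry is
  part of the definition.
\<close>

definition psd_operator :: "('a::real_inner \<Rightarrow> 'a) \<Rightarrow> bool" where
  "psd_operator P \<longleftrightarrow> bounded_linear P \<and> (\<forall>x y. inner (P x) y = inner x (P y)) \<and>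
     (\<forall>x. 0 \<le> inner (P x) x)"

lemma psd_bounded_linear: "psd_operator P \<Longrightarrow> bounded_linear P"
  and psd_sym: "psd_operator P \<Longrightarrow> inner (P x) y = inner x (P y)"
  and psd_nonneg: "psd_operator P \<Longrightarrow> 0 \<le> inner (P x) x"
  by (auto simp: psd_operator_def)

text \<open>
  \<open>\<langle>P x, y\<rangle>\<close> is a semi-inner product: the quadratic polynomial \<open>\<langle>P (x + t y), x + t y\<rangle>\<close> in \<open>t\<close>
  has no sign change, so its discriminant is nonpositive.
\<close>

lemma psd_cauchy_schwarz:
  assumes P: "psd_operator P"
  shows "(inner (P x) y)\<^sup>2 \<le> inner (P x) x * inner (P y) y"
proof -
  interpret bounded_linear P by (rule psd_bounded_linear[OF P])
  let ?a = "inner (P x) x" and ?b = "inner (P x) y" and ?c = "inner (P y) y"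
  have quad: "0 \<le> ?a + 2 * t * ?b + t\<^sup>2 * ?c" for t
  proof -
    have "inner (P y) x = ?b"
      by (metis psd_sym[OF P] inner_commute)
    then have "inner (P (x + t *\<^sub>R y)) (x + t *\<^sub>R y) = ?a + 2 * t * ?b + t\<^sup>2 * ?c"
      by (simp add: add scaleR inner_add_left inner_add_right power2_eq_square algebra_simps)
    then show ?thesis
      using psd_nonneg[OF P, of "x + t *\<^sub>R y"] by simp
  qed
  show ?thesis
  proof (cases "?c = 0")
    case True
    have "?b = 0"
    proof (rule ccontr)
      assume b: "?b \<noteq> 0"
      show False
        using quad[of "- (?a + 1) / (2 * ?b)"] True b by (simp add: field_simps)
    qed
    then show ?thesis
      using True by simp
  next
    case False
    then have c: "?c > 0"
      using psd_nonneg[OF P, of y] by simp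
    show ?thesis
      using quad[of "- ?b / ?c"] c by (simp add: field_simps power2_eq_square)
  qed
qed

lemma psd_eq_0:
  assumes P: "psd_operator P" and x: "inner (P x) x = 0"
  shows "P x = 0"
  using psd_cauchy_schwarz[OF P, of x "P x"] x by simp

lemma psd_norm_le:
  assumes P: "psd_operator P" and K: "\<And>x. inner (P x) x \<le> K * (norm x)\<^sup>2" "0 \<le> K"
  shows "norm (P x) \<le> K * norm x"
proof (cases "P x = 0")
  case False
  have "((norm (P x))\<^sup>2)\<^sup>2 \<le> inner (P x) x * inner (P (P x)) (P x)"
    using psd_cauchy_schwarz[OF P, of x "P x"] by (simp add: power2_norm_eq_inner)
  also have "\<dots> \<le> (K * (norm x)\<^sup>2) * (K * (norm (P x))\<^sup>2)"
    using K psd_nonneg[OF P] by (intro mult_mono) auto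
  also have "\<dots> = (K * norm x)\<^sup>2 * (norm (P x))\<^sup>2"
    by (simp add: power_mult_distrib power2_eq_square)
  finally have "(norm (P x))\<^sup>2 * (norm (P x))\<^sup>2 \<le> (K * norm x)\<^sup>2 * (norm (P x))\<^sup>2"
    unfolding power2_eq_square[of "(norm (P x))\<^sup>2"] .
  then have "(norm (P x))\<^sup>2 \<le> (K * norm x)\<^sup>2"
    by (rule mult_right_le_imp_le) (use False in simp)
  then show ?thesis
    by (rule power2_le_imp_le) (use K(2) in simp)
qed (use K in simp)

text \<open>
  For \<open>B = 1 - A\<close>, a solution \<open>Z\<close> of \<open>2 Z = B + Z\<^sup>2\<close> satisfies \<open>(1 - Z)\<^sup>2 = A\<close>. The fixed point
  iteration for \<open>Z\<close> starts at \<open>0\<close>, so every iterate is a polynomial in \<open>B\<close>.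
\<close>

primrec sqrt_iter :: "('a::real_normed_vector \<Rightarrow> 'a) \<Rightarrow> nat \<Rightarrow> 'a \<Rightarrow> 'a" where
  "sqrt_iter B 0 = (\<lambda>x. 0)"
| "sqrt_iter B (Suc n) = (\<lambda>x. (1/2) *\<^sub>R (B x + sqrt_iter B n (sqrt_iter B n x)))"

text \<open>
  The same iteration for the number \<open>1\<close> in place of \<open>B\<close>. Its iterates and their increments
  dominate the norms of the operator iterates and of their increments whenever \<open>\<parallel>B\<parallel> \<le> 1\<close>; as a
  bounded increasing real sequence it converges, and so do the operator iterates.
\<close>

primrec sqrt_majorant :: "nat \<Rightarrow> real" where
  "sqrt_majorant 0 = 0"
| "sqrt_majorant (Suc n) = (1 + (sqrt_majorant n)\<^sup>2) / 2"

lemma sqrt_majorant_bounds: "0 \<le> sqrt_majorant n" "sqrt_majorant n \<le> 1"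
proof -
  have "0 \<le> sqrt_majorant n \<and> sqrt_majorant n \<le> 1"
    by (induction n) (auto simp: power_le_one)
  then show "0 \<le> sqrt_majorant n" "sqrt_majorant n \<le> 1"
    by auto
qed

lemma convergent_sqrt_majorant: "convergent sqrt_majorant"
proof (rule Bseq_monoseq_convergent)
  show "Bseq sqrt_majorant"
    by (rule BseqI'[of _ 1]) (use sqrt_majorant_bounds in auto)
  show "monoseq sqrt_majorant"
  proof (rule mono_SucI1, rule allI)
    show "sqrt_majorant n \<le> sqrt_majorant (Suc n)" for n
      using zero_le_power2[of "1 - sqrt_majorant n"] by (simp add: power2_eq_square algebra_simps)
  qed
qed

context
  fixes B :: "'a::{real_inner, banach} \<Rightarrow> 'a"
  assumes B: "bounded_linear B" "\<And>x. norm (B x) \<le> norm x"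
begin

lemma linear_sqrt_iter: "linear (sqrt_iter B n)"
proof (induction n)
  case (Suc n)
  have "linear B"
    using B(1) by (rule bounded_linear.linear)
  with Suc show ?case
    by (auto simp: linear_iff algebra_simps)
qed (simp add: linear_iff)

lemma norm_sqrt_iter: "norm (sqrt_iter B n x) \<le> sqrt_majorant n * norm x"
proof (induction n arbitrary: x)
  case (Suc n)
  have "norm (sqrt_iter B n (sqrt_iter B n x)) \<le> sqrt_majorant n * (sqrt_majorant n * norm x)"
    using Suc sqrt_majorant_bounds(1) by (meson mult_left_mono order_trans)
  then have "norm (B x + sqrt_iter B n (sqrt_iter B n x)) \<le>
      norm x + sqrt_majorant n * (sqrt_majorant n * norm x)"
    using B(2)[of x] by (intro norm_triangle_mono)
  then show ?case
    by (simp add: power2_eq_square distrib_right mult.assoc del: scaleR_add_right)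
qed simp

text \<open>
  Write \<open>Y\<close> and \<open>Y'\<close> for consecutive iterates. Then
  \<open>Y'\<^sup>2 - Y\<^sup>2 = Y' (Y' - Y) + (Y' - Y) Y\<close>, and the scalar majorant satisfies the corresponding
  identity with equality.
\<close>

lemma norm_sqrt_iter_Suc_diff:
  "norm (sqrt_iter B (Suc n) x - sqrt_iter B n x) \<le> (sqrt_majorant (Suc n) - sqrt_majorant n) * norm x"
proof (induction n arbitrary: x)
  case 0
  then show ?case
    using B(2)[of x] by simp
next
  case (Suc n)
  let ?Y0 = "sqrt_iter B n" and ?Y1 = "sqrt_iter B (Suc n)"
  let ?a = "sqrt_majorant n" and ?b = "sqrt_majorant (Suc n)"
  have "norm (?Y1 (?Y1 x) - ?Y0 (?Y0 x)) = norm (?Y1 (?Y1 x - ?Y0 x) + (?Y1 (?Y0 x) - ?Y0 (?Y0 x)))"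
    by (simp add: linear_diff[OF linear_sqrt_iter, of "Suc n"] del: sqrt_iter.simps)
  also have "\<dots> \<le> ?b * ((?b - ?a) * norm x) + (?b - ?a) * (?a * norm x)"
  proof (rule norm_triangle_mono)
    show "norm (?Y1 (?Y1 x - ?Y0 x)) \<le> ?b * ((?b - ?a) * norm x)"
      by (rule order_trans[OF norm_sqrt_iter]) (intro mult_left_mono Suc.IH sqrt_majorant_bounds)
    have "0 \<le> ?b - ?a"
      using zero_le_power2[of "1 - ?a"] by (simp add: power2_eq_square algebra_simps)
    then show "norm (?Y1 (?Y0 x) - ?Y0 (?Y0 x)) \<le> (?b - ?a) * (?a * norm x)"
      by (intro order_trans[OF Suc.IH] mult_left_mono norm_sqrt_iter)
  qed
  also have "\<dots> = (?b\<^sup>2 - ?a\<^sup>2) * norm x"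
    by (simp add: power2_eq_square algebra_simps del: sqrt_majorant.simps)
  finally have main: "norm (?Y1 (?Y1 x) - ?Y0 (?Y0 x)) \<le> (?b\<^sup>2 - ?a\<^sup>2) * norm x" .
  have "sqrt_iter B (Suc (Suc n)) x - ?Y1 x = (1/2) *\<^sub>R (?Y1 (?Y1 x) - ?Y0 (?Y0 x))"
    unfolding sqrt_iter.simps(2)[of B "Suc n"] sqrt_iter.simps(2)[of B n, THEN fun_cong, of x]
    by (simp only: scaleR_diff_right scaleR_add_right) simp
  moreover have "sqrt_majorant (Suc (Suc n)) - ?b = (?b\<^sup>2 - ?a\<^sup>2) / 2"
    unfolding sqrt_majorant.simps(2)[of "Suc n"] by (simp add: field_simps)
  ultimately show ?case
    using main by (simp only: norm_scaleR)
qed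

lemma norm_sqrt_iter_diff:
  "n \<le> m \<Longrightarrow> norm (sqrt_iter B m x - sqrt_iter B n x) \<le> (sqrt_majorant m - sqrt_majorant n) * norm x"
proof (induction rule: dec_induct)
  case (step m)
  have "norm ((sqrt_iter B (Suc m) x - sqrt_iter B m x) + (sqrt_iter B m x - sqrt_iter B n x)) \<le>
     (sqrt_majorant (Suc m) - sqrt_majorant m) * norm x + (sqrt_majorant m - sqrt_majorant n) * norm x"
    by (intro norm_triangle_mono norm_sqrt_iter_Suc_diff step)
  then show ?case
    by (simp add: algebra_simps del: sqrt_iter.simps sqrt_majorant.simps)
qed simp

lemma convergent_sqrt_iter: "convergent (\<lambda>n. sqrt_iter B n x)"
proof -
  have "Cauchy (\<lambda>n. sqrt_iter B n x)"
  proof (rule CauchyI')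
    fix e :: real assume e: "0 < e"
    have "Cauchy sqrt_majorant"
      using convergent_sqrt_majorant by (rule convergent_Cauchy)
    moreover have "0 < e / (norm x + 1)"
      using e by (simp add: add_nonneg_pos)
    ultimately obtain N where N: "\<And>m n. m \<ge> N \<Longrightarrow> n \<ge> N \<Longrightarrow>
        norm (sqrt_majorant m - sqrt_majorant n) < e / (norm x + 1)"
      using CauchyD by blast
    have "dist (sqrt_iter B m x) (sqrt_iter B n x) < e" if "m \<ge> N" "n > m" for m n
    proof -
      have "norm (sqrt_iter B n x - sqrt_iter B m x) \<le> (sqrt_majorant n - sqrt_majorant m) * norm x"
        using that by (intro norm_sqrt_iter_diff) simp
      also have "\<dots> \<le> e / (norm x + 1) * norm x"
        using N[of n m] that by (intro mult_right_mono) auto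
      also have "\<dots> < e"
      proof -
        have "norm x + 1 > 0"
          by (simp add: add_nonneg_pos)
        then show ?thesis
          using e by (simp add: field_simps)
      qed
      finally show ?thesis
        by (simp add: dist_norm norm_minus_commute)
    qed
    then show "\<exists>M. \<forall>m\<ge>M. \<forall>n>m. dist (sqrt_iter B m x) (sqrt_iter B n x) < e"
      by blast
  qed
  then show ?thesis
    by (simp add: Cauchy_convergent)
qed

lemma symmetric_sqrt_iter:
  assumes "\<And>x y. inner (B x) y = inner x (B y)"
  shows "inner (sqrt_iter B n x) y = inner x (sqrt_iter B n y)"
  by (induction n arbitrary: x y) (auto simp: inner_add_left inner_add_right assms)

lemma commute_sqrt_iter:
  assumes "linear C" "\<And>x. C (B x) = B (C x)"
  shows "C (sqrt_iter B n x) = sqrt_iter B n (C x)"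
  using assms(1)
  by (induction n arbitrary: x) (auto simp: linear_add linear_cmul linear_0 assms(2))

end

text \<open>
  Commuting with \<open>A\<close> passes to the iterates, which are polynomials in \<open>B = 1 - A\<close>, and hence to
  their limit. This clause gives uniqueness of the square root, and it shows that the square
  root of a complex-linear operator is complex-linear.
\<close>

lemma psd_sqrt_exists_contraction:
  fixes A :: "'a::{real_inner, banach} \<Rightarrow> 'a"
  assumes A: "psd_operator A" and le: "\<And>x. inner (A x) x \<le> (norm x)\<^sup>2"
  shows "\<exists>P. psd_operator P \<and> (\<forall>x. P (P x) = A x) \<and>
    (\<forall>C. bounded_linear C \<and> (\<forall>x. C (A x) = A (C x)) \<longrightarrow> (\<forall>x. C (P x) = P (C x)))"
proof -
  interpret A: bounded_linear A
    by (rule psd_bounded_linear[OF A])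
  define B where "B x = x - A x" for x
  have Bpsd: "psd_operator B"
    unfolding psd_operator_def
  proof (intro conjI allI)
    show "bounded_linear B"
      unfolding B_def by (intro bounded_linear_sub bounded_linear_ident A.bounded_linear_axioms)
    show "inner (B x) y = inner x (B y)" for x y
      by (simp add: B_def inner_diff_left inner_diff_right psd_sym[OF A])
    show "0 \<le> inner (B x) x" for x
      using le[of x] by (simp add: B_def inner_diff_left power2_norm_eq_inner)
  qed
  have Bl: "bounded_linear B"
    using Bpsd by (rule psd_bounded_linear)
  have Bn: "norm (B x) \<le> norm x" for x
    using psd_norm_le[OF Bpsd, of 1 x] psd_nonneg[OF A]
    by (simp add: B_def inner_diff_left power2_norm_eq_inner)
  let ?Y = "sqrt_iter B"
  define Z where "Z x = lim (\<lambda>n. ?Y n x)" for x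
  have lim: "(\<lambda>n. ?Y n x) \<longlonglongrightarrow> Z x" for x
    using convergent_sqrt_iter[OF Bl Bn] by (simp add: Z_def convergent_LIMSEQ_iff)
  have Ynorm: "norm (?Y n x) \<le> norm x" for n x
    using norm_sqrt_iter[OF Bl Bn, of n x] mult_right_mono[OF sqrt_majorant_bounds(2)[of n], of "norm x"]
    by simp
  have Znorm: "norm (Z x) \<le> norm x" for x
    by (rule Lim_bounded[OF tendsto_norm[OF lim], of 0]) (simp add: Ynorm)
  have Zlin: "bounded_linear Z"
  proof (rule bounded_linear_intro)
    fix x y r
    have "(\<lambda>n. ?Y n (x + y)) \<longlonglongrightarrow> Z x + Z y"
      unfolding linear_add[OF linear_sqrt_iter[OF Bl Bn]] by (intro tendsto_intros lim)
    then show "Z (x + y) = Z x + Z y"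
      using LIMSEQ_unique lim by blast
    have "(\<lambda>n. ?Y n (r *\<^sub>R x)) \<longlonglongrightarrow> r *\<^sub>R Z x"
      unfolding linear_cmul[OF linear_sqrt_iter[OF Bl Bn]] by (intro tendsto_intros lim)
    then show "Z (r *\<^sub>R x) = r *\<^sub>R Z x"
      using LIMSEQ_unique lim by blast
    show "norm (Z x) \<le> norm x * 1"
      using Znorm by simp
  qed
  interpret Z: bounded_linear Z by fact
  have Zsym: "inner (Z x) y = inner x (Z y)" for x y
  proof (rule LIMSEQ_unique)
    show "(\<lambda>n. inner (?Y n x) y) \<longlonglongrightarrow> inner (Z x) y"
      by (intro tendsto_intros lim)
    show "(\<lambda>n. inner (?Y n x) y) \<longlonglongrightarrow> inner x (Z y)"
      unfolding symmetric_sqrt_iter[OF Bl Bn psd_sym[OF Bpsd]] by (intro tendsto_intros lim)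
  qed
  have Zfix: "2 *\<^sub>R Z x = B x + Z (Z x)" for x
  proof -
    have "(\<lambda>n. ?Y n (?Y n x - Z x)) \<longlonglongrightarrow> 0"
    proof (rule Lim_null_comparison)
      show "\<forall>\<^sub>F n in sequentially. norm (?Y n (?Y n x - Z x)) \<le> norm (?Y n x - Z x)"
        by (simp add: Ynorm)
      show "(\<lambda>n. norm (?Y n x - Z x)) \<longlonglongrightarrow> 0"
        using lim[of x] by (intro tendsto_norm_zero) (simp add: LIM_zero)
    qed
    from tendsto_add[OF this lim[of "Z x"]]
    have "(\<lambda>n. ?Y n (?Y n x)) \<longlonglongrightarrow> Z (Z x)"
      by (simp add: linear_diff[OF linear_sqrt_iter[OF Bl Bn]])
    then have "(\<lambda>n. ?Y (Suc n) x) \<longlonglongrightarrow> (1/2) *\<^sub>R (B x + Z (Z x))"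
      unfolding sqrt_iter.simps by (intro tendsto_intros)
    then have "Z x = (1/2) *\<^sub>R (B x + Z (Z x))"
      using LIMSEQ_unique LIMSEQ_Suc[OF lim] by blast
    then have "2 *\<^sub>R Z x = 2 *\<^sub>R ((1/2) *\<^sub>R (B x + Z (Z x)))"
      by simp
    then show ?thesis
      by (simp only: scaleR_scaleR) simp
  qed
  define P where "P x = x - Z x" for x
  have "psd_operator P"
    unfolding psd_operator_def
  proof (intro conjI allI)
    show "bounded_linear P"
      unfolding P_def by (intro bounded_linear_sub bounded_linear_ident Zlin)
    show "inner (P x) y = inner x (P y)" for x y
      by (simp add: P_def inner_diff_left inner_diff_right Zsym)
    show "0 \<le> inner (P x) x" for x
    proof -
      have "inner (Z x) x \<le> norm (Z x) * norm x"
        by (rule norm_cauchy_schwarz)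
      also have "\<dots> \<le> norm x * norm x"
        by (intro mult_right_mono Znorm) simp
      finally show ?thesis
        by (simp add: P_def inner_diff_left power2_norm_eq_inner flip: power2_eq_square)
    qed
  qed
  moreover have "P (P x) = A x" for x
    using Zfix[of x] by (simp add: P_def B_def Z.diff scaleR_2 algebra_simps)
  moreover have "C (P x) = P (C x)" if C: "bounded_linear C" "\<And>x. C (A x) = A (C x)" for C x
  proof -
    interpret C: bounded_linear C by fact
    have "(\<lambda>n. C (?Y n x)) \<longlonglongrightarrow> C (Z x)"
      by (intro C.tendsto lim)
    moreover have "C (?Y n x) = ?Y n (C x)" for n
      by (rule commute_sqrt_iter[OF Bl Bn C.linear_axioms]) (simp add: B_def C.diff C(2))
    ultimately have "(\<lambda>n. ?Y n (C x)) \<longlonglongrightarrow> C (Z x)"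
      by simp
    then have "C (Z x) = Z (C x)"
      using lim by (rule LIMSEQ_unique)
    then show ?thesis
      by (simp add: P_def C.diff)
  qed
  ultimately show ?thesis
    by blast
qed

lemma psd_sqrt_exists:
  fixes A :: "'a::{real_inner, banach} \<Rightarrow> 'a"
  assumes A: "psd_operator A"
  shows "\<exists>P. psd_operator P \<and> (\<forall>x. P (P x) = A x) \<and>
    (\<forall>C. bounded_linear C \<and> (\<forall>x. C (A x) = A (C x)) \<longrightarrow> (\<forall>x. C (P x) = P (C x)))"
proof -
  interpret A: bounded_linear A
    by (rule psd_bounded_linear[OF A])
  obtain K where K: "K > 0" "\<And>x. norm (A x) \<le> norm x * K"
    using A.pos_bounded by blast
  define A' where "A' x = (1 / K) *\<^sub>R A x" for x
  have "psd_operator A'"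
    unfolding psd_operator_def
  proof (intro conjI allI)
    show "bounded_linear A'"
      unfolding A'_def by (intro bounded_linear_const_scaleR A.bounded_linear_axioms)
    show "inner (A' x) y = inner x (A' y)" for x y
      by (simp add: A'_def psd_sym[OF A])
    show "0 \<le> inner (A' x) x" for x
      using psd_nonneg[OF A, of x] K(1) by (simp add: A'_def)
  qed
  moreover have "inner (A' x) x \<le> (norm x)\<^sup>2" for x
  proof -
    have "inner (A x) x \<le> norm (A x) * norm x"
      by (rule norm_cauchy_schwarz)
    also have "\<dots> \<le> norm x * K * norm x"
      by (intro mult_right_mono K) simp
    finally show ?thesis
      using K(1) by (simp add: A'_def field_simps power2_eq_square)
  qed
  ultimately obtain P where P: "psd_operator P" "\<And>x. P (P x) = A' x"
      "\<And>C x. bounded_linear C \<Longrightarrow> (\<And>x. C (A' x) = A' (C x)) \<Longrightarrow> C (P x) = P (C x)"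
    using psd_sqrt_exists_contraction[of A'] by blast
  interpret P: bounded_linear P
    by (rule psd_bounded_linear[OF P(1)])
  let ?P = "\<lambda>x. sqrt K *\<^sub>R P x"
  have "psd_operator ?P"
    unfolding psd_operator_def
  proof (intro conjI allI)
    show "bounded_linear ?P"
      by (intro bounded_linear_const_scaleR P.bounded_linear_axioms)
    show "inner (?P x) y = inner x (?P y)" for x y
      by (simp add: psd_sym[OF P(1)])
    show "0 \<le> inner (?P x) x" for x
      using psd_nonneg[OF P(1), of x] K(1) by simp
  qed
  moreover have "?P (?P x) = A x" for x
    using K(1) by (simp add: P.scaleR P(2) A'_def)
  moreover have "C (?P x) = ?P (C x)" if C: "bounded_linear C" "\<And>x. C (A x) = A (C x)" for C x
  proof -
    have "C (P x) = P (C x)"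
      by (rule P(3)[OF C(1)]) (simp add: A'_def linear_cmul[OF bounded_linear.linear[OF C(1)]] C(2))
    then show ?thesis
      by (simp add: linear_cmul[OF bounded_linear.linear[OF C(1)]])
  qed
  ultimately show ?thesis
    by blast
qed

text \<open>
  Let \<open>R\<close> be the root constructed above. Any other root \<open>Q\<close> commutes with \<open>Q\<^sup>2 = R\<^sup>2\<close>, hence with
  \<open>R\<close>, so that \<open>(Q + R) (Q - R) = 0\<close>. With \<open>D = Q - R\<close> the two nonnegative numbers
  \<open>\<langle>Q D x, D x\<rangle>\<close> and \<open>\<langle>R D x, D x\<rangle>\<close> add up to \<open>0\<close>, so \<open>Q D = R D = 0\<close>, whence
  \<open>D\<^sup>2 = 0\<close> and, by symmetry of \<open>D\<close>, \<open>\<parallel>D x\<parallel>\<^sup>2 = \<langle>D\<^sup>2 x, x\<rangle> = 0\<close>.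
\<close>

lemma psd_sqrt_unique:
  fixes P P' :: "'a::{real_inner, banach} \<Rightarrow> 'a"
  assumes P: "psd_operator P" and P': "psd_operator P'" and eq: "\<And>x. P (P x) = P' (P' x)"
  shows "P = P'"
proof -
  have sq: "psd_operator (\<lambda>x. R (R x))" if R: "psd_operator R" for R :: "'a \<Rightarrow> 'a"
    unfolding psd_operator_def
  proof (intro conjI allI)
    show "bounded_linear (\<lambda>x. R (R x))"
      using bounded_linear_compose[OF psd_bounded_linear psd_bounded_linear, OF R R] .
    show "inner (R (R x)) y = inner x (R (R y))" for x y
      by (simp only: psd_sym[OF R])
    show "0 \<le> inner (R (R x)) x" for x
      unfolding psd_sym[OF R, of "R x"] by (rule inner_ge_zero)
  qed
  obtain R where R: "psd_operator R" "\<And>x. R (R x) = P (P x)"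
    and comm': "\<forall>C. bounded_linear C \<and> (\<forall>x. C (P (P x)) = P (P (C x))) \<longrightarrow> (\<forall>x. C (R x) = R (C x))"
    using psd_sqrt_exists[OF sq[OF P]] by (elim exE conjE) simp
  have comm: "C (R x) = R (C x)" if "bounded_linear C" "\<And>x. C (P (P x)) = P (P (C x))" for C x
    using comm' that by simp
  have QR: "Q = R" if Q: "psd_operator Q" and QR: "\<And>x. Q (Q x) = R (R x)"
    and cQ: "\<And>x. Q (R x) = R (Q x)" for Q
  proof
    fix x
    interpret Q: bounded_linear Q by (rule psd_bounded_linear[OF Q])
    interpret R: bounded_linear R by (rule psd_bounded_linear[OF R(1)])
    let ?D = "\<lambda>x. Q x - R x"
    have "Q (?D y) + R (?D y) = 0" for y
      by (simp add: Q.diff R.diff QR cQ)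
    then have sum0: "inner (Q (?D y)) (?D y) + inner (R (?D y)) (?D y) = 0" for y
      unfolding inner_add_left[symmetric] by simp
    have "inner (Q (?D y)) (?D y) = 0 \<and> inner (R (?D y)) (?D y) = 0" for y
      using psd_nonneg[OF Q, of "?D y"] psd_nonneg[OF R(1), of "?D y"] sum0[of y] by linarith
    then have DD: "?D (?D x) = 0"
      using psd_eq_0[OF Q, of "?D x"] psd_eq_0[OF R(1), of "?D x"] by simp
    have "inner (?D x) (?D x) = inner x (?D (?D x))"
      unfolding inner_diff_left inner_diff_right[of x] psd_sym[OF Q] psd_sym[OF R(1)] ..
    then have "inner (?D x) (?D x) = 0"
      unfolding DD by simp
    then show "Q x = R x"
      by simp
  qed
  have "P (R x) = R (P x)" for x
    by (rule comm[OF psd_bounded_linear[OF P]]) (rule refl)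
  then have "P = R"
    by (intro QR[OF P] R(2)[symmetric])
  have "P' (R x) = R (P' x)" for x
    by (rule comm[OF psd_bounded_linear[OF P']]) (simp only: eq)
  then have "P' = R"
    by (intro QR[OF P']) (simp_all only: R(2) eq)
  with \<open>P = R\<close> show ?thesis
    by simp
qed


lemma psd_sqrt_form:
  fixes P :: "'a::{real_inner, banach} \<Rightarrow> 'a"
  assumes "psd_operator P"
  shows "\<exists>Q. psd_operator Q \<and> (\<forall>x. Q (Q x) = P x) \<and> (\<forall>x. inner (P x) x = (norm (Q x))\<^sup>2)"
proof -
  obtain Q where Q: "psd_operator Q" "\<And>x. Q (Q x) = P x"
    using psd_sqrt_exists[OF assms] by blast
  moreover have "inner (P x) x = (norm (Q x))\<^sup>2" for x
    unfolding Q(2)[symmetric] psd_sym[OF Q(1), of "Q x"] power2_norm_eq_inner ..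
  ultimately show ?thesis
    by blast
qed

section \<open>Orthonormal bases\<close>

definition orthonormal :: "'a::real_inner set \<Rightarrow> bool" where
  "orthonormal B \<longleftrightarrow> (\<forall>e\<in>B. \<forall>e'\<in>B. inner e e' = (if e = e' then 1 else 0))"

definition hilbert_basis :: "'a::real_inner set \<Rightarrow> bool" where
  "hilbert_basis B \<longleftrightarrow> orthonormal B \<and> (\<forall>x. (\<forall>e\<in>B. inner x e = 0) \<longrightarrow> x = 0)"

lemma orthonormal_subset: "orthonormal B \<Longrightarrow> F \<subseteq> B \<Longrightarrow> orthonormal F"
  unfolding orthonormal_def by blast

lemma hilbert_basis_norm: "hilbert_basis B \<Longrightarrow> e \<in> B \<Longrightarrow> norm e = 1"
  by (auto simp: hilbert_basis_def orthonormal_def norm_eq_sqrt_inner)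

lemma orthonormal_distance:
  assumes F: "finite F" "orthonormal F"
  shows "(norm (x - (\<Sum>e\<in>F. c e *\<^sub>R e)))\<^sup>2 =
    (norm x)\<^sup>2 - (\<Sum>e\<in>F. (inner x e)\<^sup>2) + (\<Sum>e\<in>F. (inner x e - c e)\<^sup>2)"
proof -
  let ?s = "\<Sum>e\<in>F. c e *\<^sub>R e"
  have "inner ?s ?s = (\<Sum>e\<in>F. \<Sum>e'\<in>F. c e * (c e' * inner e' e))"
    by (simp add: inner_sum_left inner_sum_right sum_distrib_left)
  also have "\<dots> = (\<Sum>e\<in>F. \<Sum>e'\<in>F. if e' = e then (c e)\<^sup>2 else 0)"
    using F(2) by (intro sum.cong refl) (auto simp: orthonormal_def power2_eq_square)
  also have "\<dots> = (\<Sum>e\<in>F. (c e)\<^sup>2)"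
    using F(1) by simp
  finally have ss: "inner ?s ?s = (\<Sum>e\<in>F. (c e)\<^sup>2)" .
  have xs: "inner x ?s = (\<Sum>e\<in>F. c e * inner x e)"
    by (simp add: inner_sum_right)
  have "(norm (x - ?s))\<^sup>2 = (norm x)\<^sup>2 - 2 * inner x ?s + inner ?s ?s"
    by (simp add: power2_norm_eq_inner inner_diff_left inner_diff_right inner_commute)
  also have "\<dots> = (norm x)\<^sup>2 + (\<Sum>e\<in>F. - 2 * (c e * inner x e) + (c e)\<^sup>2)"
    unfolding ss xs sum.distrib by (simp add: sum_distrib_left sum_negf)
  also have "(\<Sum>e\<in>F. - 2 * (c e * inner x e) + (c e)\<^sup>2) =
      (\<Sum>e\<in>F. (inner x e - c e)\<^sup>2 - (inner x e)\<^sup>2)"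
    by (intro sum.cong refl) (simp add: power2_eq_square algebra_simps)
  finally show ?thesis
    by (simp add: sum_subtractf)
qed

lemma bessel_inequality:
  assumes F: "finite F" "orthonormal F"
  shows "(\<Sum>e\<in>F. (inner x e)\<^sup>2) \<le> (norm x)\<^sup>2"
  using orthonormal_distance[OF F, of x "inner x"] zero_le_power2[of "norm (x - (\<Sum>e\<in>F. inner x e *\<^sub>R e))"]
  by simp

lemma subspace_closure:
  fixes V :: "'a::real_normed_vector set"
  assumes V: "subspace V"
  shows "subspace (closure V)"
proof (rule subspaceI)
  show "0 \<in> closure V"
    using subspace_0[OF V] closure_subset by blast
next
  fix x y assume "x \<in> closure V" "y \<in> closure V"
  then obtain f g where "\<forall>n. f n \<in> V" "f \<longlonglongrightarrow> x" "\<forall>n. g n \<in> V" "g \<longlonglongrightarrow> y"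
    unfolding closure_sequential by blast
  then show "x + y \<in> closure V"
    unfolding closure_sequential
    by (intro exI[of _ "\<lambda>n. f n + g n"] conjI tendsto_add) (simp_all add: subspace_add[OF V])
next
  fix c :: real and x assume "x \<in> closure V"
  then obtain f where "\<forall>n. f n \<in> V" "f \<longlonglongrightarrow> x"
    unfolding closure_sequential by blast
  then show "c *\<^sub>R x \<in> closure V"
    unfolding closure_sequential
    by (intro exI[of _ "\<lambda>n. c *\<^sub>R f n"] conjI tendsto_scaleR tendsto_const)
       (simp_all add: subspace_scale[OF V])
qed

text \<open>
  The span of the basis is dense. If a combination of the vectors in a finite set \<open>F\<close> is close to
  \<open>x\<close>, the Fourier sum over \<open>F\<close> is at least as close, because it is the best approximation from
  the span of \<open>F\<close>. Stating Parseval's identity through finite subsets avoids infinite sums over bases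
  of arbitrary size.
\<close>

lemma parseval_approx:
  fixes B :: "'a::{real_inner, banach} set"
  assumes B: "hilbert_basis B" and "0 < \<epsilon>"
  shows "\<exists>F. finite F \<and> F \<subseteq> B \<and> (norm x)\<^sup>2 \<le> (\<Sum>e\<in>F. (inner x e)\<^sup>2) + \<epsilon>"
proof -
  \<comment> \<open>A vector orthogonal to the closed span would be orthogonal to the whole basis.\<close>
  have "closure (span B) = UNIV"
  proof (rule ccontr)
    assume "closure (span B) \<noteq> UNIV"
    moreover have "subspace (closure (span B))"
      by (intro subspace_closure subspace_span)
    ultimately obtain w where w: "w \<noteq> 0" "\<And>v. v \<in> closure (span B) \<Longrightarrow> inner v w = 0"
      using closed_subspace_orthogonal_vector[of "closure (span B)"] closed_closure by blast
    have "inner w e = 0" if "e \<in> B" for e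
      using w(2)[of e] that span_base[of e B] closure_subset[of "span B"] by (auto simp: inner_commute)
    with B w(1) show False
      by (auto simp: hilbert_basis_def)
  qed
  then have "x \<in> closure (span B)"
    by simp
  moreover have "0 < sqrt \<epsilon>"
    using \<open>0 < \<epsilon>\<close> by simp
  ultimately obtain y where y: "y \<in> span B" "dist y x < sqrt \<epsilon>"
    using closure_approachable by blast
  from y(1) obtain F c where F: "finite F" "F \<subseteq> B" "y = (\<Sum>e\<in>F. c e *\<^sub>R e)"
    unfolding span_explicit by blast
  have "(norm (x - y))\<^sup>2 \<le> (sqrt \<epsilon>)\<^sup>2"
    using y(2) by (intro power_mono) (auto simp: dist_norm norm_minus_commute)
  then have "(norm (x - y))\<^sup>2 \<le> \<epsilon>"
    using \<open>0 < \<epsilon>\<close> by simp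
  moreover have "orthonormal F"
    using B F(2) orthonormal_subset by (auto simp: hilbert_basis_def)
  moreover have "0 \<le> (\<Sum>e\<in>F. (inner x e - c e)\<^sup>2)"
    by (intro sum_nonneg) simp
  ultimately have "(norm x)\<^sup>2 \<le> (\<Sum>e\<in>F. (inner x e)\<^sup>2) + \<epsilon>"
    using orthonormal_distance[OF F(1), of x c] F(3) by simp
  with F show ?thesis
    by blast
qed

text \<open>
  The Hilbert-Schmidt norm is not increased by composition with a contraction, even when the sum for
  \<open>Q W\<close> runs over another orthonormal system: Parseval turns \<open>\<parallel>Q W f\<parallel>\<^sup>2\<close> into
  \<open>\<Sum>e. \<langle>W' Q e, f\<rangle>\<^sup>2\<close>, and summing over \<open>f\<close> first, Bessel's inequality bounds the
  total by \<open>\<Sum>e. \<parallel>W' Q e\<parallel>\<^sup>2\<close>.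
\<close>

lemma hilbert_schmidt_compose:
  fixes B :: "'a::{real_inner, banach} set"
  assumes B: "hilbert_basis B"
    and Q: "\<And>x y. inner (Q x) y = inner x (Q y)"
    and t: "\<And>G. finite G \<Longrightarrow> G \<subseteq> B \<Longrightarrow> (\<Sum>e\<in>G. (norm (Q e))\<^sup>2) \<le> t"
    and W: "\<And>x y. inner (W x) y = inner x (W' y)" "\<And>y. norm (W' y) \<le> norm y"
    and F: "finite F" "orthonormal F"
  shows "(\<Sum>f\<in>F. (norm (Q (W f)))\<^sup>2) \<le> t"
proof (rule field_le_epsilon)
  fix \<epsilon> :: real assume "0 < \<epsilon>"
  \<comment> \<open>An error of \<open>\<delta>\<close> is admitted for each member of \<open>F\<close>; the summand 1 covers empty \<open>F\<close>.\<close>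
  define \<delta> where "\<delta> = \<epsilon> / (real (card F) + 1)"
  have \<delta>: "0 < \<delta>" "real (card F) * \<delta> \<le> \<epsilon>"
    using \<open>0 < \<epsilon>\<close> by (auto simp: \<delta>_def field_simps)
  have "\<forall>f. \<exists>G. finite G \<and> G \<subseteq> B \<and> (norm (Q (W f)))\<^sup>2 \<le> (\<Sum>e\<in>G. (inner (Q (W f)) e)\<^sup>2) + \<delta>"
    using parseval_approx[OF B \<delta>(1)] by blast
  then obtain G where G: "\<And>f. finite (G f)" "\<And>f. G f \<subseteq> B"
      "\<And>f. (norm (Q (W f)))\<^sup>2 \<le> (\<Sum>e\<in>G f. (inner (Q (W f)) e)\<^sup>2) + \<delta>"
    by metis
  define H where "H = (\<Union>f\<in>F. G f)"
  have H: "finite H" "H \<subseteq> B"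
    using G F(1) by (auto simp: H_def)
  have QW: "inner (Q (W f)) e = inner (W' (Q e)) f" for e f
    unfolding Q W(1) by (rule inner_commute)
  have "(\<Sum>f\<in>F. (norm (Q (W f)))\<^sup>2) \<le> (\<Sum>f\<in>F. (\<Sum>e\<in>H. (inner (Q (W f)) e)\<^sup>2) + \<delta>)"
  proof (rule sum_mono)
    fix f assume "f \<in> F"
    then have "(\<Sum>e\<in>G f. (inner (Q (W f)) e)\<^sup>2) \<le> (\<Sum>e\<in>H. (inner (Q (W f)) e)\<^sup>2)"
      by (intro sum_mono2 H(1)) (auto simp: H_def)
    with G(3)[of f] show "(norm (Q (W f)))\<^sup>2 \<le> (\<Sum>e\<in>H. (inner (Q (W f)) e)\<^sup>2) + \<delta>"
      by linarith
  qed
  also have "\<dots> = (\<Sum>e\<in>H. \<Sum>f\<in>F. (inner (W' (Q e)) f)\<^sup>2) + real (card F) * \<delta>"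
    unfolding QW by (simp add: sum.distrib sum.swap[of _ H F])
  also have "(\<Sum>e\<in>H. \<Sum>f\<in>F. (inner (W' (Q e)) f)\<^sup>2) \<le> (\<Sum>e\<in>H. (norm (Q e))\<^sup>2)"
  proof (rule sum_mono)
    fix e
    have "(\<Sum>f\<in>F. (inner (W' (Q e)) f)\<^sup>2) \<le> (norm (W' (Q e)))\<^sup>2"
      by (rule bessel_inequality[OF F])
    also have "\<dots> \<le> (norm (Q e))\<^sup>2"
      by (intro power_mono W(2)) simp
    finally show "(\<Sum>f\<in>F. (inner (W' (Q e)) f)\<^sup>2) \<le> (norm (Q e))\<^sup>2" .
  qed
  also have "\<dots> \<le> t"
    by (rule t[OF H])
  finally show "(\<Sum>f\<in>F. (norm (Q (W f)))\<^sup>2) \<le> t + \<epsilon>"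
    using \<delta>(2) by linarith
qed

text \<open>
  With \<open>Q = \<surd>P\<close> one has \<open>\<langle>P x, x\<rangle> = \<parallel>Q x\<parallel>\<^sup>2 = \<Sum>e. \<langle>x, Q e\<rangle>\<^sup>2 \<le> \<parallel>x\<parallel>\<^sup>2 \<Sum>e. \<langle>P e, e\<rangle>\<close>.
\<close>

lemma psd_norm_le_trace:
  fixes B :: "'a::{real_inner, banach} set"
  assumes B: "hilbert_basis B" and P: "psd_operator P"
    and t: "\<And>G. finite G \<Longrightarrow> G \<subseteq> B \<Longrightarrow> (\<Sum>e\<in>G. inner (P e) e) \<le> t"
  shows "norm (P x) \<le> t * norm x"
proof (rule psd_norm_le[OF P])
  show "0 \<le> t"
    using t[of "{}"] by simp
  obtain Q where Q: "psd_operator Q" "\<And>x. Q (Q x) = P x" and QP: "\<And>x. inner (P x) x = (norm (Q x))\<^sup>2"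
    using psd_sqrt_form[OF P] by blast
  show "inner (P x) x \<le> t * (norm x)\<^sup>2" for x
  proof (rule field_le_epsilon)
    fix \<epsilon> :: real assume "0 < \<epsilon>"
    then obtain G where G: "finite G" "G \<subseteq> B" "(norm (Q x))\<^sup>2 \<le> (\<Sum>e\<in>G. (inner (Q x) e)\<^sup>2) + \<epsilon>"
      using parseval_approx[OF B] by blast
    have "(\<Sum>e\<in>G. (inner (Q x) e)\<^sup>2) \<le> (\<Sum>e\<in>G. inner (P e) e * (norm x)\<^sup>2)"
    proof (rule sum_mono)
      fix e
      have "\<bar>inner (Q x) e\<bar> \<le> norm x * norm (Q e)"
        unfolding psd_sym[OF Q(1), of x] by (rule Cauchy_Schwarz_ineq2)
      then have "(inner (Q x) e)\<^sup>2 \<le> (norm x * norm (Q e))\<^sup>2"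
        by (rule abs_le_square_iff[THEN iffD1, OF order_trans]) simp
      then show "(inner (Q x) e)\<^sup>2 \<le> inner (P e) e * (norm x)\<^sup>2"
        by (simp add: QP power_mult_distrib mult.commute)
    qed
    also have "\<dots> \<le> t * (norm x)\<^sup>2"
      unfolding sum_distrib_right[symmetric] by (intro mult_right_mono t G) simp
    finally show "inner (P x) x \<le> t * (norm x)\<^sup>2 + \<epsilon>"
      using G(3) by (simp add: QP)
  qed
qed

section \<open>The triangle inequality for the trace of the modulus\<close>

text \<open>
  \<open>\<parallel>(P + \<epsilon>) x\<parallel>\<^sup>2 = \<parallel>P x\<parallel>\<^sup>2 + 2 \<epsilon> \<langle>P x, x\<rangle> + \<epsilon>\<^sup>2 \<parallel>x\<parallel>\<^sup>2\<close> bounds \<open>P + \<epsilon>\<close> from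
  below, so its range is closed; a vector orthogonal to the range vanishes, because \<open>P + \<epsilon>\<close> is
  positive definite. The same identity shows that \<open>P (P + \<epsilon>)\<inverse>\<close> is a contraction.
\<close>

lemma psd_shift_inverse:
  fixes P :: "'a::{real_inner, banach} \<Rightarrow> 'a"
  assumes P: "psd_operator P" and \<epsilon>: "0 < \<epsilon>"
  shows "\<exists>R. bounded_linear R \<and> (\<forall>x. P (R x) + \<epsilon> *\<^sub>R R x = x) \<and> (\<forall>x. R (P x) + \<epsilon> *\<^sub>R R x = x) \<and>
    (\<forall>x. norm (P (R x)) \<le> norm x)"
proof -
  interpret P: bounded_linear P by (rule psd_bounded_linear[OF P])
  define S where "S x = P x + \<epsilon> *\<^sub>R x" for x
  have S: "bounded_linear S"
    unfolding S_def
    by (intro bounded_linear_add P.bounded_linear_axioms bounded_linear_const_scaleR bounded_linear_ident)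
  interpret S: bounded_linear S by fact
  have expand: "(norm (S x))\<^sup>2 = (norm (P x))\<^sup>2 + 2 * \<epsilon> * inner (P x) x + (\<epsilon> * norm x)\<^sup>2" for x
    by (simp add: S_def power2_norm_eq_inner inner_add_left inner_add_right inner_commute
        power_mult_distrib power2_eq_square[of \<epsilon>] algebra_simps)
  have lower: "\<epsilon> * norm x \<le> norm (S x)" "norm (P x) \<le> norm (S x)" for x
  proof -
    have "0 \<le> 2 * \<epsilon> * inner (P x) x"
      using psd_nonneg[OF P, of x] \<epsilon> by simp
    with expand[of x] zero_le_power2[of "norm (P x)"] zero_le_power2[of "\<epsilon> * norm x"]
    have "(\<epsilon> * norm x)\<^sup>2 \<le> (norm (S x))\<^sup>2" "(norm (P x))\<^sup>2 \<le> (norm (S x))\<^sup>2"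
      by linarith+
    then show "\<epsilon> * norm x \<le> norm (S x)" "norm (P x) \<le> norm (S x)"
      by (auto intro: power2_le_imp_le)
  qed
  have inj: "inj S"
  proof (rule injI)
    fix x y assume "S x = S y"
    then have "S (x - y) = 0"
      by (simp add: S.diff)
    with lower(1)[of "x - y"] \<epsilon> show "x = y"
      by (simp add: mult_le_0_iff)
  qed
  have "complete (S ` UNIV)"
    by (rule complete_isometric_image[OF \<epsilon> subspace_UNIV S]) (use lower in \<open>auto simp: complete_UNIV\<close>)
  then have "closed (range S)"
    by (rule complete_imp_closed)
  have surj: "range S = UNIV"
  proof (rule ccontr)
    assume "range S \<noteq> UNIV"
    moreover have "subspace (range S)"
      using S.linear_axioms subspace_UNIV by (rule linear_subspace_image)
    ultimately obtain w where w: "w \<noteq> 0" "\<And>x. inner (S x) w = 0"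
      using closed_subspace_orthogonal_vector[of "range S"] \<open>closed (range S)\<close> by blast
    have "inner (P w) w + \<epsilon> * inner w w = 0"
      using w(2)[of w] by (simp add: S_def inner_add_left)
    moreover have "0 < \<epsilon> * inner w w"
      using w(1) \<epsilon> by simp
    ultimately show False
      using psd_nonneg[OF P, of w] by linarith
  qed
  define R where "R = inv S"
  have SR: "S (R x) = x" for x
    unfolding R_def using surj by (rule surj_f_inv_f)
  have RS: "R (S x) = x" for x
    unfolding R_def using inj by (rule inv_f_f)
  have Rlin: "bounded_linear R"
  proof (rule bounded_linear_intro)
    fix x y :: 'a and r :: real
    show "R (x + y) = R x + R y"
      using RS[of "R x + R y"] by (simp only: S.add SR)
    show "R (r *\<^sub>R x) = r *\<^sub>R R x"
      using RS[of "r *\<^sub>R R x"] by (simp only: S.scaleR SR)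
    show "norm (R x) \<le> norm x * (1 / \<epsilon>)"
      using lower(1)[of "R x"] \<epsilon> by (simp add: SR field_simps)
  qed
  then have "R (P x) + \<epsilon> *\<^sub>R R x = x" for x
    using RS[of x] by (simp add: S_def linear_add linear_cmul bounded_linear.linear)
  moreover have "P (R x) + \<epsilon> *\<^sub>R R x = x" for x
    using SR[of x] by (simp add: S_def)
  moreover have "norm (P (R x)) \<le> norm x" for x
    using lower(2)[of "R x"] by (simp add: SR)
  ultimately show ?thesis
    using Rlin by blast
qed

text \<open>
  \<open>P = |T|\<close>: the second condition is \<open>P\<^sup>2 = T\<^sup>* T\<close>, phrased without the adjoint.
\<close>

definition is_modulus :: "('a::real_inner \<Rightarrow> 'a) \<Rightarrow> ('a \<Rightarrow> 'a) \<Rightarrow> bool" where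
  "is_modulus P T \<longleftrightarrow> psd_operator P \<and> (\<forall>x y. inner (P (P x)) y = inner (T x) (T y))"

lemma is_modulus_norm: "is_modulus P T \<Longrightarrow> norm (P x) = norm (T x)"
  using psd_sym[of P "P x" x] by (simp add: is_modulus_def norm_eq_sqrt_inner)

text \<open>
  The contraction \<open>U = T (P + \<epsilon>)\<inverse>\<close> is a substitute for the partial isometry of the polar
  decomposition \<open>T = U P\<close>, \<open>P = U\<^sup>* T\<close>. Both identities hold up to \<open>\<epsilon>\<close>, which is enough for
  estimates and avoids extending an isometry from the range of \<open>P\<close>.
\<close>

lemma approximate_polar_decomposition:
  fixes T :: "'a::{real_inner, banach} \<Rightarrow> 'a"
  assumes T: "bounded_linear T" and P: "is_modulus P T" and \<epsilon>: "0 < \<epsilon>"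
  shows "\<exists>U. bounded_linear U \<and> (\<forall>x. norm (U x) \<le> norm x) \<and>
    (\<forall>x. norm (T x - U (P x)) \<le> \<epsilon> * norm x) \<and>
    (\<forall>x. inner (P x) x \<le> inner (T x) (U x) + \<epsilon> * (norm x)\<^sup>2)"
proof -
  have psd: "psd_operator P"
    using P by (simp add: is_modulus_def)
  obtain R where R: "bounded_linear R" "\<And>x. P (R x) + \<epsilon> *\<^sub>R R x = x"
      "\<And>x. R (P x) + \<epsilon> *\<^sub>R R x = x" "\<And>x. norm (P (R x)) \<le> norm x"
    using psd_shift_inverse[OF psd \<epsilon>] by blast
  interpret T: bounded_linear T by fact
  have contr: "norm (T (R x)) \<le> norm x" for x
    using R(4)[of x] by (simp add: is_modulus_norm[OF P])
  show ?thesis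
  proof (intro exI[of _ "\<lambda>x. T (R x)"] conjI allI contr)
    show "bounded_linear (\<lambda>x. T (R x))"
      by (rule bounded_linear_compose[OF T R(1)])
    show "norm (T x - T (R (P x))) \<le> \<epsilon> * norm x" for x
    proof -
      have "x - R (P x) = \<epsilon> *\<^sub>R R x"
        using R(3)[of x] by (simp add: algebra_simps)
      then have "T x - T (R (P x)) = \<epsilon> *\<^sub>R T (R x)"
        by (metis T.diff T.scaleR)
      then show ?thesis
        using \<epsilon> contr[of x] by (simp add: mult_left_mono)
    qed
    show "inner (P x) x \<le> inner (T x) (T (R x)) + \<epsilon> * (norm x)\<^sup>2" for x
    proof -
      have "inner (T x) (T (R x)) = inner (P x) (P (R x))"
        using P psd_sym[OF psd, of "P x" "R x"] by (simp add: is_modulus_def)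
      also have "P (R x) = x - \<epsilon> *\<^sub>R R x"
        using R(2)[of x] by (simp add: algebra_simps)
      also have "inner (P x) (x - \<epsilon> *\<^sub>R R x) = inner (P x) x - \<epsilon> * inner x (P (R x))"
        by (simp add: inner_diff_right psd_sym[OF psd, of x "R x"])
      finally have "inner (T x) (T (R x)) = inner (P x) x - \<epsilon> * inner x (P (R x))" .
      moreover have "inner x (P (R x)) \<le> (norm x)\<^sup>2"
      proof -
        have "inner x (P (R x)) \<le> norm x * norm (P (R x))"
          by (rule norm_cauchy_schwarz)
        also have "\<dots> \<le> norm x * norm x"
          by (intro mult_left_mono R(4)) simp
        finally show ?thesis
          by (simp add: power2_eq_square)
      qed
      ultimately show ?thesis
        using \<epsilon> by (simp add: mult_left_mono)
    qed
  qed
qed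

text \<open>
  This is \<open>|tr (U\<^sup>* T)| \<le> \<parallel>U\<parallel> \<parallel>T\<parallel>\<^sub>1\<close> for partial sums of the trace. Writing \<open>T \<approx> V P\<close>
  and \<open>P = Q\<^sup>2\<close>, each term \<open>\<langle>T e, U e\<rangle>\<close> becomes \<open>\<langle>Q e, Q W e\<rangle>\<close> with the contraction
  \<open>W = V\<^sup>* U\<close>, which is at most \<open>(\<parallel>Q e\<parallel>\<^sup>2 + \<parallel>Q W e\<parallel>\<^sup>2) / 2\<close>; both squares sum to at most the
  trace of \<open>P\<close>.
\<close>

lemma trace_pairing_le:
  fixes B :: "'a::{real_inner, banach} set"
  assumes B: "hilbert_basis B" and T: "bounded_linear T" and P: "is_modulus P T"
    and t: "\<And>G. finite G \<Longrightarrow> G \<subseteq> B \<Longrightarrow> (\<Sum>e\<in>G. inner (P e) e) \<le> t"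
    and U: "bounded_linear U" "\<And>x. norm (U x) \<le> norm x"
    and F: "finite F" "F \<subseteq> B"
  shows "(\<Sum>e\<in>F. inner (T e) (U e)) \<le> t"
proof (rule field_le_epsilon)
  fix \<epsilon> :: real assume "0 < \<epsilon>"
  define \<delta> where "\<delta> = \<epsilon> / (real (card F) + 1)"
  have \<delta>: "0 < \<delta>" "real (card F) * \<delta> \<le> \<epsilon>"
    using \<open>0 < \<epsilon>\<close> by (auto simp: \<delta>_def field_simps)
  have psd: "psd_operator P"
    using P by (simp add: is_modulus_def)
  obtain Q where Q: "psd_operator Q" "\<And>x. Q (Q x) = P x" and QP: "\<And>x. inner (P x) x = (norm (Q x))\<^sup>2"
    using psd_sqrt_form[OF psd] by blast
  obtain V where V: "bounded_linear V" "\<And>x. norm (V x) \<le> norm x"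
      "\<And>x. norm (T x - V (P x)) \<le> \<delta> * norm x"
    using approximate_polar_decomposition[OF T P \<delta>(1)] by blast
  define W where "W x = adjoint V (U x)" for x
  define W' where "W' x = adjoint U (V x)" for x
  have WW': "inner (W x) y = inner x (W' y)" for x y
    unfolding W_def W'_def inner_adjoint[OF U(1), symmetric]
    by (simp only: inner_commute[of _ y] inner_adjoint[OF V(1), symmetric]) (rule inner_commute)
  have normW': "norm (W' y) \<le> norm y" for y
    using norm_adjoint_le[OF U(1), of 1 "V y"] U(2) V(2)[of y] by (simp add: W'_def)
  note unit = hilbert_basis_norm[OF B subsetD[OF F(2)]]
  have ortho: "orthonormal F"
    using B F(2) orthonormal_subset by (auto simp: hilbert_basis_def)
  have "(\<Sum>e\<in>F. inner (T e) (U e)) \<le> (\<Sum>e\<in>F. ((norm (Q e))\<^sup>2 + (norm (Q (W e)))\<^sup>2) / 2 + \<delta>)"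
  proof (rule sum_mono)
    fix e assume e: "e \<in> F"
    have "inner (T e) (U e) = inner (T e - V (P e)) (U e) + inner (V (P e)) (U e)"
      by (simp add: inner_diff_left)
    also have "inner (T e - V (P e)) (U e) \<le> norm (T e - V (P e)) * norm (U e)"
      by (rule norm_cauchy_schwarz)
    also have "\<dots> \<le> \<delta> * 1"
      using V(3)[of e] U(2)[of e] unit[OF e] \<delta>(1) by (intro mult_mono) auto
    also have "inner (V (P e)) (U e) = inner (Q e) (Q (W e))"
      unfolding W_def inner_adjoint[OF V(1)] Q(2)[symmetric] psd_sym[OF Q(1), of "Q e"] ..
    also have "\<dots> \<le> ((norm (Q e))\<^sup>2 + (norm (Q (W e)))\<^sup>2) / 2"
      using inner_ge_zero[of "Q e - Q (W e)"]
      by (simp add: power2_norm_eq_inner inner_diff_left inner_diff_right inner_commute)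
    finally show "inner (T e) (U e) \<le> ((norm (Q e))\<^sup>2 + (norm (Q (W e)))\<^sup>2) / 2 + \<delta>"
      by simp
  qed
  also have "\<dots> = ((\<Sum>e\<in>F. (norm (Q e))\<^sup>2) + (\<Sum>e\<in>F. (norm (Q (W e)))\<^sup>2)) / 2 + real (card F) * \<delta>"
    by (simp add: sum.distrib flip: sum_divide_distrib)
  also have "\<dots> \<le> (t + t) / 2 + \<epsilon>"
  proof -
    have "(\<Sum>e\<in>F. (norm (Q e))\<^sup>2) \<le> t"
      using t[OF F] by (simp add: QP)
    moreover have "(\<Sum>e\<in>F. (norm (Q (W e)))\<^sup>2) \<le> t"
      by (rule hilbert_schmidt_compose[OF B psd_sym[OF Q(1)] _ WW' normW' F(1) ortho])
         (use t in \<open>simp add: QP\<close>)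
    ultimately show ?thesis
      using \<delta>(2) by argo
  qed
  finally show "(\<Sum>e\<in>F. inner (T e) (U e)) \<le> t + \<epsilon>"
    by simp
qed

text \<open>
  With a contraction \<open>U\<close> for which \<open>\<langle>P e, e\<rangle> \<approx> \<langle>(T\<^sub>1 + T\<^sub>2) e, U e\<rangle>\<close>, the right hand
  side splits into two pairings of the kind just bounded.
\<close>

lemma trace_triangle_inequality:
  fixes B :: "'a::{real_inner, banach} set"
  assumes B: "hilbert_basis B"
    and T: "bounded_linear T\<^sub>1" "bounded_linear T\<^sub>2"
    and P: "is_modulus P\<^sub>1 T\<^sub>1" "is_modulus P\<^sub>2 T\<^sub>2" "is_modulus P (\<lambda>x. T\<^sub>1 x + T\<^sub>2 x)"
    and t\<^sub>1: "\<And>G. finite G \<Longrightarrow> G \<subseteq> B \<Longrightarrow> (\<Sum>e\<in>G. inner (P\<^sub>1 e) e) \<le> t\<^sub>1"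
    and t\<^sub>2: "\<And>G. finite G \<Longrightarrow> G \<subseteq> B \<Longrightarrow> (\<Sum>e\<in>G. inner (P\<^sub>2 e) e) \<le> t\<^sub>2"
    and F: "finite F" "F \<subseteq> B"
  shows "(\<Sum>e\<in>F. inner (P e) e) \<le> t\<^sub>1 + t\<^sub>2"
proof (rule field_le_epsilon)
  fix \<epsilon> :: real assume "0 < \<epsilon>"
  define \<delta> where "\<delta> = \<epsilon> / (real (card F) + 1)"
  have \<delta>: "0 < \<delta>" "real (card F) * \<delta> \<le> \<epsilon>"
    using \<open>0 < \<epsilon>\<close> by (auto simp: \<delta>_def field_simps)
  obtain U where U: "bounded_linear U" "\<And>x. norm (U x) \<le> norm x"
      "\<And>x. inner (P x) x \<le> inner (T\<^sub>1 x + T\<^sub>2 x) (U x) + \<delta> * (norm x)\<^sup>2"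
    using approximate_polar_decomposition[OF bounded_linear_add[OF T] P(3) \<delta>(1)] by blast
  note unit = hilbert_basis_norm[OF B subsetD[OF F(2)]]
  have "(\<Sum>e\<in>F. inner (P e) e) \<le> (\<Sum>e\<in>F. inner (T\<^sub>1 e) (U e) + inner (T\<^sub>2 e) (U e) + \<delta>)"
  proof (rule sum_mono)
    fix e assume "e \<in> F"
    then show "inner (P e) e \<le> inner (T\<^sub>1 e) (U e) + inner (T\<^sub>2 e) (U e) + \<delta>"
      using U(3)[of e] unit by (simp add: inner_add_left)
  qed
  also have "\<dots> = (\<Sum>e\<in>F. inner (T\<^sub>1 e) (U e)) + (\<Sum>e\<in>F. inner (T\<^sub>2 e) (U e)) + real (card F) * \<delta>"
    by (simp add: sum.distrib)
  also have "\<dots> \<le> t\<^sub>1 + t\<^sub>2 + \<epsilon>"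
    using trace_pairing_le[OF B T(1) P(1) t\<^sub>1 U(1,2) F] trace_pairing_le[OF B T(2) P(2) t\<^sub>2 U(1,2) F] \<delta>(2)
    by linarith
  finally show "(\<Sum>e\<in>F. inner (P e) e) \<le> t\<^sub>1 + t\<^sub>2 + \<epsilon>" .
qed

section \<open>Completeness of the space of square-integrable functions\<close>

lemma square_integrable_rep_l2: "square_integrable (rep_l2 f)"
  using Quotient3_rep_reflp[OF Quotient3_l2, of f] by (simp add: l2_rel_def)

lemma abs_rep_l2: "abs_l2 (rep_l2 f) = f"
  using Quotient3_abs_rep[OF Quotient3_l2] .

lemma l2_rel_refl: "square_integrable f \<Longrightarrow> l2_rel f f"
  by (simp add: l2_rel_def)

lemma norm_abs_l2:
  assumes h: "square_integrable h"
  shows "(\<integral>\<^sup>+x. ennreal ((cmod (h x))\<^sup>2) \<partial>lborel) = ennreal ((norm (abs_l2 h))\<^sup>2)"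
proof -
  have eq: "h x * cnj (h x) = complex_of_real ((cmod (h x))\<^sup>2)" for x
    by (simp add: complex_norm_square[symmetric])
  have "(norm (abs_l2 h))\<^sup>2 = Re (cinner (abs_l2 h) (abs_l2 h))"
    by (simp add: power2_norm_eq_inner inner_l2_def)
  also have "cinner (abs_l2 h) (abs_l2 h) = complex_of_real (LINT x|lborel. (cmod (h x))\<^sup>2)"
    unfolding cinner.abs_eq[OF l2_rel_refl[OF h] l2_rel_refl[OF h]] eq by (rule integral_complex_of_real)
  finally have "(norm (abs_l2 h))\<^sup>2 = (LINT x|lborel. (cmod (h x))\<^sup>2)"
    by simp
  then show ?thesis
    using h by (simp add: square_integrable_def nn_integral_eq_integral)
qed

lemma diff_abs_l2:
  "square_integrable f \<Longrightarrow> square_integrable g \<Longrightarrow> abs_l2 f - abs_l2 g = abs_l2 (\<lambda>x. f x - g x)"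
  by (simp add: minus_l2.abs_eq l2_rel_refl)

lemma norm_diff_l2:
  "(\<integral>\<^sup>+x. ennreal ((cmod (rep_l2 f x - rep_l2 g x))\<^sup>2) \<partial>lborel) = ennreal ((norm (f - g))\<^sup>2)"
  using norm_abs_l2[OF square_integrable_diff[OF square_integrable_rep_l2 square_integrable_rep_l2], of f g]
    diff_abs_l2[OF square_integrable_rep_l2 square_integrable_rep_l2, of f g]
  by (simp add: abs_rep_l2)

lemma ennreal_le_suminf: "(u :: nat \<Rightarrow> ennreal) n \<le> (\<Sum>n. u n)"
  using sum_le_suminf[of u "{n}"] by simp

text \<open>
  The weights \<open>2\<^sup>n\<close> keep \<open>\<Sum>n. 2\<^sup>n |Y\<^sub>n\<^sub>+\<^sub>1 - Y\<^sub>n|\<^sup>2\<close> integrable. At almost every point this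
  sum is finite, which forces \<open>|Y\<^sub>n\<^sub>+\<^sub>1 - Y\<^sub>n|\<close> to decay like \<open>2\<^sup>-\<^sup>n\<^sup>/\<^sup>2\<close>.
\<close>

lemma AE_convergent_of_fast_Cauchy_l2:
  fixes Y :: "nat \<Rightarrow> 'a::euclidean_space l2"
  assumes fast: "\<And>n. norm (Y (Suc n) - Y n) \<le> (1/2) ^ n"
  shows "AE x in lborel. convergent (\<lambda>n. rep_l2 (Y n) x)"
proof -
  define D where "D n x = cmod (rep_l2 (Y (Suc n)) x - rep_l2 (Y n) x)" for n x
  have [measurable]: "rep_l2 (Y n) \<in> borel_measurable lborel" for n
    using square_integrable_rep_l2 by (rule square_integrable_measurable)
  have [measurable]: "D n \<in> borel_measurable lborel" for n
    unfolding D_def by measurable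
  have "(\<integral>\<^sup>+x. (\<Sum>n. ennreal (2 ^ n * (D n x)\<^sup>2)) \<partial>lborel) = (\<Sum>n. \<integral>\<^sup>+x. ennreal (2 ^ n * (D n x)\<^sup>2) \<partial>lborel)"
    by (rule nn_integral_suminf) measurable
  also have "\<dots> = (\<Sum>n. ennreal (2 ^ n * (norm (Y (Suc n) - Y n))\<^sup>2))"
  proof (rule suminf_cong)
    fix n
    have "(\<integral>\<^sup>+x. ennreal (2 ^ n * (D n x)\<^sup>2) \<partial>lborel) = (\<integral>\<^sup>+x. ennreal (2 ^ n) * ennreal ((D n x)\<^sup>2) \<partial>lborel)"
      by (simp add: ennreal_mult)
    also have "\<dots> = ennreal (2 ^ n) * (\<integral>\<^sup>+x. ennreal ((D n x)\<^sup>2) \<partial>lborel)"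
      by (rule nn_integral_cmult) measurable
    also have "\<dots> = ennreal (2 ^ n * (norm (Y (Suc n) - Y n))\<^sup>2)"
      unfolding D_def norm_diff_l2 by (simp add: ennreal_mult)
    finally show "(\<integral>\<^sup>+x. ennreal (2 ^ n * (D n x)\<^sup>2) \<partial>lborel) = ennreal (2 ^ n * (norm (Y (Suc n) - Y n))\<^sup>2)" .
  qed
  also have "\<dots> \<le> (\<Sum>n. ennreal ((1/2) ^ n))"
  proof (intro suminf_le ennreal_leI summableI)
    fix n
    have "2 ^ n * (norm (Y (Suc n) - Y n))\<^sup>2 \<le> 2 ^ n * ((1/2) ^ n)\<^sup>2"
      by (intro mult_left_mono power_mono fast) auto
    also have "\<dots> = (1/2 :: real) ^ n"
      by (simp add: power2_eq_square power_divide)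
    finally show "2 ^ n * (norm (Y (Suc n) - Y n))\<^sup>2 \<le> (1/2) ^ n" .
  qed
  also have "\<dots> = ennreal (\<Sum>n. (1/2) ^ n)"
    by (rule suminf_ennreal2) (auto intro: summable_geometric)
  also have "\<dots> < \<infinity>"
    by simp
  finally have "AE x in lborel. (\<Sum>n. ennreal (2 ^ n * (D n x)\<^sup>2)) \<noteq> \<infinity>"
    by (intro nn_integral_PInf_AE) (auto simp: less_top)
  then show ?thesis
  proof (rule eventually_mono)
    fix x assume fin: "(\<Sum>n. ennreal (2 ^ n * (D n x)\<^sup>2)) \<noteq> \<infinity>"
    define C where "C = enn2real (\<Sum>n. ennreal (2 ^ n * (D n x)\<^sup>2))"
    have C: "C \<ge> 0" "(\<Sum>n. ennreal (2 ^ n * (D n x)\<^sup>2)) = ennreal C"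
      unfolding C_def using fin by (simp_all only: enn2real_nonneg ennreal_enn2real_if infinity_ennreal_def if_False)
    have bound: "D n x \<le> sqrt C * (sqrt (1/2)) ^ n" for n
    proof -
      have "ennreal (2 ^ n * (D n x)\<^sup>2) \<le> ennreal C"
        unfolding C(2)[symmetric] by (rule ennreal_le_suminf)
      then have "2 ^ n * (D n x)\<^sup>2 \<le> C"
        using C(1) by (simp only: ennreal_le_iff)
      then have "(D n x)\<^sup>2 \<le> C * (1/2) ^ n"
        by (simp add: field_simps power_divide)
      then have "sqrt ((D n x)\<^sup>2) \<le> sqrt (C * (1/2) ^ n)"
        by (rule real_sqrt_le_mono)
      then show ?thesis
        by (simp add: real_sqrt_mult real_sqrt_power D_def)
    qed
    have "summable (\<lambda>n. rep_l2 (Y (Suc n)) x - rep_l2 (Y n) x)"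
    proof (rule summable_comparison_test')
      show "summable (\<lambda>n. sqrt C * (sqrt (1/2)) ^ n)"
        by (intro summable_mult summable_geometric) (simp add: real_sqrt_divide)
      show "norm (rep_l2 (Y (Suc n)) x - rep_l2 (Y n) x) \<le> sqrt C * (sqrt (1/2)) ^ n" if "n \<ge> 0" for n
        using bound[of n] by (simp add: D_def)
    qed
    then have "convergent (\<lambda>n. \<Sum>i<n. rep_l2 (Y (Suc i)) x - rep_l2 (Y i) x)"
      by (simp add: summable_iff_convergent)
    then have "convergent (\<lambda>n. rep_l2 (Y n) x - rep_l2 (Y 0) x)"
      by (simp only: sum_lessThan_telescope[of "\<lambda>n. rep_l2 (Y n) x"])
    from convergent_add[OF this convergent_const[of "rep_l2 (Y 0) x"]]
    show "convergent (\<lambda>n. rep_l2 (Y n) x)"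
      by simp
  qed
qed

lemma convergent_of_fast_Cauchy_l2:
  fixes Y :: "nat \<Rightarrow> 'a::euclidean_space l2"
  assumes fast: "\<And>n. norm (Y (Suc n) - Y n) \<le> (1/2) ^ n" and Cauchy: "Cauchy Y"
  shows "convergent Y"
proof -
  have [measurable]: "rep_l2 (Y n) \<in> borel_measurable lborel" for n
    using square_integrable_rep_l2 by (rule square_integrable_measurable)
  define g where "g x = lim (\<lambda>n. rep_l2 (Y n) x)" for x
  have [measurable]: "g \<in> borel_measurable lborel"
    unfolding g_def by measurable
  have lim: "AE x in lborel. (\<lambda>n. rep_l2 (Y n) x) \<longlonglongrightarrow> g x"
    using AE_convergent_of_fast_Cauchy_l2[OF fast] by (simp add: g_def convergent_LIMSEQ_iff)
  have fatou: "(\<integral>\<^sup>+x. ennreal ((cmod (rep_l2 (Y n) x - g x))\<^sup>2) \<partial>lborel) \<le> ennreal (e\<^sup>2)"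
    if N: "\<And>m n. m \<ge> N \<Longrightarrow> n \<ge> N \<Longrightarrow> norm (Y m - Y n) < e" and n: "n \<ge> N" for e N n
  proof -
    have "(\<integral>\<^sup>+x. ennreal ((cmod (rep_l2 (Y n) x - g x))\<^sup>2) \<partial>lborel) =
        (\<integral>\<^sup>+x. liminf (\<lambda>m. ennreal ((cmod (rep_l2 (Y n) x - rep_l2 (Y m) x))\<^sup>2)) \<partial>lborel)"
    proof (rule nn_integral_cong_AE, use lim in \<open>rule eventually_mono\<close>)
      fix x assume "(\<lambda>n. rep_l2 (Y n) x) \<longlonglongrightarrow> g x"
      then have "(\<lambda>m. ennreal ((cmod (rep_l2 (Y n) x - rep_l2 (Y m) x))\<^sup>2)) \<longlonglongrightarrow>
          ennreal ((cmod (rep_l2 (Y n) x - g x))\<^sup>2)"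
        by (intro tendsto_ennrealI tendsto_intros)
      then show "ennreal ((cmod (rep_l2 (Y n) x - g x))\<^sup>2) =
          liminf (\<lambda>m. ennreal ((cmod (rep_l2 (Y n) x - rep_l2 (Y m) x))\<^sup>2))"
        by (intro lim_imp_Liminf[symmetric]) auto
    qed
    also have "\<dots> \<le> liminf (\<lambda>m. \<integral>\<^sup>+x. ennreal ((cmod (rep_l2 (Y n) x - rep_l2 (Y m) x))\<^sup>2) \<partial>lborel)"
      by (rule nn_integral_liminf) measurable
    also have "\<dots> \<le> liminf (\<lambda>m. ennreal (e\<^sup>2))"
    proof (rule Liminf_mono, use eventually_ge_at_top[of N] in \<open>rule eventually_mono\<close>)
      fix m assume "N \<le> m"
      then show "(\<integral>\<^sup>+x. ennreal ((cmod (rep_l2 (Y n) x - rep_l2 (Y m) x))\<^sup>2) \<partial>lborel) \<le> ennreal (e\<^sup>2)"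
        unfolding norm_diff_l2 using N[OF n, of m] by (intro ennreal_leI power_mono) auto
    qed
    also have "\<dots> = ennreal (e\<^sup>2)"
      by (simp add: Liminf_const)
    finally show ?thesis .
  qed
  have NE: "\<exists>N. \<forall>m\<ge>N. \<forall>n\<ge>N. norm (Y m - Y n) < e" if "0 < e" for e
    using CauchyD[OF Cauchy that] .
  have g: "square_integrable g"
  proof -
    obtain N where N: "\<And>m n. m \<ge> N \<Longrightarrow> n \<ge> N \<Longrightarrow> norm (Y m - Y n) < 1"
      using NE[of 1] by auto
    have "(\<integral>\<^sup>+x. ennreal ((cmod (rep_l2 (Y N) x - g x))\<^sup>2) \<partial>lborel) < \<infinity>"
      using le_less_trans[OF fatou[OF N order_refl]] by simp
    then have "square_integrable (\<lambda>x. rep_l2 (Y N) x - g x)"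
      unfolding square_integrable_def by (auto intro!: integrableI_nonneg)
    from square_integrable_diff[OF square_integrable_rep_l2[of "Y N"] this] show ?thesis
      by simp
  qed
  have "Y \<longlonglongrightarrow> abs_l2 g"
  proof (rule LIMSEQ_I)
    fix r :: real assume r: "0 < r"
    then obtain N where N: "\<And>m n. m \<ge> N \<Longrightarrow> n \<ge> N \<Longrightarrow> norm (Y m - Y n) < r / 2"
      using NE[of "r / 2"] by auto
    have "norm (Y n - abs_l2 g) < r" if "n \<ge> N" for n
    proof -
      have "ennreal ((norm (Y n - abs_l2 g))\<^sup>2) \<le> ennreal ((r / 2)\<^sup>2)"
        using fatou[OF N that] norm_abs_l2[OF square_integrable_diff[OF square_integrable_rep_l2 g], of "Y n"]
          diff_abs_l2[OF square_integrable_rep_l2 g, of "Y n"]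
        by (simp add: abs_rep_l2)
      then have "(norm (Y n - abs_l2 g))\<^sup>2 \<le> (r / 2)\<^sup>2"
        by (simp del: power_divide)
      then have "norm (Y n - abs_l2 g) \<le> r / 2"
        by (rule power2_le_imp_le) (use r in simp)
      then show ?thesis
        using r by simp
    qed
    then show "\<exists>no. \<forall>n\<ge>no. norm (Y n - abs_l2 g) < r"
      by blast
  qed
  then show ?thesis
    by (rule convergentI)
qed

text \<open>
  The Riesz-Fischer theorem. It makes the Hilbert space results above available on \<^typ>\<open>'a l2\<close>.
\<close>

instance l2 :: (euclidean_space) banach
proof
  fix X :: "nat \<Rightarrow> 'a l2"
  assume X: "Cauchy X"
  have "\<forall>k. \<exists>M. \<forall>m\<ge>M. \<forall>n\<ge>M. norm (X m - X n) < (1/2) ^ k"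
    by (intro allI CauchyD[OF X]) simp
  then obtain M where M: "\<And>k m n. m \<ge> M k \<Longrightarrow> n \<ge> M k \<Longrightarrow> norm (X m - X n) < (1/2) ^ k"
    by metis
  \<comment> \<open>The summand \<open>n\<close> makes the index sequence strictly increasing; the sum puts it above every \<open>M i\<close>
    with \<open>i \<le> n\<close>.\<close>
  define r where "r n = n + (\<Sum>i\<le>n. M i)" for n
  have r: "strict_mono r" "\<And>n. M n \<le> r n"
  proof -
    show "strict_mono r"
      by (intro strict_mono_Suc_iff[THEN iffD2]) (simp add: r_def)
    show "M n \<le> r n" for n
      using member_le_sum[of n "{..n}" M] by (simp add: r_def)
  qed
  have "norm ((X \<circ> r) (Suc n) - (X \<circ> r) n) \<le> (1/2) ^ n" for n
  proof -
    have "r n \<le> r (Suc n)"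
      using r(1) by (simp add: strict_mono_less_eq)
    then have "M n \<le> r (Suc n)"
      using r(2)[of n] by linarith
    then show ?thesis
      using M[of n "r (Suc n)" "r n"] r(2)[of n] by simp
  qed
  then have "convergent (X \<circ> r)"
    by (rule convergent_of_fast_Cauchy_l2) (rule Cauchy_subseq_Cauchy[OF X r(1)])
  then obtain l where "(X \<circ> r) \<longlonglongrightarrow> l"
    unfolding convergent_def by blast
  then show "convergent X"
    using Cauchy_converges_subseq[OF X r(1)] convergentI by blast
qed

section \<open>Trace-class operators over the complex numbers\<close>

text \<open>
  The complex structure of \<open>L\<^sup>2\<close> as a real-linear isometry: a real-linear operator is complex-linear
  exactly if it commutes with this map, and the complex inner product is recovered from the real one
  by means of it.
\<close>

definition imult :: "'a::euclidean_space l2 \<Rightarrow> 'a l2" where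
  "imult \<psi> = \<i> *\<^sub>C \<psi>"

lemma cinner_add_left: "cinner (f + g) h = cinner f h + cinner g h"
  by transfer (simp add: l2_rel_def distrib_right square_integrable_mult_cnj)

lemma cinner_scaleC_left: "cinner (c *\<^sub>C f) g = c * cinner f g"
  by transfer (simp add: mult.assoc)

lemma cinner_commute: "cinner f g = cnj (cinner g f)"
  by transfer (subst Bochner_Integration.integral_cnj[symmetric], simp add: mult.commute)

lemma scaleC_scaleC: "a *\<^sub>C b *\<^sub>C f = (a * b) *\<^sub>C f"
  by transfer (auto simp: l2_rel_def mult.assoc intro!: square_integrable_cmult)

lemma scaleC_add_left: "(a + b) *\<^sub>C f = a *\<^sub>C f + b *\<^sub>C f"
  by transfer (auto simp: l2_rel_def distrib_right intro!: square_integrable_add square_integrable_cmult)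

lemma scaleC_conv: "c *\<^sub>C f = Re c *\<^sub>R f + Im c *\<^sub>R imult f"
proof -
  have "c *\<^sub>C f = (complex_of_real (Re c) + complex_of_real (Im c) * \<i>) *\<^sub>C f"
    by (metis complex_eq mult.commute)
  then show ?thesis
    by (simp add: scaleC_add_left scaleR_l2_def imult_def scaleC_scaleC)
qed

lemma imult_imult: "imult (imult f) = - f"
  using scaleC_conv[of "-1" f] by (simp add: imult_def scaleC_scaleC)

lemma inner_imult_left: "inner (imult f) g = - inner f (imult g)"
  by (simp add: inner_l2_def imult_def cinner_scaleC_left cinner_commute[of f "_ *\<^sub>C _"] cinner_commute[of f g])

lemma inner_imult_imult: "inner (imult f) (imult g) = inner f g"
  by (simp add: inner_imult_left imult_imult)

lemma linear_imult: "linear imult"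
proof (rule linearI)
  fix f g :: "'a l2" and r
  have "\<forall>h. inner (imult (f + g)) h = inner (imult f + imult g) h"
    by (simp add: inner_imult_left inner_add_left)
  then show "imult (f + g) = imult f + imult g"
    by (rule iffD1[OF vector_eq_rdot])
  show "imult (r *\<^sub>R f) = r *\<^sub>R imult f"
    by (simp add: imult_def scaleR_l2_def scaleC_scaleC mult.commute)
qed

lemma bounded_linear_imult: "bounded_linear imult"
proof (rule bounded_linear_intro)
  show "norm (imult f) \<le> norm f * 1" for f :: "'a l2"
    by (simp add: norm_eq_sqrt_inner inner_imult_imult)
qed (auto simp: linear_add[OF linear_imult] linear_cmul[OF linear_imult])

lemma cinner_conv: "cinner f g = Complex (inner f g) (inner f (imult g))"
proof -
  have "Im (cinner f g) = - Re (cinner (imult f) g)"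
    by (simp add: imult_def cinner_scaleC_left)
  then show ?thesis
    using inner_imult_left[of f g] by (simp add: complex_eq_iff inner_l2_def)
qed

lemma norm_cinner_le: "cmod (cinner f g) \<le> 2 * (norm f * norm g)"
proof -
  have "cmod (cinner f g) \<le> \<bar>inner f g\<bar> + \<bar>inner f (imult g)\<bar>"
    using cmod_le[of "cinner f g"] by (simp add: cinner_conv)
  also have "\<dots> \<le> norm f * norm g + norm f * norm (imult g)"
    by (intro add_mono Cauchy_Schwarz_ineq2)
  also have "norm (imult g) = norm g"
    by (simp add: norm_eq_sqrt_inner inner_imult_imult)
  finally show ?thesis
    by simp
qed

lemma bounded_clinear_iff:
  "bounded_clinear T \<longleftrightarrow> bounded_linear T \<and> (\<forall>x. T (imult x) = imult (T x))"
proof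
  assume "bounded_clinear T"
  then show "bounded_linear T \<and> (\<forall>x. T (imult x) = imult (T x))"
    by (simp add: bounded_clinear_def imult_def)
next
  assume T: "bounded_linear T \<and> (\<forall>x. T (imult x) = imult (T x))"
  then have "linear T"
    by (simp add: bounded_linear.linear)
  with T show "bounded_clinear T"
    by (simp add: bounded_clinear_def scaleC_conv linear_add linear_cmul)
qed

lemma cadjoint_eq_adjoint:
  assumes T: "bounded_clinear T"
  shows "cadjoint T = adjoint T"
  unfolding cadjoint_def
proof (rule the_equality)
  have bl: "bounded_linear T" and im: "T (imult x) = imult (T x)" for x
    using T by (auto simp: bounded_clinear_iff)
  show "\<forall>x y. cinner (T x) y = cinner x (adjoint T y)"
  proof (intro allI)
    fix x y
    have "inner (T x) (imult y) = - inner (T (imult x)) y"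
      by (simp add: im inner_imult_left)
    also have "\<dots> = inner x (imult (adjoint T y))"
      unfolding inner_adjoint[OF bl] by (simp add: inner_imult_left)
    finally show "cinner (T x) y = cinner x (adjoint T y)"
      by (simp add: cinner_conv inner_adjoint[OF bl, of x y])
  qed
  fix T' assume T': "\<forall>x y. cinner (T x) y = cinner x (T' y)"
  show "T' = adjoint T"
  proof
    fix y
    have "\<forall>x. inner x (T' y) = inner x (adjoint T y)"
      unfolding inner_adjoint[OF bl, symmetric] using T' by (simp add: inner_l2_def)
    then show "T' y = adjoint T y"
      by (rule iffD1[OF vector_eq_ldot])
  qed
qed

text \<open>
  On a complex space, real values of \<open>\<langle>P x, x\<rangle>\<close> already give symmetry: polarising
  \<open>Im \<langle>P x, x\<rangle> = 0\<close> at \<open>x + \<i> y\<close> yields \<open>\<langle>P x, y\<rangle> = \<langle>x, P y\<rangle>\<close>.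
\<close>

lemma positive_operator_iff:
  "positive_operator P \<longleftrightarrow> psd_operator P \<and> (\<forall>x. P (imult x) = imult (P x))"
proof
  assume P: "positive_operator P"
  then have bl: "bounded_linear P" and im: "P (imult x) = imult (P x)" for x
    by (auto simp: positive_operator_def bounded_clinear_iff)
  interpret bounded_linear P by fact
  have nonneg: "0 \<le> inner (P x) x" and real: "inner (P x) (imult x) = 0" for x
    using P by (auto simp: positive_operator_def cinner_conv complex_is_Real_iff)
  have sym: "inner (P x) y = inner x (P y)" for x y
  proof -
    have "inner (P (x + imult y)) (imult (x + imult y)) = 0"
      by (rule real)
    then have "inner (P x) (imult (imult y)) + inner (P (imult y)) (imult x) = 0"
      using real[of x] real[of "imult y"] linear_add[OF linear_imult, of x "imult y"]
      by (simp add: add inner_add_left inner_add_right)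
    then show ?thesis
      by (simp add: imult_imult im inner_imult_imult inner_commute)
  qed
  with bl nonneg im show "psd_operator P \<and> (\<forall>x. P (imult x) = imult (P x))"
    by (simp add: psd_operator_def)
next
  assume "psd_operator P \<and> (\<forall>x. P (imult x) = imult (P x))"
  then have P: "psd_operator P" and im: "P (imult x) = imult (P x)" for x
    by auto
  have "inner (P x) (imult x) = 0" for x
    using psd_sym[OF P, of x "imult x"] inner_imult_left[of "P x" x] by (simp add: im inner_commute)
  with P im show "positive_operator P"
    by (simp add: positive_operator_def bounded_clinear_iff psd_bounded_linear psd_nonneg
        cinner_conv complex_is_Real_iff)
qed

text \<open>
  The definite description in the definition of \<open>|T|\<close> denotes: \<open>T\<^sup>* T\<close> is positive and commutes
  with multiplication by \<open>\<i>\<close>, hence so does its unique positive square root.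
\<close>

lemma abs_operator:
  assumes T: "bounded_clinear T"
  shows "is_modulus (abs_operator T) T" "\<And>x. abs_operator T (imult x) = imult (abs_operator T x)"
proof -
  have bl: "bounded_linear T" and im: "T (imult x) = imult (T x)" for x
    using T by (auto simp: bounded_clinear_iff)
  define A where "A x = adjoint T (T x)" for x
  have innerA: "inner (A x) y = inner (T x) (T y)" for x y
    using inner_adjoint[OF bl, of y "T x"] by (simp add: A_def inner_commute)
  have "psd_operator A"
    unfolding psd_operator_def
  proof (intro conjI allI)
    show "bounded_linear A"
      unfolding A_def by (rule bounded_linear_compose[OF bounded_linear_adjoint[OF bl] bl])
    show "inner (A x) y = inner x (A y)" for x y
      using innerA[of x y] innerA[of y x] by (simp add: inner_commute)
    show "0 \<le> inner (A x) x" for x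
      by (simp add: innerA)
  qed
  then obtain P where P: "psd_operator P" "\<And>x. P (P x) = A x"
      and comm: "\<forall>C. bounded_linear C \<and> (\<forall>x. C (A x) = A (C x)) \<longrightarrow> (\<forall>x. C (P x) = P (C x))"
    using psd_sqrt_exists by blast
  have "imult (A x) = A (imult x)" for x
  proof (rule iffD1[OF vector_eq_rdot], rule allI)
    show "inner (imult (A x)) z = inner (A (imult x)) z" for z
      by (simp add: inner_imult_left innerA im)
  qed
  then have P_im: "P (imult x) = imult (P x)" for x
    using comm bounded_linear_imult by metis
  have "abs_operator T = P"
    unfolding abs_operator_def
  proof (rule the_equality)
    show "positive_operator P \<and> P \<circ> P = cadjoint T \<circ> T"
      using P P_im by (auto simp: positive_operator_iff cadjoint_eq_adjoint[OF T] A_def fun_eq_iff)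
    fix P' assume "positive_operator P' \<and> P' \<circ> P' = cadjoint T \<circ> T"
    then have "psd_operator P'" "\<And>x. P' (P' x) = A x"
      by (auto simp: positive_operator_iff cadjoint_eq_adjoint[OF T] A_def fun_eq_iff)
    then show "P' = P"
      by (intro psd_sqrt_unique P(1)) (simp_all add: P(2))
  qed
  then show "is_modulus (abs_operator T) T" "\<And>x. abs_operator T (imult x) = imult (abs_operator T x)"
    using P P_im by (auto simp: is_modulus_def innerA)
qed

lemma orthonormal_basis_exists: "\<exists>E :: 'a::euclidean_space l2 set. orthonormal_basis E"
proof -
  define \<A> where A_def: "\<A> = {E :: 'a l2 set. \<forall>e\<in>E. \<forall>e'\<in>E. cinner e e' = (if e = e' then 1 else 0)}"
  have "\<exists>M\<in>\<A>. \<forall>X\<in>\<A>. M \<subseteq> X \<longrightarrow> X = M"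
  proof (rule subset_Zorn')
    fix C assume C: "subset.chain \<A> C"
    show "\<Union>C \<in> \<A>"
      unfolding A_def
    proof (intro CollectI ballI)
      fix e e' assume "e \<in> \<Union>C" "e' \<in> \<Union>C"
      then obtain X Y where X: "X \<in> C" "e \<in> X" "Y \<in> C" "e' \<in> Y"
        by blast
      then have "X \<in> \<A>" "Y \<in> \<A>" "X \<subseteq> Y \<or> Y \<subseteq> X"
        using C unfolding subset.chain_def by blast+
      then show "cinner e e' = (if e = e' then 1 else 0)"
        using X unfolding A_def by blast
    qed
  qed
  then obtain M where M: "M \<in> \<A>" and max: "\<And>X. X \<in> \<A> \<Longrightarrow> M \<subseteq> X \<Longrightarrow> X = M"
    by blast
  have "\<psi> = 0" if perp: "\<forall>e\<in>M. cinner \<psi> e = 0" for \<psi>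
  proof (rule ccontr)
    assume "\<psi> \<noteq> 0"
    define e where "e = complex_of_real (1 / norm \<psi>) *\<^sub>C \<psi>"
    have e: "e = (1 / norm \<psi>) *\<^sub>R \<psi>"
      by (simp add: e_def scaleR_l2_def)
    have "inner e e = 1"
      using \<open>\<psi> \<noteq> 0\<close> by (simp add: e flip: power2_norm_eq_inner)
    moreover have "inner e (imult e) = 0"
      using inner_imult_left[of e e] by (simp add: inner_commute)
    ultimately have ee: "cinner e e = 1"
      by (simp add: cinner_conv complex_eq_iff)
    have em: "cinner e m = 0" "cinner m e = 0" if "m \<in> M" for m
      using perp that cinner_commute[of m e] by (auto simp: e_def cinner_scaleC_left)
    have "insert e M \<in> \<A>"
      using M ee em by (auto simp: A_def)
    then have "e \<in> M"
      using max[of "insert e M"] by blast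
    then show False
      using em(1)[of e] ee by simp
  qed
  with M have "orthonormal_basis M"
    by (auto simp: orthonormal_basis_def A_def)
  then show ?thesis
    by blast
qed

lemma orthonormal_basis_some_onb: "orthonormal_basis some_onb"
  unfolding some_onb_def using orthonormal_basis_exists by (rule someI_ex)

text \<open>
  An orthonormal basis \<open>E\<close> over the complex numbers gives the basis \<open>E \<union> \<i> E\<close> of the underlying real
  Hilbert space. A complex-linear positive operator has the same diagonal entry at \<open>e\<close> and at
  \<open>\<i> e\<close>, so the real trace is twice the complex one. This is the origin of the factor 2 in the bounds
  that follow.
\<close>

definition real_onb :: "'a::euclidean_space l2 set" where
  "real_onb = some_onb \<union> imult ` some_onb"

lemma hilbert_basis_real_onb: "hilbert_basis real_onb"
proof -
  have ortho: "cinner e e' = (if e = e' then 1 else 0)" if "e \<in> some_onb" "e' \<in> some_onb" for e e' :: "'a l2"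
    using orthonormal_basis_some_onb that by (auto simp: orthonormal_basis_def)
  then have re: "inner e e' = (if e = e' then 1 else 0)" and im: "inner e (imult e') = 0" "inner (imult e) e' = 0"
    if "e \<in> some_onb" "e' \<in> some_onb" for e e' :: "'a l2"
    using that by (auto simp: cinner_conv complex_eq_iff inner_imult_left split: if_splits)
  have inj: "imult e = imult e' \<longleftrightarrow> e = e'" for e e' :: "'a l2"
    by (metis imult_imult neg_equal_iff_equal)
  have ne: "e \<noteq> imult e'" if "e \<in> some_onb" "e' \<in> some_onb" for e e' :: "'a l2"
    using im(1)[OF that] re[OF that(1) that(1)] by auto
  have "orthonormal (real_onb :: 'a l2 set)"
    unfolding orthonormal_def real_onb_def
    using re im ne ne[symmetric] by (auto simp: inner_imult_imult inj)
  moreover have "\<psi> = 0" if "\<forall>e\<in>real_onb. inner \<psi> e = 0" for \<psi> :: "'a l2"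
    using orthonormal_basis_some_onb that
    by (auto simp: orthonormal_basis_def real_onb_def cinner_conv complex_eq_iff)
  ultimately show ?thesis
    by (auto simp: hilbert_basis_def)
qed

lemma trace_class_bounded_clinear: "trace_class T \<Longrightarrow> bounded_clinear T"
  by (simp add: trace_class_def)

lemma trace_norm_alt: "trace_norm T = (\<Sum>\<^sub>\<infinity>e\<in>some_onb. inner (abs_operator T e) e)"
  by (simp add: trace_norm_def inner_l2_def)

lemma trace_class_alt:
  "trace_class T \<longleftrightarrow> bounded_clinear T \<and> (\<lambda>e. inner (abs_operator T e) e) summable_on some_onb"
  by (simp add: trace_class_def inner_l2_def)

lemma abs_operator_nonneg: "bounded_clinear T \<Longrightarrow> 0 \<le> inner (abs_operator T x) x"
  using abs_operator(1)[of T] by (auto simp: is_modulus_def psd_nonneg)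

lemma trace_class_real_sum_le:
  assumes T: "trace_class T" and G: "finite G" "G \<subseteq> real_onb"
  shows "(\<Sum>e\<in>G. inner (abs_operator T e) e) \<le> 2 * trace_norm T"
proof -
  let ?P = "abs_operator T"
  let ?q = "\<lambda>e. inner (?P e) e"
  have bc: "bounded_clinear T"
    using T by (rule trace_class_bounded_clinear)
  note nonneg = abs_operator_nonneg[OF bc]
  have inj: "inj imult"
    by (rule injI) (metis imult_imult neg_equal_iff_equal)
  have q_im: "?q (imult e) = ?q e" for e
    by (simp add: abs_operator(2)[OF bc] inner_imult_imult)
  define F where "F = (G \<union> imult -` G) \<inter> some_onb"
  have F: "finite F" "F \<subseteq> some_onb"
    using G(1) by (auto simp: F_def intro: finite_vimageI[OF _ inj])
  have "sum ?q G \<le> sum ?q (F \<union> imult ` F)"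
    using G F(1) nonneg by (intro sum_mono2) (auto simp: F_def real_onb_def)
  also have "\<dots> \<le> sum ?q F + sum ?q (imult ` F)"
    using sum.union_inter[of F "imult ` F" ?q] F(1) sum_nonneg[of "F \<inter> imult ` F" ?q] nonneg by simp
  also have "sum ?q (imult ` F) = sum ?q F"
    using inj by (subst sum.reindex) (auto simp: q_im inj_on_def)
  also have "sum ?q F \<le> trace_norm T"
    unfolding trace_norm_alt using T F nonneg by (intro finite_sum_le_infsum) (auto simp: trace_class_alt)
  finally show ?thesis
    by simp
qed

lemma trace_norm_nonneg: "trace_class T \<Longrightarrow> 0 \<le> trace_norm T"
  unfolding trace_norm_alt
  by (intro infsum_nonneg abs_operator_nonneg trace_class_bounded_clinear)

lemma trace_class_norm_le:
  assumes T: "trace_class T"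
  shows "norm (T x) \<le> 2 * trace_norm T * norm x"
proof -
  have modulus: "is_modulus (abs_operator T) T"
    by (rule abs_operator(1)[OF trace_class_bounded_clinear[OF T]])
  have "norm (abs_operator T x) \<le> 2 * trace_norm T * norm x"
    by (rule psd_norm_le_trace[OF hilbert_basis_real_onb])
       (use modulus trace_class_real_sum_le[OF T] in \<open>auto simp: is_modulus_def\<close>)
  then show ?thesis
    by (simp add: is_modulus_norm[OF modulus])
qed

text \<open>
  Matrix coefficients are continuous in the trace norm. One factor 2 comes from passing to the real
  basis, the other from bounding real and imaginary parts separately.
\<close>

lemma trace_class_cinner_le:
  assumes T: "trace_class T"
  shows "cmod (cinner (T \<psi>) \<phi>) \<le> 4 * norm \<psi> * norm \<phi> * trace_norm T"
proof -
  have "cmod (cinner (T \<psi>) \<phi>) \<le> 2 * (norm (T \<psi>) * norm \<phi>)"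
    by (rule norm_cinner_le)
  also have "\<dots> \<le> 2 * (2 * trace_norm T * norm \<psi> * norm \<phi>)"
    by (intro mult_left_mono mult_right_mono trace_class_norm_le T) auto
  finally show ?thesis
    by (simp add: mult_ac)
qed

text \<open>
  Additivity of the convolution in the operator can only be applied to trace-class summands. To
  split an operator into an approximant and a remainder, one therefore has to know that the
  remainder is of trace class.
\<close>

lemma trace_class_add:
  assumes T: "trace_class T\<^sub>1" "trace_class T\<^sub>2"
  shows "trace_class (\<lambda>\<psi>. T\<^sub>1 \<psi> + T\<^sub>2 \<psi>)"
proof -
  note bc = T[THEN trace_class_bounded_clinear]
  have bl: "bounded_linear T\<^sub>1" "bounded_linear T\<^sub>2"
    using bc by (auto simp: bounded_clinear_iff)
  let ?T = "\<lambda>\<psi>. T\<^sub>1 \<psi> + T\<^sub>2 \<psi>"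
  have bcT: "bounded_clinear ?T"
    using bc by (auto simp: bounded_clinear_iff linear_add[OF linear_imult] intro: bounded_linear_add)
  have "(\<Sum>e\<in>F. inner (abs_operator ?T e) e) \<le> 2 * trace_norm T\<^sub>1 + 2 * trace_norm T\<^sub>2"
    if "finite F" "F \<subseteq> some_onb" for F
    by (rule trace_triangle_inequality[OF hilbert_basis_real_onb bl abs_operator(1)[OF bc(1)]
          abs_operator(1)[OF bc(2)] abs_operator(1)[OF bcT]])
       (use that trace_class_real_sum_le T in \<open>auto simp: real_onb_def\<close>)
  then have "bdd_above (sum (\<lambda>e. inner (abs_operator ?T e) e) ` {F. F \<subseteq> some_onb \<and> finite F})"
    by (intro bdd_aboveI[of _ "2 * trace_norm T\<^sub>1 + 2 * trace_norm T\<^sub>2"]) auto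
  then show ?thesis
    unfolding trace_class_alt
    by (intro conjI bcT nonneg_bdd_above_summable_on abs_operator_nonneg)
qed

section \<open>Jordan decomposition of signed measures\<close>

definition signed_measure :: "('b::topological_space set \<Rightarrow> real) \<Rightarrow> bool" where
  "signed_measure \<nu> \<longleftrightarrow> (\<forall>A :: nat \<Rightarrow> 'b set. range A \<subseteq> sets borel \<and> disjoint_family A \<longrightarrow>
     (\<lambda>n. \<nu> (A n)) sums \<nu> (\<Union>n. A n))"

lemma signed_measure_sums:
  "signed_measure \<nu> \<Longrightarrow> (\<And>n::nat. A n \<in> sets borel) \<Longrightarrow> disjoint_family A \<Longrightarrow>
    (\<lambda>n. \<nu> (A n)) sums \<nu> (\<Union>n. A n)"
  unfolding signed_measure_def by blast

lemma signed_measure_empty: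
  assumes "signed_measure \<nu>"
  shows "\<nu> {} = 0"
  using signed_measure_sums[OF assms, of "\<lambda>_. {}"]
  by (auto simp: disjoint_family_on_def sums_iff summable_const_iff)

lemma signed_measure_Un:
  assumes \<nu>: "signed_measure \<nu>" and A: "A \<in> sets borel" "B \<in> sets borel" "A \<inter> B = {}"
  shows "\<nu> (A \<union> B) = \<nu> A + \<nu> B"
proof -
  have "(\<lambda>n. \<nu> (binaryset A B n)) sums \<nu> (\<Union>n. binaryset A B n)"
  proof (rule signed_measure_sums[OF \<nu>])
    show "binaryset A B n \<in> sets borel" for n
      using A by (simp add: binaryset_def)
    show "disjoint_family (binaryset A B)"
      using A(3) by (auto simp: disjoint_family_on_def binaryset_def)
  qed
  moreover have "(\<lambda>n. \<nu> (binaryset A B n)) sums (\<nu> A + \<nu> B)"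
    by (rule binaryset_sums) (rule signed_measure_empty[OF \<nu>])
  ultimately show ?thesis
    using sums_unique2 by (fastforce simp: UN_binaryset_eq)
qed

lemma signed_measure_Diff:
  assumes "signed_measure \<nu>" "A \<in> sets borel" "B \<in> sets borel" "B \<subseteq> A"
  shows "\<nu> (A - B) = \<nu> A - \<nu> B"
proof -
  have "\<nu> ((A - B) \<union> B) = \<nu> (A - B) + \<nu> B"
    by (rule signed_measure_Un) (use assms in auto)
  moreover have "(A - B) \<union> B = A"
    using assms by auto
  ultimately show ?thesis
    by simp
qed

lemma signed_measure_uminus: "signed_measure \<nu> \<Longrightarrow> signed_measure (\<lambda>A. - \<nu> A)"
  unfolding signed_measure_def using sums_minus by blast

text \<open>
  Call a set bad if \<open>\<nu>\<close> is unbounded on its subsets. A bad set \<open>A\<close> contains \<open>B\<close> with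
  \<open>|\<nu> B| > 1 + |\<nu> A|\<close>, so that \<open>|\<nu> B|\<close> and \<open>|\<nu> (A - B)|\<close> are both at least \<open>1\<close>,
  and one of the two sets is bad. Repeating this in the bad part produces disjoint sets whose measures
  have absolute value at least \<open>1\<close>, contrary to the convergence of their sum.
\<close>

lemma signed_measure_bounded:
  assumes \<nu>: "signed_measure \<nu>"
  shows "\<exists>K. \<forall>B\<in>sets borel. \<bar>\<nu> B\<bar> \<le> K"
proof (rule ccontr)
  assume unbdd: "\<nexists>K. \<forall>B\<in>sets borel. \<bar>\<nu> B\<bar> \<le> K"
  define U where "U A \<longleftrightarrow> A \<in> sets borel \<and> (\<forall>K. \<exists>B\<in>sets borel. B \<subseteq> A \<and> K < \<bar>\<nu> B\<bar>)" for A
  have U0: "U UNIV"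
    using unbdd by (auto simp: U_def not_le)
  have step: "\<exists>B. U B \<and> B \<subseteq> A \<and> 1 \<le> \<bar>\<nu> (A - B)\<bar>" if A: "U A" for A
  proof -
    obtain B where B: "B \<in> sets borel" "B \<subseteq> A" "1 + \<bar>\<nu> A\<bar> < \<bar>\<nu> B\<bar>"
      using A by (auto simp: U_def)
    have Ab: "A \<in> sets borel"
      using A by (simp add: U_def)
    have diff: "\<nu> (A - B) = \<nu> A - \<nu> B"
      by (rule signed_measure_Diff[OF \<nu> Ab B(1,2)])
    show ?thesis
    proof (cases "U B")
      case True
      then show ?thesis
        using B diff by (intro exI[of _ B]) auto
    next
      case False
      then obtain K where "\<forall>C\<in>sets borel. C \<subseteq> B \<longrightarrow> \<not> K < \<bar>\<nu> C\<bar>"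
        using B(1) unfolding U_def by blast
      then have K: "\<And>C. C \<in> sets borel \<Longrightarrow> C \<subseteq> B \<Longrightarrow> \<bar>\<nu> C\<bar> \<le> K"
        by (simp add: not_less)
      have "U (A - B)"
        unfolding U_def
      proof (intro conjI allI)
        show "A - B \<in> sets borel"
          using Ab B(1) by auto
        fix L
        obtain C where C: "C \<in> sets borel" "C \<subseteq> A" "K + L < \<bar>\<nu> C\<bar>"
          using A by (auto simp: U_def)
        have "\<nu> C = \<nu> (C - B) + \<nu> (C \<inter> B)"
          using signed_measure_Un[OF \<nu>, of "C - B" "C \<inter> B"] C B(1) by (auto simp: Un_Diff_Int)
        moreover have "\<bar>\<nu> (C \<inter> B)\<bar> \<le> K"
          using C B(1) by (intro K) auto
        ultimately have "L < \<bar>\<nu> (C - B)\<bar>"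
          using C(3) by linarith
        then show "\<exists>D\<in>sets borel. D \<subseteq> A - B \<and> L < \<bar>\<nu> D\<bar>"
          using C B(1) by (intro bexI[of _ "C - B"]) auto
      qed
      moreover have "A - (A - B) = B"
        using B(2) by auto
      ultimately show ?thesis
        using B(3) by (intro exI[of _ "A - B"]) auto
    qed
  qed
  have "\<exists>A. \<forall>n. U (A n) \<and> (A (Suc n) \<subseteq> A n \<and> 1 \<le> \<bar>\<nu> (A n - A (Suc n))\<bar>)"
    by (rule dependent_nat_choice) (use U0 step in auto)
  then obtain A where A: "\<And>n::nat. U (A n)" "\<And>n. A (Suc n) \<subseteq> A n" "\<And>n. 1 \<le> \<bar>\<nu> (A n - A (Suc n))\<bar>"
    by blast
  have "decseq A"
    using A(2) by (rule decseq_SucI)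
  have "disjoint_family (\<lambda>n. A n - A (Suc n))"
    unfolding disjoint_family_on_def
  proof (intro ballI impI)
    fix m n :: nat assume "m \<noteq> n"
    then consider "Suc m \<le> n" | "Suc n \<le> m"
      by linarith
    then show "(A m - A (Suc m)) \<inter> (A n - A (Suc n)) = {}"
      using decseqD[OF \<open>decseq A\<close>] by cases blast+
  qed
  moreover have "A n \<in> sets borel" for n
    using A(1) by (simp add: U_def)
  ultimately have "summable (\<lambda>n. \<nu> (A n - A (Suc n)))"
    by (intro sums_summable[OF signed_measure_sums[OF \<nu>]]) auto
  then have "(\<lambda>n. \<bar>\<nu> (A n - A (Suc n))\<bar>) \<longlonglongrightarrow> 0"
    by (intro tendsto_rabs_zero summable_LIMSEQ_zero)
  then show False
    using LIMSEQ_le_const[of _ 0 1] A(3) by fastforce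
qed

definition positive_part :: "('b::topological_space set \<Rightarrow> real) \<Rightarrow> 'b set \<Rightarrow> real" where
  "positive_part \<nu> A = (SUP B \<in> {B \<in> sets borel. B \<subseteq> A}. \<nu> B)"

context
  fixes \<nu> :: "'b::topological_space set \<Rightarrow> real"
  assumes \<nu>: "signed_measure \<nu>"
begin

lemma positive_part_bdd: "bdd_above (\<nu> ` {B \<in> sets borel. B \<subseteq> A})"
proof -
  obtain K where "\<forall>B\<in>sets borel. \<bar>\<nu> B\<bar> \<le> K"
    using signed_measure_bounded[OF \<nu>] by blast
  then show ?thesis
    by (intro bdd_aboveI[of _ K]) (auto simp: abs_le_iff)
qed

lemma positive_part_ge: "B \<in> sets borel \<Longrightarrow> B \<subseteq> A \<Longrightarrow> \<nu> B \<le> positive_part \<nu> A"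
  unfolding positive_part_def by (intro cSUP_upper positive_part_bdd) auto

lemma positive_part_le: "(\<And>B. B \<in> sets borel \<Longrightarrow> B \<subseteq> A \<Longrightarrow> \<nu> B \<le> c) \<Longrightarrow> positive_part \<nu> A \<le> c"
  unfolding positive_part_def by (intro cSUP_least) auto

lemma positive_part_nonneg: "0 \<le> positive_part \<nu> A"
  using positive_part_ge[of "{}" A] signed_measure_empty[OF \<nu>] by simp

lemma positive_part_mono: "A \<subseteq> B \<Longrightarrow> positive_part \<nu> A \<le> positive_part \<nu> B"
  by (intro positive_part_le positive_part_ge) auto

lemma positive_part_superadditive:
  assumes "A \<inter> B = {}"
  shows "positive_part \<nu> A + positive_part \<nu> B \<le> positive_part \<nu> (A \<union> B)"
proof -
  have "\<nu> C + \<nu> D \<le> positive_part \<nu> (A \<union> B)"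
    if "C \<in> sets borel" "C \<subseteq> A" "D \<in> sets borel" "D \<subseteq> B" for C D
  proof -
    have "\<nu> C + \<nu> D = \<nu> (C \<union> D)"
      using that assms by (intro signed_measure_Un[OF \<nu>, symmetric]) auto
    also have "\<dots> \<le> positive_part \<nu> (A \<union> B)"
      using that by (intro positive_part_ge) auto
    finally show ?thesis .
  qed
  then have "\<nu> C \<le> positive_part \<nu> (A \<union> B) - \<nu> D"
    if "C \<in> sets borel" "C \<subseteq> A" "D \<in> sets borel" "D \<subseteq> B" for C D
    using that by (fastforce simp: le_diff_eq)
  then have "positive_part \<nu> A \<le> positive_part \<nu> (A \<union> B) - \<nu> D" if "D \<in> sets borel" "D \<subseteq> B" for D
    using that by (intro positive_part_le) auto
  then have "\<nu> D \<le> positive_part \<nu> (A \<union> B) - positive_part \<nu> A" if "D \<in> sets borel" "D \<subseteq> B" for D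
    using that by (fastforce simp: algebra_simps)
  then have "positive_part \<nu> B \<le> positive_part \<nu> (A \<union> B) - positive_part \<nu> A"
    by (rule positive_part_le)
  then show ?thesis
    by simp
qed

lemma positive_part_sum_le:
  fixes A :: "nat \<Rightarrow> 'b set"
  assumes "disjoint_family A"
  shows "(\<Sum>n<N. positive_part \<nu> (A n)) \<le> positive_part \<nu> (\<Union>n<N. A n)"
proof (induction N)
  case 0
  show ?case
    by (simp add: positive_part_nonneg)
next
  case (Suc N)
  have "(\<Union>n<N. A n) \<inter> A N = {}"
  proof -
    have "A n \<inter> A N = {}" if "n < N" for n
      by (rule disjoint_family_onD[OF assms]) (use that in auto)
    then show ?thesis
      by blast
  qed
  from positive_part_superadditive[OF this] Suc show ?case
    by (simp add: lessThan_Suc Un_commute)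
qed

text \<open>
  Superadditivity bounds the partial sums by the value on the union. Conversely a subset \<open>B\<close> of the
  union is cut into the pieces \<open>B \<inter> A\<^sub>n\<close>, whose measures are at most \<open>\<nu>\<^sup>+ (A\<^sub>n)\<close>.
\<close>

lemma positive_part_sums:
  assumes A: "\<And>n::nat. A n \<in> sets borel" "disjoint_family A"
  shows "(\<lambda>n. positive_part \<nu> (A n)) sums positive_part \<nu> (\<Union>n. A n)"
proof -
  have le: "(\<Sum>n<N. positive_part \<nu> (A n)) \<le> positive_part \<nu> (\<Union>n. A n)" for N
    by (rule order_trans[OF positive_part_sum_le[OF A(2)] positive_part_mono]) auto
  have summable: "summable (\<lambda>n. positive_part \<nu> (A n))"
    by (rule summableI_nonneg_bounded[OF positive_part_nonneg le])
  have "positive_part \<nu> (\<Union>n. A n) \<le> (\<Sum>n. positive_part \<nu> (A n))"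
  proof (rule positive_part_le)
    fix B assume B: "B \<in> sets borel" "B \<subseteq> (\<Union>n. A n)"
    have "(\<lambda>n. \<nu> (B \<inter> A n)) sums \<nu> (\<Union>n. B \<inter> A n)"
      using B A by (intro signed_measure_sums[OF \<nu>] disjoint_family_subset[OF A(2)]) auto
    moreover have "(\<Union>n. B \<inter> A n) = B"
      using B(2) by auto
    ultimately have "(\<lambda>n. \<nu> (B \<inter> A n)) sums \<nu> B"
      by simp
    then show "\<nu> B \<le> (\<Sum>n. positive_part \<nu> (A n))"
      by (rule sums_le[rotated]) (use summable B A in \<open>auto intro!: positive_part_ge summable_sums\<close>)
  qed
  moreover have "(\<Sum>n. positive_part \<nu> (A n)) \<le> positive_part \<nu> (\<Union>n. A n)"
    by (rule suminf_le_const[OF summable le])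
  ultimately show ?thesis
    using summable by (simp add: sums_iff)
qed

lemma ennreal_positive_part:
  "(SUP B \<in> {B \<in> sets borel. B \<subseteq> A}. ennreal (\<nu> B)) = ennreal (positive_part \<nu> A)"
proof -
  let ?S = "{B \<in> sets borel. B \<subseteq> A}"
  have "(SUP B \<in> ?S. ennreal (\<nu> B)) \<le> ennreal (positive_part \<nu> A)"
    by (intro SUP_least ennreal_leI positive_part_ge) auto
  moreover have "ennreal (positive_part \<nu> A) \<le> (SUP B \<in> ?S. ennreal (\<nu> B))"
  proof (cases "(SUP B \<in> ?S. ennreal (\<nu> B)) = top")
    case False
    define s where "s = enn2real (SUP B \<in> ?S. ennreal (\<nu> B))"
    have s: "(SUP B \<in> ?S. ennreal (\<nu> B)) = ennreal s" "0 \<le> s"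
      unfolding s_def using False by (simp_all only: ennreal_enn2real_if if_False enn2real_nonneg)
    have "positive_part \<nu> A \<le> s"
    proof (rule positive_part_le)
      fix B assume "B \<in> sets borel" "B \<subseteq> A"
      then have "ennreal (\<nu> B) \<le> ennreal s"
        unfolding s(1)[symmetric] by (intro SUP_upper) simp
      then show "\<nu> B \<le> s"
        using s(2) by (simp only: ennreal_le_iff)
    qed
    then show ?thesis
      unfolding s(1) by (rule ennreal_leI)
  qed (simp only: top_greatest)
  ultimately show ?thesis
    by (rule antisym)
qed

lemma sets_positive_part_measure [measurable_cong]: "sets (positive_part_measure \<nu>) = sets borel"
  using sets.sigma_sets_eq[of "borel :: 'b measure"]
  by (simp add: positive_part_measure_def sets_measure_of_conv)

lemma space_positive_part_measure: "space (positive_part_measure \<nu>) = UNIV"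
  unfolding positive_part_measure_def by (simp add: space_measure_of_conv)

lemma emeasure_positive_part_measure:
  assumes A: "A \<in> sets borel"
  shows "emeasure (positive_part_measure \<nu>) A = ennreal (positive_part \<nu> A)"
proof -
  have "emeasure (positive_part_measure \<nu>) A = (SUP B \<in> {B \<in> sets borel. B \<subseteq> A}. ennreal (\<nu> B))"
  proof (rule emeasure_measure_of[OF positive_part_measure_def])
    show "positive (sets (positive_part_measure \<nu>)) (\<lambda>A. SUP B \<in> {B \<in> sets borel. B \<subseteq> A}. ennreal (\<nu> B))"
      unfolding positive_def ennreal_positive_part
      using positive_part_le[of "{}" 0] positive_part_nonneg[of "{}"] signed_measure_empty[OF \<nu>] by simp
    show "countably_additive (sets (positive_part_measure \<nu>))
        (\<lambda>A. SUP B \<in> {B \<in> sets borel. B \<subseteq> A}. ennreal (\<nu> B))"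
      unfolding countably_additive_def ennreal_positive_part sets_positive_part_measure
    proof (intro allI impI)
      fix A :: "nat \<Rightarrow> 'b set"
      assume A: "range A \<subseteq> sets borel" "disjoint_family A"
      have "(\<lambda>n. positive_part \<nu> (A n)) sums positive_part \<nu> (\<Union>n. A n)"
        by (rule positive_part_sums) (use A in auto)
      then show "(\<Sum>n. ennreal (positive_part \<nu> (A n))) = ennreal (positive_part \<nu> (\<Union>n. A n))"
        by (intro suminf_ennreal_eq positive_part_nonneg)
    qed
  qed (use A in \<open>auto simp: sets_positive_part_measure\<close>)
  then show ?thesis
    by (simp add: ennreal_positive_part)
qed

lemma measure_positive_part_measure:
  "A \<in> sets borel \<Longrightarrow> measure (positive_part_measure \<nu>) A = positive_part \<nu> A"
  by (simp add: measure_def emeasure_positive_part_measure positive_part_nonneg)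

lemma finite_positive_part_measure: "finite_measure (positive_part_measure \<nu>)"
  by (rule finite_measureI) (simp add: space_positive_part_measure emeasure_positive_part_measure)

end

text \<open>
  \<open>B \<mapsto> A - B\<close> permutes the Borel subsets of \<open>A\<close>, and \<open>-\<nu> B = \<nu> (A - B) - \<nu> A\<close>. Taking
  suprema yields the Jordan decomposition without a Hahn decomposition of the space.
\<close>

lemma positive_part_minus:
  assumes \<nu>: "signed_measure \<nu>" and A: "A \<in> sets borel"
  shows "positive_part (\<lambda>A. - \<nu> A) A = positive_part \<nu> A - \<nu> A"
proof (rule antisym)
  show "positive_part (\<lambda>A. - \<nu> A) A \<le> positive_part \<nu> A - \<nu> A"
  proof (rule positive_part_le[OF signed_measure_uminus[OF \<nu>]])
    fix B assume B: "B \<in> sets borel" "B \<subseteq> A"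
    then have "\<nu> (A - B) \<le> positive_part \<nu> A"
      using A by (intro positive_part_ge[OF \<nu>]) auto
    then show "- \<nu> B \<le> positive_part \<nu> A - \<nu> A"
      using B A by (simp add: signed_measure_Diff[OF \<nu>])
  qed
  have "positive_part \<nu> A \<le> \<nu> A + positive_part (\<lambda>A. - \<nu> A) A"
  proof (rule positive_part_le[OF \<nu>])
    fix B assume B: "B \<in> sets borel" "B \<subseteq> A"
    then have "- \<nu> (A - B) \<le> positive_part (\<lambda>A. - \<nu> A) A"
      using A by (intro positive_part_ge[OF signed_measure_uminus[OF \<nu>]]) auto
    then show "\<nu> B \<le> \<nu> A + positive_part (\<lambda>A. - \<nu> A) A"
      using B A by (simp add: signed_measure_Diff[OF \<nu>])
  qed
  then show "positive_part \<nu> A - \<nu> A \<le> positive_part (\<lambda>A. - \<nu> A) A"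
    by simp
qed

lemma jordan_decomposition:
  assumes "signed_measure \<nu>" "A \<in> sets borel"
  shows "\<nu> A = measure (positive_part_measure \<nu>) A - measure (positive_part_measure (\<lambda>A. - \<nu> A)) A"
  using assms signed_measure_uminus[OF assms(1)]
  by (simp add: measure_positive_part_measure positive_part_minus)

section \<open>Integration against complex measures\<close>

lemma complex_measure_sums:
  "complex_measure \<mu> \<Longrightarrow> (\<And>n::nat. A n \<in> sets borel) \<Longrightarrow> disjoint_family A \<Longrightarrow>
    (\<lambda>n. \<mu> (A n)) sums \<mu> (\<Union>n. A n)"
  unfolding complex_measure_def by blast

lemma complex_measure_nonborel: "complex_measure \<mu> \<Longrightarrow> A \<notin> sets borel \<Longrightarrow> \<mu> A = 0"
  unfolding complex_measure_def by blast

lemma signed_measure_Re: "complex_measure \<mu> \<Longrightarrow> signed_measure (\<lambda>A. Re (\<mu> A))"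
  and signed_measure_Im: "complex_measure \<mu> \<Longrightarrow> signed_measure (\<lambda>A. Im (\<mu> A))"
  unfolding complex_measure_def signed_measure_def using sums_Re sums_Im by blast+

lemma complex_measure_empty: "complex_measure \<mu> \<Longrightarrow> \<mu> {} = 0"
  using signed_measure_empty[OF signed_measure_Re[of \<mu>]] signed_measure_empty[OF signed_measure_Im[of \<mu>]]
  by (simp add: complex_eq_iff)

lemma complex_measure_bounded:
  assumes \<mu>: "complex_measure \<mu>"
  shows "\<exists>K\<ge>0. \<forall>A. cmod (\<mu> A) \<le> K"
proof -
  obtain K L where K: "\<forall>B\<in>sets borel. \<bar>Re (\<mu> B)\<bar> \<le> K" and L: "\<forall>B\<in>sets borel. \<bar>Im (\<mu> B)\<bar> \<le> L"
    using signed_measure_bounded[OF signed_measure_Re[OF \<mu>]]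
      signed_measure_bounded[OF signed_measure_Im[OF \<mu>]] by blast
  have "0 \<le> K" "0 \<le> L"
    using K[rule_format, of "{}"] L[rule_format, of "{}"] by auto
  moreover have "cmod (\<mu> A) \<le> K + L" for A
  proof (cases "A \<in> sets borel")
    case True
    then show ?thesis
      using cmod_le[of "\<mu> A"] K L by fastforce
  qed (use \<open>0 \<le> K\<close> \<open>0 \<le> L\<close> complex_measure_nonborel[OF \<mu>] in auto)
  ultimately show ?thesis
    by (intro exI[of _ "K + L"]) auto
qed

lemma complex_measure_add:
  "complex_measure \<mu> \<Longrightarrow> complex_measure \<nu> \<Longrightarrow> complex_measure (\<lambda>A. \<mu> A + \<nu> A)"
  unfolding complex_measure_def by (auto intro!: sums_add)

lemma complex_measure_cmult: "complex_measure \<mu> \<Longrightarrow> complex_measure (\<lambda>A. c * \<mu> A)"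
  unfolding complex_measure_def by (auto intro!: sums_mult)

lemma complex_measure_zero: "complex_measure (\<lambda>A. 0)"
  unfolding complex_measure_def by auto

lemma complex_measure_sum:
  "finite I \<Longrightarrow> (\<And>i. i \<in> I \<Longrightarrow> complex_measure (\<mu> i)) \<Longrightarrow> complex_measure (\<lambda>A. \<Sum>i\<in>I. \<mu> i A)"
  by (induction rule: finite_induct) (auto intro: complex_measure_zero complex_measure_add)

definition jordan_measures :: "('b::topological_space set \<Rightarrow> complex) \<Rightarrow> 'b measure set" where
  "jordan_measures \<mu> = {positive_part_measure (\<lambda>A. Re (\<mu> A)), positive_part_measure (\<lambda>A. - Re (\<mu> A)),
     positive_part_measure (\<lambda>A. Im (\<mu> A)), positive_part_measure (\<lambda>A. - Im (\<mu> A))}"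

text \<open>
  Integration against the sum of the four Jordan parts. That sum dominates the total variation
  measure and is at most twice as large, so it serves equally well for estimates.
\<close>

definition variation_integral :: "('b::topological_space set \<Rightarrow> complex) \<Rightarrow> ('b \<Rightarrow> real) \<Rightarrow> real" where
  "variation_integral \<mu> h =
     (LINT x|positive_part_measure (\<lambda>A. Re (\<mu> A)). h x) +
     (LINT x|positive_part_measure (\<lambda>A. - Re (\<mu> A)). h x) +
     (LINT x|positive_part_measure (\<lambda>A. Im (\<mu> A)). h x) +
     (LINT x|positive_part_measure (\<lambda>A. - Im (\<mu> A)). h x)"

lemma complex_measure_integrable_iff:
  "complex_measure_integrable \<mu> f \<longleftrightarrow> (\<forall>M\<in>jordan_measures \<mu>. integrable M f)"
  by (auto simp: complex_measure_integrable_def jordan_measures_def)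

lemma jordan_measures:
  assumes "complex_measure \<mu>" "M \<in> jordan_measures \<mu>"
  shows "finite_measure M" "sets M = sets borel" "space M = UNIV"
  using assms(2) signed_measure_Re[OF assms(1)] signed_measure_Im[OF assms(1)]
    signed_measure_uminus[OF signed_measure_Re[OF assms(1)]]
    signed_measure_uminus[OF signed_measure_Im[OF assms(1)]]
  by (auto simp: jordan_measures_def finite_positive_part_measure sets_positive_part_measure
      space_positive_part_measure)

lemma borel_measurable_jordan:
  assumes "complex_measure \<mu>" "M \<in> jordan_measures \<mu>"
  shows "f \<in> borel_measurable M \<longleftrightarrow> f \<in> borel_measurable borel"
  using measurable_cong_sets[OF jordan_measures(2)[OF assms] refl] by blast

lemma jordan_integrable_bounded:
  fixes f :: "'b::topological_space \<Rightarrow> 'c::{banach, second_countable_topology}"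
  assumes \<mu>: "complex_measure \<mu>" and M: "M \<in> jordan_measures \<mu>"
    and f: "f \<in> borel_measurable borel" "\<And>x. norm (f x) \<le> K"
  shows "integrable M f"
proof -
  interpret finite_measure M
    by (rule jordan_measures[OF \<mu> M])
  show ?thesis
    by (rule integrable_const_bound[of _ K]) (use f in \<open>auto simp: borel_measurable_jordan[OF \<mu> M]\<close>)
qed

lemma complex_measure_integrable_bounded:
  assumes "complex_measure \<mu>" "f \<in> borel_measurable borel" "\<And>x. norm (f x) \<le> K"
  shows "complex_measure_integrable \<mu> f"
  unfolding complex_measure_integrable_iff using jordan_integrable_bounded[OF assms(1)] assms(2,3) by blast

lemma complex_measure_integral_add:
  "complex_measure_integrable \<mu> f \<Longrightarrow> complex_measure_integrable \<mu> g \<Longrightarrow>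
    complex_measure_integral \<mu> (\<lambda>x. f x + g x) = complex_measure_integral \<mu> f + complex_measure_integral \<mu> g"
  by (simp add: complex_measure_integral_def complex_measure_integrable_def algebra_simps)

lemma complex_measure_integral_cmult:
  "complex_measure_integral \<mu> (\<lambda>x. c * f x) = c * complex_measure_integral \<mu> f"
  by (simp add: complex_measure_integral_def algebra_simps)

lemma complex_measure_integral_diff:
  "complex_measure_integrable \<mu> f \<Longrightarrow> complex_measure_integrable \<mu> g \<Longrightarrow>
    complex_measure_integral \<mu> (\<lambda>x. f x - g x) = complex_measure_integral \<mu> f - complex_measure_integral \<mu> g"
  by (simp add: complex_measure_integral_def complex_measure_integrable_def algebra_simps)

lemma complex_measure_integrable_add:
  "complex_measure_integrable \<mu> f \<Longrightarrow> complex_measure_integrable \<mu> g \<Longrightarrow>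
    complex_measure_integrable \<mu> (\<lambda>x. f x + g x)"
  by (simp add: complex_measure_integrable_def)

lemma complex_measure_integrable_cmult:
  "complex_measure_integrable \<mu> f \<Longrightarrow> complex_measure_integrable \<mu> (\<lambda>x. c * f x)"
  by (simp add: complex_measure_integrable_def)

lemma complex_measure_integrable_zero: "complex_measure_integrable \<mu> (\<lambda>x. 0)"
  by (simp add: complex_measure_integrable_def)

lemma complex_measure_integral_zero: "complex_measure_integral \<mu> (\<lambda>x. 0) = 0"
  by (simp add: complex_measure_integral_def)

lemma complex_measure_integral_sum:
  assumes "finite I" "\<And>i. i \<in> I \<Longrightarrow> complex_measure_integrable \<mu> (f i)"
  shows "complex_measure_integrable \<mu> (\<lambda>x. \<Sum>i\<in>I. f i x)"
    and "complex_measure_integral \<mu> (\<lambda>x. \<Sum>i\<in>I. f i x) = (\<Sum>i\<in>I. complex_measure_integral \<mu> (f i))"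
proof -
  have "complex_measure_integrable \<mu> (\<lambda>x. \<Sum>i\<in>I. f i x) \<and>
    complex_measure_integral \<mu> (\<lambda>x. \<Sum>i\<in>I. f i x) = (\<Sum>i\<in>I. complex_measure_integral \<mu> (f i))"
    using assms
    by (induction rule: finite_induct)
       (auto simp: complex_measure_integral_zero complex_measure_integrable_zero
         complex_measure_integral_add complex_measure_integrable_add)
  then show "complex_measure_integrable \<mu> (\<lambda>x. \<Sum>i\<in>I. f i x)"
    "complex_measure_integral \<mu> (\<lambda>x. \<Sum>i\<in>I. f i x) = (\<Sum>i\<in>I. complex_measure_integral \<mu> (f i))"
    by auto
qed

lemma norm_complex_measure_integral_le:
  "cmod (complex_measure_integral \<mu> f) \<le> variation_integral \<mu> (\<lambda>x. cmod (f x))"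
proof -
  have bound: "cmod (a - b + \<i> * (c - d)) \<le> A + B + C + D"
    if "cmod a \<le> A" "cmod b \<le> B" "cmod c \<le> C" "cmod d \<le> D" for a b c d A B C D
  proof -
    have "cmod (a - b + \<i> * (c - d)) \<le> cmod (a - b) + cmod (\<i> * (c - d))"
      by (rule norm_triangle_ineq)
    also have "\<dots> \<le> (cmod a + cmod b) + (cmod c + cmod d)"
      using norm_triangle_ineq4[of a b] norm_triangle_ineq4[of c d] by (simp add: norm_mult)
    finally show ?thesis
      using that by linarith
  qed
  show ?thesis
    unfolding complex_measure_integral_def variation_integral_def by (intro bound integral_norm_bound)
qed

lemma variation_integral_cmult: "variation_integral \<mu> (\<lambda>x. c * h x) = c * variation_integral \<mu> h"
  by (simp add: variation_integral_def algebra_simps)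

lemma variation_integral_mono:
  assumes "\<And>M. M \<in> jordan_measures \<mu> \<Longrightarrow> integrable M f" "\<And>M. M \<in> jordan_measures \<mu> \<Longrightarrow> integrable M g"
    and "\<And>x. f x \<le> g x"
  shows "variation_integral \<mu> f \<le> variation_integral \<mu> g"
  unfolding variation_integral_def
  by (intro add_mono integral_mono assms) (auto simp: jordan_measures_def)

lemma variation_integral_sum:
  assumes "finite I" "\<And>i M. i \<in> I \<Longrightarrow> M \<in> jordan_measures \<mu> \<Longrightarrow> integrable M (f i)"
  shows "variation_integral \<mu> (\<lambda>x. \<Sum>i\<in>I. f i x) = (\<Sum>i\<in>I. variation_integral \<mu> (f i))"
  unfolding variation_integral_def sum.distrib
  by (intro arg_cong2[where f = "(+)"] Bochner_Integration.integral_sum assms) (auto simp: jordan_measures_def)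

lemma jordan_dominated_convergence:
  fixes f :: "nat \<Rightarrow> 'b::topological_space \<Rightarrow> 'c::{banach, second_countable_topology}"
  assumes \<mu>: "complex_measure \<mu>" and f: "\<And>n. f n \<in> borel_measurable borel" "f' \<in> borel_measurable borel"
    and K: "\<And>n x. norm (f n x) \<le> K" and lim: "\<And>x. (\<lambda>n. f n x) \<longlonglongrightarrow> f' x"
    and M: "M \<in> jordan_measures \<mu>"
  shows "(\<lambda>n. integral\<^sup>L M (f n)) \<longlonglongrightarrow> integral\<^sup>L M f'"
proof (rule integral_dominated_convergence[where w = "\<lambda>_. K"])
  show "integrable M (\<lambda>_. K)"
    by (rule jordan_integrable_bounded[OF \<mu> M]) auto
qed (use f K lim in \<open>auto simp: borel_measurable_jordan[OF \<mu> M]\<close>)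

lemma variation_integral_dominated_convergence:
  assumes "complex_measure \<mu>" "\<And>n. f n \<in> borel_measurable borel" "f' \<in> borel_measurable borel"
    and "\<And>n x. norm (f n x) \<le> K" "\<And>x. (\<lambda>n. f n x) \<longlonglongrightarrow> f' x"
  shows "(\<lambda>n. variation_integral \<mu> (f n)) \<longlonglongrightarrow> variation_integral \<mu> f'"
  unfolding variation_integral_def
  by (intro tendsto_add jordan_dominated_convergence[OF assms]) (auto simp: jordan_measures_def)

lemma complex_measure_integral_dominated_convergence:
  assumes "complex_measure \<mu>" "\<And>n. f n \<in> borel_measurable borel" "f' \<in> borel_measurable borel"
    and "\<And>n x. norm (f n x) \<le> K" "\<And>x. (\<lambda>n. f n x) \<longlonglongrightarrow> f' x"
  shows "(\<lambda>n. complex_measure_integral \<mu> (f n)) \<longlonglongrightarrow> complex_measure_integral \<mu> f'"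
  unfolding complex_measure_integral_def
  by (intro tendsto_add tendsto_diff tendsto_mult tendsto_const jordan_dominated_convergence[OF assms])
     (auto simp: jordan_measures_def)

lemma complex_measure_integral_indicator:
  assumes \<mu>: "complex_measure \<mu>" and A: "A \<in> sets borel"
  shows "complex_measure_integral \<mu> (indicator A) = \<mu> A"
proof -
  have ind: "(LINT x|M. indicator A x) = complex_of_real (measure M A)" if M: "M \<in> jordan_measures \<mu>" for M
  proof -
    have "(LINT x|M. indicator A x) = (LINT x|M. complex_of_real (indicator A x))"
      by (intro Bochner_Integration.integral_cong) (auto simp: indicator_def)
    also have "\<dots> = complex_of_real (LINT x|M. indicator A x)"
      by (rule integral_complex_of_real)
    also have "(LINT x|M. indicator A x) = measure M A"
      by (simp add: jordan_measures(3)[OF \<mu> M])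
    finally show ?thesis .
  qed
  have "complex_measure_integral \<mu> (indicator A) = Complex (Re (\<mu> A)) (Im (\<mu> A))"
    unfolding complex_measure_integral_def
      jordan_decomposition[OF signed_measure_Re[OF \<mu>] A] jordan_decomposition[OF signed_measure_Im[OF \<mu>] A]
    by (simp add: ind jordan_measures_def complex_eq_iff)
  then show ?thesis
    by simp
qed

lemma complex_measure_dirac: "complex_measure (dirac_measure z)"
  unfolding complex_measure_def
proof (intro conjI allI impI)
  fix A :: "nat \<Rightarrow> 'a set"
  assume "range A \<subseteq> sets borel \<and> disjoint_family A"
  then have A: "\<And>n. A n \<in> sets borel" "disjoint_family A"
    by auto
  have "(\<lambda>n. indicator (A n) z :: complex) sums indicator (\<Union>n. A n) z"
  proof (cases "z \<in> (\<Union>n. A n)")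
    case True
    then obtain m where m: "z \<in> A m"
      by blast
    have "indicator (A n) z = (if n = m then 1 else 0 :: complex)" for n
      using A(2) m by (auto simp: disjoint_family_on_def indicator_def)
    then show ?thesis
      using True sums_single[of m "\<lambda>_. 1 :: complex"] by simp
  qed (auto simp: indicator_def)
  moreover have "(\<Union>n. A n) \<in> sets borel"
    using A(1) by blast
  ultimately show "(\<lambda>n. dirac_measure z (A n)) sums dirac_measure z (\<Union>n. A n)"
    using A(1) by (simp add: dirac_measure_def)
qed (simp add: dirac_measure_def)

text \<open>
  All Jordan parts of the point measure vanish on the complement of \<open>z\<close>, so \<open>h\<close> may be replaced
  by the constant \<open>h z\<close>.
\<close>

lemma complex_measure_integral_dirac:
  fixes z :: "'b::t1_space"
  assumes h: "h \<in> borel_measurable borel"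
  shows "complex_measure_integral (dirac_measure z) h = h z"
proof -
  let ?\<delta> = "dirac_measure z"
  have \<delta>: "complex_measure ?\<delta>"
    by (rule complex_measure_dirac)
  have pos: "emeasure (positive_part_measure \<nu>) (- {z}) = 0"
    if "signed_measure \<nu>" "\<And>B. z \<notin> B \<Longrightarrow> \<nu> B = 0" for \<nu>
  proof -
    have "positive_part \<nu> (- {z}) = 0"
      using that(2) by (intro antisym positive_part_le[OF that(1)] positive_part_nonneg[OF that(1)]) (auto simp: subset_Compl_singleton)
    then show ?thesis
      by (simp add: emeasure_positive_part_measure[OF that(1)])
  qed
  have null: "emeasure M (- {z}) = 0" if "M \<in> jordan_measures ?\<delta>" for M
    using that signed_measure_Re[OF \<delta>] signed_measure_Im[OF \<delta>]
      signed_measure_uminus[OF signed_measure_Re[OF \<delta>]] signed_measure_uminus[OF signed_measure_Im[OF \<delta>]]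
    by (auto simp: jordan_measures_def dirac_measure_def intro!: pos)
  have int: "(LINT x|M. h x) = (LINT x|M. h z * indicator UNIV x)" if M: "M \<in> jordan_measures ?\<delta>" for M
  proof (rule integral_cong_AE)
    show "AE x in M. h x = h z * indicator UNIV x"
      by (rule AE_I[of _ _ "- {z}"]) (use null[OF M] jordan_measures[OF \<delta> M] in auto)
  qed (use h in \<open>auto simp: borel_measurable_jordan[OF \<delta> M]\<close>)
  have "complex_measure_integral ?\<delta> h = complex_measure_integral ?\<delta> (\<lambda>x. h z * indicator UNIV x)"
    unfolding complex_measure_integral_def
    by (intro arg_cong2[where f = "(+)"] arg_cong2[where f = "(-)"] arg_cong2[where f = "(*)"] refl int)
       (simp_all add: jordan_measures_def)
  also have "\<dots> = h z * ?\<delta> UNIV"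
    unfolding complex_measure_integral_cmult
    by (subst complex_measure_integral_indicator[OF \<delta>]) simp_all
  also have "\<dots> = h z"
    by (simp add: dirac_measure_def)
  finally show ?thesis .
qed

section \<open>Convolution of measures\<close>

lemma disjoint_family_vimage: "disjoint_family A \<Longrightarrow> disjoint_family (\<lambda>n. f -` A n)"
  unfolding disjoint_family_on_def by blast

lemma translate_borel: "A \<in> sets borel \<Longrightarrow> (+) x -` A \<in> sets borel" for A :: "'b::euclidean_space set"
  using measurable_sets[of "(+) x" borel borel A] by simp

lemma borel_measurable_translate_measure:
  fixes \<nu> :: "'b::euclidean_space set \<Rightarrow> complex"
  assumes \<nu>: "complex_measure \<nu>" and A: "A \<in> sets borel"
  shows "(\<lambda>x. \<nu> ((+) x -` A)) \<in> borel_measurable borel"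
proof -
  have meas: "(\<lambda>x. LINT y|M. indicator A (x + y) :: complex) \<in> borel_measurable borel"
    if M: "M \<in> jordan_measures \<nu>" for M
  proof -
    interpret finite_measure M
      by (rule jordan_measures[OF \<nu> M])
    have [measurable_cong]: "sets M = sets borel"
      by (rule jordan_measures[OF \<nu> M])
    note A[measurable]
    show ?thesis
      by measurable
  qed
  have "\<nu> ((+) x -` A) = complex_measure_integral \<nu> (\<lambda>y. indicator A (x + y))" for x
  proof -
    have "(\<lambda>y. indicator A (x + y) :: complex) = indicator ((+) x -` A)"
      by (auto simp: indicator_def)
    then show ?thesis
      using complex_measure_integral_indicator[OF \<nu> translate_borel[OF A]] by simp
  qed
  then show ?thesis
    unfolding complex_measure_integral_def
    by (simp only:) (intro borel_measurable_add borel_measurable_diff borel_measurable_times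
        borel_measurable_const meas; simp add: jordan_measures_def)
qed

text \<open>
  Since the integral of an indicator function is the measure of the set, the inner integral in the
  definition of the convolution is \<open>\<nu> (A - x)\<close>; here \<open>A - x\<close> is the preimage of \<open>A\<close> under
  \<open>y \<mapsto> x + y\<close>.
\<close>

lemma measure_convolution_eq:
  fixes \<nu> :: "'b::euclidean_space set \<Rightarrow> complex"
  assumes \<nu>: "complex_measure \<nu>" and A: "A \<in> sets borel"
  shows "measure_convolution \<mu> \<nu> A = complex_measure_integral \<mu> (\<lambda>x. \<nu> ((+) x -` A))"
proof -
  have "(\<lambda>y. indicator A (x + y) :: complex) = indicator ((+) x -` A)" for x
    by (auto simp: indicator_def)
  then show ?thesis
    using A by (simp add: measure_convolution_def complex_measure_integral_indicator[OF \<nu> translate_borel[OF A]])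
qed

lemma measure_convolution_dirac:
  assumes \<nu>: "complex_measure \<nu>" and A: "A \<in> sets borel"
  shows "measure_convolution (dirac_measure z) \<nu> A = \<nu> ((+) z -` A)"
  using measure_convolution_eq[OF \<nu> A] complex_measure_integral_dirac[OF borel_measurable_translate_measure[OF \<nu> A]]
  by simp

lemma complex_measure_convolution:
  assumes \<mu>: "complex_measure \<mu>" and \<nu>: "complex_measure \<nu>"
  shows "complex_measure (measure_convolution \<mu> \<nu>)"
  unfolding complex_measure_def
proof (intro conjI allI impI)
  fix A :: "nat \<Rightarrow> 'a set"
  assume "range A \<subseteq> sets borel \<and> disjoint_family A"
  then have A: "\<And>n. A n \<in> sets borel" "disjoint_family A"
    by auto
  obtain K where K: "\<And>B. cmod (\<nu> B) \<le> K"
    using complex_measure_bounded[OF \<nu>] by blast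
  let ?U = "\<lambda>N. \<Union>n<N. A n"
  have U: "?U N \<in> sets borel" "(\<Union>n. A n) \<in> sets borel" for N
    using A(1) by auto
  have sums: "(\<lambda>n. \<nu> ((+) x -` A n)) sums \<nu> ((+) x -` (\<Union>n. A n))" for x
    unfolding vimage_UN
    by (intro complex_measure_sums[OF \<nu>] translate_borel A disjoint_family_vimage)
  have partial: "(\<Sum>n<N. \<nu> ((+) x -` A n)) = \<nu> ((+) x -` ?U N)" for x N
  proof -
    let ?B = "\<lambda>n. if n < N then (+) x -` A n else {}"
    have "(\<lambda>n. \<nu> (?B n)) sums \<nu> (\<Union>n. ?B n)"
      by (intro complex_measure_sums[OF \<nu>] disjoint_family_subset[OF disjoint_family_vimage[OF A(2), of "(+) x"]])
         (auto intro: translate_borel A)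
    moreover have "(\<lambda>n. \<nu> (?B n)) sums (\<Sum>n<N. \<nu> (?B n))"
      by (rule sums_finite) (auto simp: complex_measure_empty[OF \<nu>])
    moreover have "(\<Union>n. ?B n) = (+) x -` ?U N"
      by (auto split: if_splits)
    ultimately show ?thesis
      by (simp add: sums_unique2)
  qed
  have "(\<Sum>n<N. measure_convolution \<mu> \<nu> (A n)) = complex_measure_integral \<mu> (\<lambda>x. \<nu> ((+) x -` ?U N))" for N
  proof -
    have "complex_measure_integrable \<mu> (\<lambda>x. \<nu> ((+) x -` A n))" for n
      by (rule complex_measure_integrable_bounded[OF \<mu> borel_measurable_translate_measure[OF \<nu> A(1)] K])
    then show ?thesis
      by (simp add: measure_convolution_eq[OF \<nu> A(1)] partial flip: complex_measure_integral_sum(2))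
  qed
  moreover have "(\<lambda>N. complex_measure_integral \<mu> (\<lambda>x. \<nu> ((+) x -` ?U N))) \<longlonglongrightarrow>
      complex_measure_integral \<mu> (\<lambda>x. \<nu> ((+) x -` (\<Union>n. A n)))"
    by (rule complex_measure_integral_dominated_convergence[OF \<mu> borel_measurable_translate_measure[OF \<nu> U(1)]
          borel_measurable_translate_measure[OF \<nu> U(2)] K])
       (use sums in \<open>simp add: sums_def partial\<close>)
  ultimately show "(\<lambda>n. measure_convolution \<mu> \<nu> (A n)) sums measure_convolution \<mu> \<nu> (\<Union>n. A n)"
    by (simp add: sums_def measure_convolution_eq[OF \<nu> U(2)])
qed (simp add: measure_convolution_def)

lemma complex_measure_L1:
  fixes g :: "'b::euclidean_space \<Rightarrow> complex"
  assumes g: "integrable lborel g"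
  shows "complex_measure (L1_measure g)"
  unfolding complex_measure_def
proof (intro conjI allI impI)
  fix A :: "nat \<Rightarrow> 'b set"
  assume "range A \<subseteq> sets borel \<and> disjoint_family A"
  then have A[measurable]: "\<And>n. A n \<in> sets borel" and disj: "disjoint_family A"
    by auto
  have [measurable]: "g \<in> borel_measurable borel"
    using g by auto
  have int: "integrable lborel (\<lambda>x. indicator B x *\<^sub>R g x)" if "B \<in> sets borel" for B
    using integrable_mult_indicator[OF _ g, of B] that by simp
  have "(\<lambda>N. LINT x|lborel. indicator (\<Union>n<N. A n) x *\<^sub>R g x) \<longlonglongrightarrow>
      (LINT x|lborel. indicator (\<Union>n. A n) x *\<^sub>R g x)"
  proof (rule integral_dominated_convergence[where w = "\<lambda>x. norm (g x)"])
    show "AE x in lborel. (\<lambda>N. indicator (\<Union>n<N. A n) x *\<^sub>R g x) \<longlonglongrightarrow> indicator (\<Union>n. A n) x *\<^sub>R g x"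
      by (intro AE_I2 tendsto_intros LIMSEQ_indicator_UN)
    show "AE x in lborel. norm (indicator (\<Union>n<N. A n) x *\<^sub>R g x) \<le> norm (g x)" for N
      by (auto simp: indicator_def)
  qed (use g in auto)
  moreover have "(LINT x|lborel. indicator (\<Union>n<N. A n) x *\<^sub>R g x) = (\<Sum>n<N. L1_measure g (A n))" for N
  proof -
    have "indicator (\<Union>n<N. A n) x = (\<Sum>n<N. indicator (A n) x :: real)" for x
      by (rule indicator_UN_disjoint) (use disj in \<open>auto intro: disjoint_family_on_mono\<close>)
    then have "(LINT x|lborel. indicator (\<Union>n<N. A n) x *\<^sub>R g x) =
        (LINT x|lborel. (\<Sum>n<N. indicator (A n) x *\<^sub>R g x))"
      by (simp only: scaleR_sum_left)
    also have "\<dots> = (\<Sum>n<N. (LINT x|lborel. indicator (A n) x *\<^sub>R g x))"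
      by (intro Bochner_Integration.integral_sum int A)
    finally show ?thesis
      using A by (simp add: L1_measure_def set_lebesgue_integral_def)
  qed
  ultimately show "(\<lambda>n. L1_measure g (A n)) sums L1_measure g (\<Union>n. A n)"
    by (simp add: sums_def L1_measure_def set_lebesgue_integral_def)
qed (simp add: L1_measure_def)

section \<open>Continuity of translation in the space of integrable functions\<close>

lemma integral_lborel_translate:
  fixes f :: "'b::euclidean_space \<Rightarrow> 'c::{banach, second_countable_topology}"
  assumes [measurable]: "f \<in> borel_measurable borel"
  shows "(LINT y|lborel. f (y - h)) = (LINT y|lborel. f y)"
proof -
  have "(LINT y|lborel. f y) = (LINT y|distr lborel borel ((+) (- h)). f y)"
    by (simp add: lborel_distr_plus)
  also have "\<dots> = (LINT y|lborel. f (y - h))"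
    by (subst integral_distr) (auto simp: algebra_simps)
  finally show ?thesis ..
qed

lemma integrable_lborel_translate:
  fixes f :: "'b::euclidean_space \<Rightarrow> 'c::{banach, second_countable_topology}"
  assumes f: "integrable lborel f"
  shows "integrable lborel (\<lambda>y. f (y - h))"
proof -
  have [measurable]: "f \<in> borel_measurable borel"
    using f by auto
  have "integrable (distr lborel borel ((+) (- h))) f"
    using f by (simp add: lborel_distr_plus)
  then show ?thesis
    by (subst (asm) integrable_distr_eq) (auto simp: algebra_simps)
qed

definition translation_distance :: "('b::euclidean_space \<Rightarrow> complex) \<Rightarrow> 'b \<Rightarrow> 'b \<Rightarrow> real" where
  "translation_distance g x w = (LINT y|lborel. cmod (g (y - x) - g (y - w)))"

lemma integrable_translation_difference:
  "integrable lborel g \<Longrightarrow> integrable lborel (\<lambda>y. cmod (g (y - x) - g (y - w)))"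
  by (intro integrable_norm Bochner_Integration.integrable_diff integrable_lborel_translate)

lemma translation_distance_nonneg: "0 \<le> translation_distance g x w"
  unfolding translation_distance_def by (rule Bochner_Integration.integral_nonneg) simp

lemma translation_distance_le:
  assumes g: "integrable lborel g"
  shows "translation_distance g x w \<le> 2 * (LINT y|lborel. cmod (g y))"
proof -
  have [measurable]: "g \<in> borel_measurable borel"
    using g by auto
  have int: "integrable lborel (\<lambda>y. cmod (g (y - x)))" for x
    by (intro integrable_norm integrable_lborel_translate g)
  have "translation_distance g x w \<le> (LINT y|lborel. cmod (g (y - x)) + cmod (g (y - w)))"
    unfolding translation_distance_def
    by (intro integral_mono integrable_translation_difference[OF g] Bochner_Integration.integrable_add int
        norm_triangle_ineq4)
  also have "\<dots> = 2 * (LINT y|lborel. cmod (g y))"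
    by (simp add: int integral_lborel_translate[of "\<lambda>y. cmod (g y)"])
  finally show ?thesis .
qed

lemma norm_translation_distance_le:
  "integrable lborel g \<Longrightarrow> norm (translation_distance g x w) \<le> 2 * (LINT y|lborel. cmod (g y))"
  using translation_distance_le[of g x w] translation_distance_nonneg[of g x w] by simp

lemma translation_distance_shift:
  assumes g: "integrable lborel g"
  shows "translation_distance g x w = translation_distance g 0 (w - x)"
proof -
  have [measurable]: "g \<in> borel_measurable borel"
    using g by auto
  show ?thesis
    using integral_lborel_translate[of "\<lambda>u. cmod (g u - g (u - (w - x)))" x]
    by (simp add: translation_distance_def algebra_simps)
qed

lemma translation_distance_add_le:
  assumes f: "integrable lborel f" and g: "integrable lborel g"
  shows "translation_distance (\<lambda>y. f y + g y) x w \<le> translation_distance f x w + translation_distance g x w"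
proof -
  have "translation_distance (\<lambda>y. f y + g y) x w \<le>
      (LINT y|lborel. cmod (f (y - x) - f (y - w)) + cmod (g (y - x) - g (y - w)))"
    unfolding translation_distance_def
  proof (intro integral_mono integrable_translation_difference Bochner_Integration.integrable_add f g)
    fix y
    have "cmod ((f (y - x) - f (y - w)) + (g (y - x) - g (y - w))) \<le>
        cmod (f (y - x) - f (y - w)) + cmod (g (y - x) - g (y - w))"
      by (rule norm_triangle_ineq)
    then show "cmod (f (y - x) + g (y - x) - (f (y - w) + g (y - w))) \<le>
        cmod (f (y - x) - f (y - w)) + cmod (g (y - x) - g (y - w))"
      by (simp add: algebra_simps)
  qed
  then show ?thesis
    by (simp add: translation_distance_def integrable_translation_difference f g)
qed

definition translation_continuous :: "('b::euclidean_space \<Rightarrow> complex) \<Rightarrow> bool" where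
  "translation_continuous g \<longleftrightarrow> (\<forall>h. h \<longlonglongrightarrow> 0 \<longrightarrow> (\<lambda>n. translation_distance g 0 (h n)) \<longlonglongrightarrow> 0)"

lemma translation_continuous_approx:
  assumes f: "integrable lborel f"
    and approx: "\<And>e. 0 < e \<Longrightarrow> \<exists>s. integrable lborel s \<and> translation_continuous s \<and>
      (LINT y|lborel. cmod (f y - s y)) \<le> e"
  shows "translation_continuous f"
  unfolding translation_continuous_def
proof (intro allI impI)
  fix h :: "nat \<Rightarrow> 'a" assume h: "h \<longlonglongrightarrow> 0"
  show "(\<lambda>n. translation_distance f 0 (h n)) \<longlonglongrightarrow> 0"
  proof (rule LIMSEQ_I)
    fix r :: real assume r: "0 < r"
    then obtain s where s: "integrable lborel s" "translation_continuous s"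
        "(LINT y|lborel. cmod (f y - s y)) \<le> r / 4"
      using approx[of "r / 4"] by auto
    have "(\<lambda>n. translation_distance s 0 (h n)) \<longlonglongrightarrow> 0"
      using s(2) h by (simp add: translation_continuous_def)
    then obtain N where N: "\<And>n. n \<ge> N \<Longrightarrow> translation_distance s 0 (h n) < r / 2"
      using LIMSEQ_D[of _ 0 "r / 2"] r translation_distance_nonneg by fastforce
    have "norm (translation_distance f 0 (h n) - 0) < r" if "n \<ge> N" for n
    proof -
      have fs: "integrable lborel (\<lambda>y. f y - s y)"
        by (intro Bochner_Integration.integrable_diff f s)
      have "translation_distance f 0 (h n) \<le>
          translation_distance (\<lambda>y. f y - s y) 0 (h n) + translation_distance s 0 (h n)"
        using translation_distance_add_le[OF fs s(1), of 0 "h n"] by simp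
      also have "translation_distance (\<lambda>y. f y - s y) 0 (h n) \<le> r / 2"
        using translation_distance_le[OF fs, of 0 "h n"] s(3) by simp
      finally show ?thesis
        using N[OF that] translation_distance_nonneg[of f 0 "h n"] by simp
    qed
    then show "\<exists>no. \<forall>n\<ge>no. norm (translation_distance f 0 (h n) - 0) < r"
      by blast
  qed
qed

text \<open>
  For an open set \<open>U\<close> and \<open>y \<in> U\<close> the points \<open>y - h\<^sub>n\<close> eventually lie in \<open>U\<close>, so
  \<open>1\<^sub>U (y) 1\<^sub>U (y - h\<^sub>n)\<close> tends to \<open>1\<^sub>U (y)\<close> everywhere. The \<open>L\<^sup>1\<close> distance is
  \<open>2 |U| - 2 \<integral> 1\<^sub>U (y) 1\<^sub>U (y - h\<^sub>n) dy\<close>, and dominated convergence applies.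
\<close>

lemma translation_continuous_open:
  fixes U :: "'b::euclidean_space set"
  assumes U: "open U" "emeasure lborel U < \<infinity>"
  shows "translation_continuous (\<lambda>y. indicator U y *\<^sub>R c)"
  unfolding translation_continuous_def
proof (intro allI impI)
  fix h :: "nat \<Rightarrow> 'b" assume h: "h \<longlonglongrightarrow> 0"
  have [measurable]: "U \<in> sets borel"
    using U(1) by simp
  let ?u = "indicator U :: 'b \<Rightarrow> real"
  have u: "integrable lborel ?u"
    using U(2) by (simp add: integrable_indicator_iff)
  have uh: "integrable lborel (\<lambda>y. ?u (y - h n))" for n
    by (rule integrable_lborel_translate[OF u])
  have uu: "integrable lborel (\<lambda>y. ?u y * ?u (y - h n))" for n
    by (rule Bochner_Integration.integrable_bound[OF u]) (auto simp: indicator_def)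
  have dist: "translation_distance (\<lambda>y. indicator U y *\<^sub>R c) 0 (h n) =
      cmod c * (2 * measure lborel U - 2 * (LINT y|lborel. ?u y * ?u (y - h n)))" for n
  proof -
    have "cmod (indicator U (y - 0) *\<^sub>R c - indicator U (y - h n) *\<^sub>R c) =
        cmod c * (?u y + ?u (y - h n) - 2 * (?u y * ?u (y - h n)))" for y
      by (auto simp: indicator_def)
    then have "translation_distance (\<lambda>y. indicator U y *\<^sub>R c) 0 (h n) =
        cmod c * ((LINT y|lborel. ?u y) + (LINT y|lborel. ?u (y - h n)) - 2 * (LINT y|lborel. ?u y * ?u (y - h n)))"
      unfolding translation_distance_def using u uh uu by simp
    moreover have "(LINT y|lborel. ?u (y - h n)) = (LINT y|lborel. ?u y)"
      by (rule integral_lborel_translate) measurable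
    ultimately show ?thesis
      by simp
  qed
  have "(\<lambda>n. LINT y|lborel. ?u y * ?u (y - h n)) \<longlonglongrightarrow> (LINT y|lborel. ?u y)"
  proof (rule integral_dominated_convergence[OF _ _ u])
    have "(\<lambda>n. ?u y * ?u (y - h n)) \<longlonglongrightarrow> ?u y" for y
    proof (cases "y \<in> U")
      case True
      have "(\<lambda>n. y - h n) \<longlonglongrightarrow> y - 0"
        by (intro tendsto_intros h)
      then have "\<forall>\<^sub>F n in sequentially. y - h n \<in> U"
        using U(1) True by (simp add: topological_tendstoD)
      then have "\<forall>\<^sub>F n in sequentially. ?u y * ?u (y - h n) = ?u y"
        by (rule eventually_mono) (simp add: True)
      then show ?thesis
        by (rule tendsto_eventually)
    qed simp
    then show "AE y in lborel. (\<lambda>n. ?u y * ?u (y - h n)) \<longlonglongrightarrow> ?u y"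
      by simp
    show "AE y in lborel. norm (?u y * ?u (y - h n)) \<le> ?u y" for n
      by (auto simp: indicator_def)
  qed measurable
  then have "(\<lambda>n. cmod c * (2 * measure lborel U - 2 * (LINT y|lborel. ?u y * ?u (y - h n)))) \<longlonglongrightarrow>
      cmod c * (2 * measure lborel U - 2 * (LINT y|lborel. ?u y))"
    by (intro tendsto_intros)
  then show "(\<lambda>n. translation_distance (\<lambda>y. indicator U y *\<^sub>R c) 0 (h n)) \<longlonglongrightarrow> 0"
    unfolding dist by simp
qed

text \<open>
  Continuity of translation in \<open>L\<^sup>1\<close> is stable under \<open>L\<^sup>1\<close> limits. Outer regularity
  approximates measurable sets of finite measure by open sets, and simple functions are dense.
\<close>

lemma translation_continuous_integrable:
  fixes g :: "'b::euclidean_space \<Rightarrow> complex"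
  assumes "integrable lborel g"
  shows "translation_continuous g"
  using assms
proof (induct rule: integrable_induct)
  case (base A c)
  then have [measurable]: "A \<in> sets borel" and fin: "emeasure lborel A < \<infinity>"
    by auto
  show ?case
  proof (rule translation_continuous_approx)
    show "integrable lborel (\<lambda>y. indicator A y *\<^sub>R c)"
      using fin by (intro integrable_scaleR_left) (simp add: integrable_indicator_iff)
    fix e :: real assume e: "0 < e"
    define d where "d = e / (cmod c + 1)"
    have d: "0 < d" "cmod c * d \<le> e"
    proof -
      have "0 < cmod c + 1"
        by (simp add: add_nonneg_pos)
      then show "0 < d" "cmod c * d \<le> e"
        using e by (simp_all add: d_def pos_divide_le_eq algebra_simps)
    qed
    obtain U where U: "open U" "A \<subseteq> U" "emeasure lborel (U - A) < ennreal d"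
      using outer_regular_lborel[of A d] d(1) by auto
    have [measurable]: "U \<in> sets borel"
      using U(1) by simp
    have UA_fin: "emeasure lborel (U - A) < \<infinity>"
      using U(3) by (rule less_trans) simp
    have "emeasure lborel U \<le> emeasure lborel A + emeasure lborel (U - A)"
    proof -
      have "U = A \<union> (U - A)"
        using U(2) by auto
      then show ?thesis
        using emeasure_subadditive[of A lborel "U - A"] by simp
    qed
    also have "\<dots> < \<infinity>"
      using fin UA_fin by (simp add: ennreal_add_less_top)
    finally have U_fin: "emeasure lborel U < \<infinity>" .
    have UA_int: "integrable lborel (indicator (U - A) :: 'b \<Rightarrow> real)"
      using UA_fin by (simp add: integrable_indicator_iff)
    have "cmod (indicator A y *\<^sub>R c - indicator U y *\<^sub>R c) = cmod c * indicator (U - A) y" for y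
      using U(2) by (auto simp: indicator_def)
    then have "(LINT y|lborel. cmod (indicator A y *\<^sub>R c - indicator U y *\<^sub>R c)) = cmod c * measure lborel (U - A)"
      by simp
    also have "\<dots> \<le> cmod c * d"
    proof (rule mult_left_mono)
      have "ennreal (measure lborel (U - A)) < ennreal d"
        using U(3) UA_fin by (simp add: emeasure_eq_ennreal_measure)
      then show "measure lborel (U - A) \<le> d"
        using d(1) by (simp add: ennreal_less_iff)
    qed simp
    also have "\<dots> \<le> e"
      by (rule d)
    finally have "(LINT y|lborel. cmod (indicator A y *\<^sub>R c - indicator U y *\<^sub>R c)) \<le> e" .
    moreover have "integrable lborel (\<lambda>y. indicator U y *\<^sub>R c)"
      using U_fin by (intro integrable_scaleR_left) (simp add: integrable_indicator_iff)
    ultimately show "\<exists>s. integrable lborel s \<and> translation_continuous s \<and>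
        (LINT y|lborel. cmod (indicator A y *\<^sub>R c - s y)) \<le> e"
      using translation_continuous_open[OF U(1) U_fin] by blast
  qed
next
  case (add f g)
  show ?case
    unfolding translation_continuous_def
  proof (intro allI impI)
    fix h :: "nat \<Rightarrow> 'b" assume "h \<longlonglongrightarrow> 0"
    then have "(\<lambda>n. translation_distance f 0 (h n) + translation_distance g 0 (h n)) \<longlonglongrightarrow> 0 + 0"
      using add by (intro tendsto_add) (auto simp: translation_continuous_def)
    then have "(\<lambda>n. translation_distance f 0 (h n) + translation_distance g 0 (h n)) \<longlonglongrightarrow> 0"
      by simp
    then show "(\<lambda>n. translation_distance (\<lambda>x. f x + g x) 0 (h n)) \<longlonglongrightarrow> 0"
    proof (rule Lim_null_comparison[rotated], intro always_eventually allI)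
      show "norm (translation_distance (\<lambda>x. f x + g x) 0 (h n)) \<le>
          translation_distance f 0 (h n) + translation_distance g 0 (h n)" for n
        using translation_distance_add_le[OF add(1,3), of 0 "h n"]
          translation_distance_nonneg[of "\<lambda>x. f x + g x" 0 "h n"] by simp
    qed
  qed
next
  case (lim f s)
  show ?case
  proof (rule translation_continuous_approx[OF lim(5)])
    fix e :: real assume e: "0 < e"
    have [measurable]: "f \<in> borel_measurable borel" "s i \<in> borel_measurable borel" for i
      using lim(1,5) by auto
    have "(\<lambda>i. LINT y|lborel. cmod (f y - s i y)) \<longlonglongrightarrow> integral\<^sup>L lborel (\<lambda>y :: 'b. 0 :: real)"
    proof (rule integral_dominated_convergence[where w = "\<lambda>y. 3 * cmod (f y)"])
      show "AE y in lborel. (\<lambda>i. cmod (f y - s i y)) \<longlonglongrightarrow> 0"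
      proof (rule AE_I2)
        fix y :: 'b
        have "(\<lambda>i. f y - s i y) \<longlonglongrightarrow> f y - f y"
          using lim(3) by (intro tendsto_intros) auto
        then show "(\<lambda>i. cmod (f y - s i y)) \<longlonglongrightarrow> 0"
          by (intro tendsto_norm_zero) simp
      qed
      show "AE y in lborel. norm (cmod (f y - s i y)) \<le> 3 * cmod (f y)" for i
      proof (rule AE_I2)
        fix y :: 'b
        show "norm (cmod (f y - s i y)) \<le> 3 * cmod (f y)"
          using norm_triangle_ineq4[of "f y" "s i y"] lim(4)[of y i] by simp
      qed
    qed (use lim(5) in auto)
    then obtain i where "\<bar>LINT y|lborel. cmod (f y - s i y)\<bar> < e"
      using LIMSEQ_D[of _ _ e] e by fastforce
    then show "\<exists>s. integrable lborel s \<and> translation_continuous s \<and> (LINT y|lborel. cmod (f y - s y)) \<le> e"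
      using lim(1,2) by (intro exI[of _ "s i"]) auto
  qed
qed

lemma translation_distance_tendsto:
  assumes g: "integrable lborel g" and w: "w \<longlonglongrightarrow> x"
  shows "(\<lambda>n. translation_distance g x (w n)) \<longlonglongrightarrow> 0"
proof -
  have "(\<lambda>n. w n - x) \<longlonglongrightarrow> 0"
    using w by (simp add: LIM_zero)
  then show ?thesis
    using translation_continuous_integrable[OF g]
    by (simp add: translation_continuous_def translation_distance_shift[OF g, of x])
qed

section \<open>Discretisation of a convolution in total variation\<close>

lemma L1_measure_translate:
  assumes g: "integrable lborel g" and A: "A \<in> sets borel"
  shows "L1_measure g ((+) x -` A) = (LINT y|lborel. indicator A y *\<^sub>R g (y - x))"
proof -
  have [measurable]: "g \<in> borel_measurable borel" "A \<in> sets borel"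
    using g A by auto
  have "L1_measure g ((+) x -` A) = (LINT y|lborel. indicator A (x + y) *\<^sub>R g y)"
    using translate_borel[OF A]
    by (simp add: L1_measure_def set_lebesgue_integral_def indicator_def vimage_def)
  also have "\<dots> = (LINT y|lborel. indicator A (x + (y - x)) *\<^sub>R g (y - x))"
    by (rule integral_lborel_translate[symmetric]) measurable
  finally show ?thesis
    by simp
qed

lemma sum_indicator_partition_le:
  assumes P: "finite P" "partition_on UNIV P"
  shows "(\<Sum>A\<in>P. indicator A y) \<le> (1 :: real)"
proof -
  have "disjoint_family_on (\<lambda>A. A) P"
    using P(2) by (auto simp: partition_on_def disjoint_def disjoint_family_on_def)
  then have "(\<Sum>A\<in>P. indicator A y) = (indicator (\<Union>A\<in>P. A) y :: real)"
    by (rule indicator_UN_disjoint[OF P(1), symmetric])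
  then show ?thesis
    by (simp only: indicator_le_1)
qed

lemma total_variation_norm_le:
  assumes "\<And>P. finite P \<Longrightarrow> partition_on UNIV P \<Longrightarrow> P \<subseteq> sets borel \<Longrightarrow> (\<Sum>A\<in>P. cmod (\<mu> A)) \<le> c"
  shows "total_variation_norm \<mu> \<le> c"
  unfolding total_variation_norm_def
proof (rule cSUP_least)
  have "finite {UNIV :: 'a set} \<and> partition_on UNIV {UNIV :: 'a set} \<and> {UNIV :: 'a set} \<subseteq> sets borel"
    by (auto simp: partition_on_def disjoint_def)
  then show "{P. finite P \<and> partition_on UNIV P \<and> P \<subseteq> sets (borel :: 'a measure)} \<noteq> {}"
    by blast
qed (use assms in auto)

lemma total_variation_dirac_le: "total_variation_norm (dirac_measure z) \<le> 1"
proof (rule total_variation_norm_le)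
  fix P :: "'a set set" assume P: "finite P" "partition_on UNIV P" "P \<subseteq> sets borel"
  have "(\<Sum>A\<in>P. cmod (dirac_measure z A)) = (\<Sum>A\<in>P. indicator A z)"
    using P(3) by (intro sum.cong refl) (auto simp: dirac_measure_def indicator_def)
  then show "(\<Sum>A\<in>P. cmod (dirac_measure z A)) \<le> 1"
    using sum_indicator_partition_le[OF P(1,2)] by simp
qed

text \<open>
  The translate of \<open>g\<close> by \<open>x\<close> is the density of \<open>A \<mapsto> \<gamma> (A - x)\<close>, so the differences over
  a partition add up to at most the \<open>L\<^sup>1\<close> distance of the two densities.
\<close>

lemma sum_translate_difference_le:
  assumes g: "integrable lborel g" and P: "finite P" "partition_on UNIV P" "P \<subseteq> sets borel"
  shows "(\<Sum>A\<in>P. cmod (L1_measure g ((+) x -` A) - L1_measure g ((+) w -` A))) \<le> translation_distance g x w"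
proof -
  have int: "integrable lborel (\<lambda>y. indicator A y *\<^sub>R f y)"
    if "A \<in> P" "integrable lborel f" for A and f :: "'a \<Rightarrow> 'c::{banach, second_countable_topology}"
    using integrable_mult_indicator[OF _ that(2), of A] that(1) P(3) by auto
  note diff = integrable_translation_difference[OF g, of x w]
  have "(\<Sum>A\<in>P. cmod (L1_measure g ((+) x -` A) - L1_measure g ((+) w -` A))) \<le>
      (\<Sum>A\<in>P. LINT y|lborel. indicator A y *\<^sub>R cmod (g (y - x) - g (y - w)))"
  proof (rule sum_mono)
    fix A assume A: "A \<in> P"
    then have Ab: "A \<in> sets borel"
      using P(3) by blast
    have "L1_measure g ((+) x -` A) - L1_measure g ((+) w -` A) =
        (LINT y|lborel. indicator A y *\<^sub>R g (y - x) - indicator A y *\<^sub>R g (y - w))"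
      unfolding L1_measure_translate[OF g Ab]
      by (intro Bochner_Integration.integral_diff[symmetric] int[OF A] integrable_lborel_translate g)
    then have "cmod (L1_measure g ((+) x -` A) - L1_measure g ((+) w -` A)) \<le>
        (LINT y|lborel. cmod (indicator A y *\<^sub>R g (y - x) - indicator A y *\<^sub>R g (y - w)))"
      by (simp only: integral_norm_bound)
    also have "(\<lambda>y. cmod (indicator A y *\<^sub>R g (y - x) - indicator A y *\<^sub>R g (y - w))) =
        (\<lambda>y. indicator A y *\<^sub>R cmod (g (y - x) - g (y - w)))"
      by (auto simp: indicator_def)
    finally show "cmod (L1_measure g ((+) x -` A) - L1_measure g ((+) w -` A)) \<le>
        (LINT y|lborel. indicator A y *\<^sub>R cmod (g (y - x) - g (y - w)))" .
  qed
  also have "\<dots> = (LINT y|lborel. (\<Sum>A\<in>P. indicator A y *\<^sub>R cmod (g (y - x) - g (y - w))))"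
    by (intro Bochner_Integration.integral_sum[symmetric] int diff)
  also have "\<dots> \<le> translation_distance g x w"
    unfolding translation_distance_def
  proof (rule integral_mono)
    show "integrable lborel (\<lambda>y. \<Sum>A\<in>P. indicator A y *\<^sub>R cmod (g (y - x) - g (y - w)))"
      by (intro Bochner_Integration.integrable_sum int diff)
    show "(\<Sum>A\<in>P. indicator A y *\<^sub>R cmod (g (y - x) - g (y - w))) \<le> cmod (g (y - x) - g (y - w))" for y
      using mult_right_mono[OF sum_indicator_partition_le[OF P(1,2), of y] norm_ge_zero, of "g (y - x) - g (y - w)"]
      by (simp only: real_scaleR_def sum_distrib_right mult_1)
  qed (rule diff)
  finally show ?thesis .
qed

lemma total_variation_translate_le:
  assumes g: "integrable lborel g"
  shows "total_variation_norm (\<lambda>A. measure_convolution (dirac_measure x) (L1_measure g) A -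
      measure_convolution (dirac_measure w) (L1_measure g) A) \<le> translation_distance g x w"
proof (rule total_variation_norm_le)
  fix P :: "'a set set" assume P: "finite P" "partition_on UNIV P" "P \<subseteq> sets borel"
  have "(\<Sum>A\<in>P. cmod (measure_convolution (dirac_measure x) (L1_measure g) A -
      measure_convolution (dirac_measure w) (L1_measure g) A)) =
    (\<Sum>A\<in>P. cmod (L1_measure g ((+) x -` A) - L1_measure g ((+) w -` A)))"
    using P(3) by (intro sum.cong refl) (auto simp: measure_convolution_dirac[OF complex_measure_L1[OF g]])
  also have "\<dots> \<le> translation_distance g x w"
    by (rule sum_translate_difference_le[OF g P])
  finally show "(\<Sum>A\<in>P. cmod (measure_convolution (dirac_measure x) (L1_measure g) A -
      measure_convolution (dirac_measure w) (L1_measure g) A)) \<le> translation_distance g x w" .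
qed

lemma borel_measurable_translation_distance:
  assumes g: "integrable lborel g" and [measurable]: "s \<in> borel_measurable borel"
  shows "(\<lambda>x. translation_distance g x (s x)) \<in> borel_measurable borel"
proof -
  have [measurable]: "g \<in> borel_measurable borel"
    using g by auto
  show ?thesis
    unfolding translation_distance_def by measurable
qed

text \<open>
  The right hand side is the integral of \<open>F\<close> against the image of \<open>\<mu>\<close> under \<open>s\<close>, which is
  the finite combination \<open>\<Sum>w. \<mu> (s = w) \<delta>\<^sub>w\<close> of point measures.
\<close>

lemma simple_function_integral:
  fixes s :: "'b::euclidean_space \<Rightarrow> 'b"
  assumes \<mu>: "complex_measure \<mu>" and s: "simple_function borel s"
  shows "complex_measure_integrable \<mu> (\<lambda>x. F (s x))"
    and "complex_measure_integral \<mu> (\<lambda>x. F (s x)) = (\<Sum>w\<in>range s. \<mu> (s -` {w}) * F w)"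
proof -
  have fin: "finite (range s)"
    using simple_functionD(1)[OF s] by simp
  have sets: "s -` {w} \<in> sets borel" for w
    using simple_functionD(2)[OF s, of "{w}"] by simp
  have F: "(\<lambda>x. F (s x)) = (\<lambda>x. \<Sum>w\<in>range s. F w * indicator (s -` {w}) x)"
  proof
    fix x
    have "(\<Sum>w\<in>range s. F w * indicator (s -` {w}) x) = (\<Sum>w\<in>range s. if w = s x then F w else 0)"
      by (intro sum.cong refl) (auto simp: indicator_def)
    also have "\<dots> = F (s x)"
      using fin by simp
    finally show "F (s x) = (\<Sum>w\<in>range s. F w * indicator (s -` {w}) x)" ..
  qed
  have int: "complex_measure_integrable \<mu> (\<lambda>x. F w * indicator (s -` {w}) x)" for w
  proof (intro complex_measure_integrable_cmult complex_measure_integrable_bounded[OF \<mu>, of _ 1])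
    show "indicator (s -` {w}) \<in> borel_measurable borel"
      by (rule borel_measurable_indicator[OF sets])
    show "cmod (indicator (s -` {w}) x) \<le> 1" for x
      by (simp add: indicator_def)
  qed
  show "complex_measure_integrable \<mu> (\<lambda>x. F (s x))"
    unfolding F by (rule complex_measure_integral_sum(1)[OF fin int])
  have "complex_measure_integral \<mu> (\<lambda>x. F (s x)) =
      (\<Sum>w\<in>range s. complex_measure_integral \<mu> (\<lambda>x. F w * indicator (s -` {w}) x))"
    unfolding F by (rule complex_measure_integral_sum(2)[OF fin int])
  then show "complex_measure_integral \<mu> (\<lambda>x. F (s x)) = (\<Sum>w\<in>range s. \<mu> (s -` {w}) * F w)"
    by (simp add: complex_measure_integral_cmult complex_measure_integral_indicator[OF \<mu> sets] mult.commute)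
qed

text \<open>
  Replacing \<open>\<mu>\<close> by its image under a simple map \<open>s\<close> close to the identity changes the convolution with
  \<open>g \<in> L\<^sup>1\<close> little in total variation: on a set \<open>A\<close> the difference is
  \<open>\<integral> \<gamma> (A - x) - \<gamma> (A - s x) d\<mu>(x)\<close>, and summation over a partition takes place under the
  integral.
\<close>

lemma total_variation_discretisation_le:
  fixes s :: "'b::euclidean_space \<Rightarrow> 'b"
  assumes \<mu>: "complex_measure \<mu>" and g: "integrable lborel g" and s: "simple_function borel s"
  shows "total_variation_norm (\<lambda>A. measure_convolution \<mu> (L1_measure g) A -
      (\<Sum>w\<in>range s. \<mu> (s -` {w}) * measure_convolution (dirac_measure w) (L1_measure g) A))
    \<le> variation_integral \<mu> (\<lambda>x. translation_distance g x (s x))"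
proof (rule total_variation_norm_le)
  fix P :: "'b set set" assume P: "finite P" "partition_on UNIV P" "P \<subseteq> sets borel"
  let ?\<gamma> = "L1_measure g"
  let ?\<eta> = "\<lambda>A. measure_convolution \<mu> ?\<gamma> A - (\<Sum>w\<in>range s. \<mu> (s -` {w}) * measure_convolution (dirac_measure w) ?\<gamma> A)"
  let ?d = "\<lambda>A x. ?\<gamma> ((+) x -` A) - ?\<gamma> ((+) (s x) -` A)"
  have \<gamma>: "complex_measure ?\<gamma>"
    by (rule complex_measure_L1[OF g])
  obtain K where K: "\<And>A. cmod (?\<gamma> A) \<le> K"
    using complex_measure_bounded[OF \<gamma>] by blast
  have smeas: "s \<in> borel_measurable borel"
    using s by (rule borel_measurable_simple_function)
  have meas: "(\<lambda>x. ?\<gamma> ((+) x -` A)) \<in> borel_measurable borel" if "A \<in> P" for A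
    using borel_measurable_translate_measure[OF \<gamma>] that P(3) by blast
  have d_int: "integrable M (\<lambda>x. cmod (?d A x))" if A: "A \<in> P" and M: "M \<in> jordan_measures \<mu>" for A M
  proof (rule jordan_integrable_bounded[OF \<mu> M])
    have "(\<lambda>x. ?\<gamma> ((+) (s x) -` A)) \<in> borel_measurable borel"
      by (rule measurable_compose[OF smeas meas[OF A]])
    then show "(\<lambda>x. cmod (?d A x)) \<in> borel_measurable borel"
      by (intro measurable_compose[OF _ borel_measurable_norm] borel_measurable_diff meas[OF A])
    show "norm (cmod (?d A x)) \<le> K + K" for x
      using norm_triangle_ineq4[of "?\<gamma> ((+) x -` A)" "?\<gamma> ((+) (s x) -` A)"]
        K[of "(+) x -` A"] K[of "(+) (s x) -` A"] by simp
  qed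
  have \<eta>: "cmod (?\<eta> A) \<le> variation_integral \<mu> (\<lambda>x. cmod (?d A x))" if A: "A \<in> P" for A
  proof -
    have Ab: "A \<in> sets borel"
      using A P(3) by blast
    have "?\<eta> A = complex_measure_integral \<mu> (\<lambda>x. ?\<gamma> ((+) x -` A)) -
        complex_measure_integral \<mu> (\<lambda>x. ?\<gamma> ((+) (s x) -` A))"
      by (simp add: measure_convolution_dirac[OF \<gamma> Ab] measure_convolution_eq[OF \<gamma> Ab, of \<mu>]
          simple_function_integral(2)[OF \<mu> s, of "\<lambda>w. ?\<gamma> ((+) w -` A)"])
    also have "\<dots> = complex_measure_integral \<mu> (?d A)"
      by (intro complex_measure_integral_diff[symmetric] simple_function_integral(1)[OF \<mu> s]
          complex_measure_integrable_bounded[OF \<mu> meas[OF A] K])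
    finally show ?thesis
      by (simp only: norm_complex_measure_integral_le)
  qed
  have "(\<Sum>A\<in>P. cmod (?\<eta> A)) \<le> (\<Sum>A\<in>P. variation_integral \<mu> (\<lambda>x. cmod (?d A x)))"
    by (rule sum_mono) (rule \<eta>)
  also have "\<dots> = variation_integral \<mu> (\<lambda>x. \<Sum>A\<in>P. cmod (?d A x))"
    by (rule variation_integral_sum[symmetric]) (use P(1) d_int in auto)
  also have "\<dots> \<le> variation_integral \<mu> (\<lambda>x. translation_distance g x (s x))"
  proof (rule variation_integral_mono)
    show "integrable M (\<lambda>x. \<Sum>A\<in>P. cmod (?d A x))" if "M \<in> jordan_measures \<mu>" for M
      using d_int that by (intro Bochner_Integration.integrable_sum) auto
    show "integrable M (\<lambda>x. translation_distance g x (s x))" if M: "M \<in> jordan_measures \<mu>" for M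
      by (rule jordan_integrable_bounded[OF \<mu> M borel_measurable_translation_distance[OF g smeas]
            norm_translation_distance_le[OF g]])
    show "(\<Sum>A\<in>P. cmod (?d A x)) \<le> translation_distance g x (s x)" for x
      by (rule sum_translate_difference_le[OF g P])
  qed
  finally show "(\<Sum>A\<in>P. cmod (?\<eta> A)) \<le> variation_integral \<mu> (\<lambda>x. translation_distance g x (s x))" .
qed

section \<open>The weak formula for the measure-operator convolution\<close>

context
  fixes conv :: "(('a::euclidean_space \<times> 'a) set \<Rightarrow> complex) \<Rightarrow> ('a l2 \<Rightarrow> 'a l2) \<Rightarrow> 'a l2 \<Rightarrow> 'a l2"
  assumes conv: "measure_operator_convolution conv"
begin

lemma conv_trace_class: "complex_measure \<mu> \<Longrightarrow> trace_class S \<Longrightarrow> trace_class (conv \<mu> S)"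
  by (rule conv[unfolded measure_operator_convolution_def, THEN conjunct1, rule_format]) simp

lemma conv_measure_add: "complex_measure \<mu> \<Longrightarrow> complex_measure \<nu> \<Longrightarrow> trace_class S \<Longrightarrow>
    conv (\<lambda>A. \<mu> A + \<nu> A) S \<psi> = conv \<mu> S \<psi> + conv \<nu> S \<psi>"
  by (rule conv[unfolded measure_operator_convolution_def, THEN conjunct2, THEN conjunct1,
        rule_format, THEN fun_cong]) simp

lemma conv_measure_cmult: "complex_measure \<mu> \<Longrightarrow> trace_class S \<Longrightarrow>
    conv (\<lambda>A. c * \<mu> A) S = (\<lambda>\<psi>. c *\<^sub>C conv \<mu> S \<psi>)"
  using conv unfolding measure_operator_convolution_def by blast

lemma conv_operator_add: "complex_measure \<mu> \<Longrightarrow> trace_class S \<Longrightarrow> trace_class T \<Longrightarrow>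
    conv \<mu> (\<lambda>\<psi>. S \<psi> + T \<psi>) = (\<lambda>\<psi>. conv \<mu> S \<psi> + conv \<mu> T \<psi>)"
  using conv unfolding measure_operator_convolution_def by blast

lemma conv_operator_scaleC: "complex_measure \<mu> \<Longrightarrow> trace_class S \<Longrightarrow>
    conv \<mu> (\<lambda>\<psi>. c *\<^sub>C S \<psi>) = (\<lambda>\<psi>. c *\<^sub>C conv \<mu> S \<psi>)"
  using conv unfolding measure_operator_convolution_def by blast

lemma conv_dirac: "trace_class S \<Longrightarrow>
    conv (dirac_measure z) S = tf_shift z \<circ> S \<circ> cadjoint (tf_shift z)"
  using conv unfolding measure_operator_convolution_def by blast

lemma trace_norm_conv_le: "complex_measure \<mu> \<Longrightarrow> trace_class S \<Longrightarrow>
    trace_norm (conv \<mu> S) \<le> total_variation_norm \<mu> * trace_norm S"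
  using conv unfolding measure_operator_convolution_def by blast

lemma conv_conv: "complex_measure \<mu> \<Longrightarrow> complex_measure \<nu> \<Longrightarrow> trace_class S \<Longrightarrow>
    conv \<mu> (conv \<nu> S) = conv (measure_convolution \<mu> \<nu>) S"
  using conv unfolding measure_operator_convolution_def by blast

lemma conv_L1_dense: "trace_class S \<Longrightarrow> 0 < \<epsilon> \<Longrightarrow>
    \<exists>L\<in>complex_span {conv (L1_measure f) S |f S. integrable lborel f \<and> trace_class S}.
      trace_norm (\<lambda>\<psi>. S \<psi> - L \<psi>) < \<epsilon>"
proof -
  assume "trace_class S" "0 < \<epsilon>"
  then have "S \<in> trace_norm_closure
       (complex_span {conv (L1_measure f) S |f S. integrable lborel f \<and> trace_class S})"
    using conv unfolding measure_operator_convolution_def by auto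
  then show ?thesis
    using \<open>0 < \<epsilon>\<close> unfolding trace_norm_closure_def by blast
qed

lemma conv_cinner_le:
  assumes \<mu>: "complex_measure \<mu>" and S: "trace_class S" and c: "total_variation_norm \<mu> \<le> c"
  shows "cmod (cinner (conv \<mu> S \<psi>) \<phi>) \<le> 4 * norm \<psi> * norm \<phi> * trace_norm S * c"
proof -
  have "cmod (cinner (conv \<mu> S \<psi>) \<phi>) \<le> 4 * norm \<psi> * norm \<phi> * trace_norm (conv \<mu> S)"
    by (rule trace_class_cinner_le[OF conv_trace_class[OF \<mu> S]])
  also have "\<dots> \<le> 4 * norm \<psi> * norm \<phi> * (c * trace_norm S)"
  proof (rule mult_left_mono)
    have "total_variation_norm \<mu> * trace_norm S \<le> c * trace_norm S"
      by (intro mult_right_mono c trace_norm_nonneg S)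
    with trace_norm_conv_le[OF \<mu> S] show "trace_norm (conv \<mu> S) \<le> c * trace_norm S"
      by (rule order_trans)
  qed simp
  finally show ?thesis
    by (simp only: mult_ac)
qed

lemma conv_cinner_sum:
  assumes "finite I" "\<And>i. i \<in> I \<Longrightarrow> complex_measure (\<mu> i)" "trace_class S"
  shows "cinner (conv (\<lambda>A. \<Sum>i\<in>I. c i * \<mu> i A) S \<psi>) \<phi> = (\<Sum>i\<in>I. c i * cinner (conv (\<mu> i) S \<psi>) \<phi>)"
  using assms(1,2)
proof (induction rule: finite_induct)
  case empty
  have "conv (\<lambda>A. 0) S \<psi> = 0 *\<^sub>C conv (\<lambda>A. 0) S \<psi>"
    using conv_measure_cmult[OF complex_measure_zero assms(3), of 0, THEN fun_cong, of \<psi>]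
    by (simp only: mult_zero_left)
  then have "cinner (conv (\<lambda>A. 0) S \<psi>) \<phi> = cinner (0 *\<^sub>C conv (\<lambda>A. 0) S \<psi>) \<phi>"
    by (rule arg_cong[where f = "\<lambda>x. cinner x \<phi>"])
  then show ?case
    by (simp add: cinner_scaleC_left)
next
  case (insert i I)
  have 1: "complex_measure (\<lambda>A. c i * \<mu> i A)"
    by (intro complex_measure_cmult insert) simp
  have 2: "complex_measure (\<lambda>A. \<Sum>i\<in>I. c i * \<mu> i A)"
    by (intro complex_measure_sum complex_measure_cmult insert) auto
  show ?case
    using insert conv_measure_add[OF 1 2 assms(3), of \<psi>] conv_measure_cmult[OF _ assms(3), of "\<mu> i" "c i"]
    by (simp add: cinner_add_left cinner_scaleC_left)
qed

text \<open>
  The formula for one operator, with the orbit \<open>z \<mapsto> \<pi>(z) S \<pi>(z)\<^sup>*\<close> written as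
  \<open>\<delta>\<^sub>z \<star> S\<close>. In this form the properties of the convolution in its measure argument apply to the
  integrand. Of the integrability of the orbit only measurability is recorded; boundedness follows
  from the bound on trace norms.
\<close>

definition weak_formula :: "(('a \<times> 'a) set \<Rightarrow> complex) \<Rightarrow> ('a l2 \<Rightarrow> 'a l2) \<Rightarrow> bool" where
  "weak_formula \<mu> S \<longleftrightarrow> trace_class S \<and> (\<forall>\<psi> \<phi>.
     (\<lambda>z. cinner (conv (dirac_measure z) S \<psi>) \<phi>) \<in> borel_measurable borel \<and>
     cinner (conv \<mu> S \<psi>) \<phi> = complex_measure_integral \<mu> (\<lambda>z. cinner (conv (dirac_measure z) S \<psi>) \<phi>))"

lemma orbit_bounded:
  assumes "trace_class S"
  shows "cmod (cinner (conv (dirac_measure z) S \<psi>) \<phi>) \<le> 4 * norm \<psi> * norm \<phi> * trace_norm S"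
  using conv_cinner_le[OF complex_measure_dirac assms total_variation_dirac_le] by simp

lemma orbit_integrable:
  assumes "complex_measure \<mu>" "weak_formula \<nu> S"
  shows "complex_measure_integrable \<mu> (\<lambda>z. cinner (conv (dirac_measure z) S \<psi>) \<phi>)"
  using assms(2) orbit_bounded
  by (intro complex_measure_integrable_bounded[OF assms(1)]) (auto simp: weak_formula_def)

text \<open>
  Let \<open>S = g \<star> T\<close>. By associativity \<open>\<mu> \<star> S = (\<mu> * g) \<star> T\<close>, and similarly for the point
  measures. For a simple map \<open>s\<close> the formula holds exactly with \<open>\<mu>\<close> replaced by
  \<open>\<Sum>w. \<mu> (s = w) \<delta>\<^sub>w\<close>, by bilinearity. Both sides change by at most a constant times
  \<open>\<integral> \<parallel>g(\<cdot> - x) - g(\<cdot> - s x)\<parallel>\<^sub>1 d|\<mu>|(x)\<close> in this replacement, which tends to \<open>0\<close> when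
  \<open>s\<close> runs through simple maps converging to the identity.
\<close>

lemma weak_formula_L1:
  fixes g :: "'a \<times> 'a \<Rightarrow> complex"
  assumes \<mu>: "complex_measure \<mu>" and g: "integrable lborel g" and T: "trace_class T"
  shows "weak_formula \<mu> (conv (L1_measure g) T)"
  unfolding weak_formula_def
proof (intro conjI allI)
  let ?\<gamma> = "L1_measure g"
  let ?S = "conv ?\<gamma> T"
  have \<gamma>: "complex_measure ?\<gamma>"
    by (rule complex_measure_L1[OF g])
  show S: "trace_class ?S"
    by (rule conv_trace_class[OF \<gamma> T])
  fix \<psi> \<phi>
  let ?F = "\<lambda>z. cinner (conv (dirac_measure z) ?S \<psi>) \<phi>"
  let ?T = "\<lambda>z. measure_convolution (dirac_measure z) ?\<gamma>"
  have Tz: "complex_measure (?T z)" for z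
    by (rule complex_measure_convolution[OF complex_measure_dirac \<gamma>])
  have F: "?F z = cinner (conv (?T z) T \<psi>) \<phi>" for z
    by (simp add: conv_conv[OF complex_measure_dirac \<gamma> T])
  define C where "C = 4 * norm \<psi> * norm \<phi> * trace_norm T"
  have C: "0 \<le> C"
    by (simp add: C_def trace_norm_nonneg[OF T])
  have F_diff: "cmod (?F z - ?F w) \<le> C * translation_distance g z w" for z w
  proof -
    have neg: "complex_measure (\<lambda>A. - 1 * ?T w A)"
      by (rule complex_measure_cmult[OF Tz])
    have "conv (\<lambda>A. ?T z A + - 1 * ?T w A) T \<psi> = conv (?T z) T \<psi> + - 1 *\<^sub>C conv (?T w) T \<psi>"
      by (simp only: conv_measure_add[OF Tz neg T] conv_measure_cmult[OF Tz T])
    then have "?F z - ?F w = cinner (conv (\<lambda>A. ?T z A + - 1 * ?T w A) T \<psi>) \<phi>"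
      by (simp only: F cinner_add_left cinner_scaleC_left) simp
    also have "cmod \<dots> \<le> C * translation_distance g z w"
      unfolding C_def
      by (rule conv_cinner_le[OF complex_measure_add[OF Tz neg] T])
         (use total_variation_translate_le[OF g, of z w] in simp)
    finally show ?thesis .
  qed
  have F_cont: "(\<lambda>n. ?F (w n)) \<longlonglongrightarrow> ?F z" if "w \<longlonglongrightarrow> z" for w z
  proof -
    have "(\<lambda>n. C * translation_distance g z (w n)) \<longlonglongrightarrow> 0"
      using tendsto_mult_right_zero[OF translation_distance_tendsto[OF g that]] .
    then have "(\<lambda>n. ?F (w n) - ?F z) \<longlonglongrightarrow> 0"
      by (rule Lim_null_comparison[rotated]) (use F_diff in \<open>simp add: norm_minus_commute\<close>)
    then show ?thesis
      by (rule LIM_zero_cancel)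
  qed
  have "continuous_on UNIV ?F"
    unfolding continuous_on_sequentially comp_def using F_cont by blast
  then show F_meas: "?F \<in> borel_measurable borel"
    by (rule borel_measurable_continuous_onI)
  have F_int: "complex_measure_integrable \<mu> ?F"
    by (rule complex_measure_integrable_bounded[OF \<mu> F_meas orbit_bounded[OF S]])
  \<comment> \<open>One multiple of \<open>C\<close> pays for replacing \<open>\<mu>\<close> by its discretisation in the convolution, the other
    for replacing it in the integral.\<close>
  have error: "cmod (cinner (conv \<mu> ?S \<psi>) \<phi> - complex_measure_integral \<mu> ?F) \<le>
      2 * C * variation_integral \<mu> (\<lambda>x. translation_distance g x (s x))"
    if s: "simple_function borel s" for s
  proof -
    let ?c = "\<lambda>w. \<mu> (s -` {w})"
    let ?V = "variation_integral \<mu> (\<lambda>x. translation_distance g x (s x))"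
    have smeas: "s \<in> borel_measurable borel"
      using s by (rule borel_measurable_simple_function)
    have fin: "finite (range s)"
      using simple_functionD(1)[OF s] by simp
    have sum: "complex_measure (\<lambda>A. \<Sum>w\<in>range s. - ?c w * ?T w A)"
      by (intro complex_measure_sum complex_measure_cmult Tz fin)
    have conv_\<mu>: "complex_measure (measure_convolution \<mu> ?\<gamma>)"
      by (rule complex_measure_convolution[OF \<mu> \<gamma>])
    have "cinner (conv (\<lambda>A. measure_convolution \<mu> ?\<gamma> A + (\<Sum>w\<in>range s. - ?c w * ?T w A)) T \<psi>) \<phi> =
        cinner (conv \<mu> ?S \<psi>) \<phi> + (\<Sum>w\<in>range s. - ?c w * ?F w)"
      by (simp only: conv_measure_add[OF conv_\<mu> sum T] cinner_add_left conv_cinner_sum[OF fin Tz T]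
          F conv_conv[OF \<mu> \<gamma> T])
    also have "\<dots> = cinner (conv \<mu> ?S \<psi>) \<phi> - complex_measure_integral \<mu> (\<lambda>x. ?F (s x))"
      by (simp add: simple_function_integral(2)[OF \<mu> s, of ?F] sum_negf)
    finally have eq: "cinner (conv \<mu> ?S \<psi>) \<phi> - complex_measure_integral \<mu> (\<lambda>x. ?F (s x)) =
        cinner (conv (\<lambda>A. measure_convolution \<mu> ?\<gamma> A + (\<Sum>w\<in>range s. - ?c w * ?T w A)) T \<psi>) \<phi>" ..
    have 1: "cmod (cinner (conv \<mu> ?S \<psi>) \<phi> - complex_measure_integral \<mu> (\<lambda>x. ?F (s x))) \<le> C * ?V"
      unfolding eq C_def
      by (rule conv_cinner_le[OF complex_measure_add[OF conv_\<mu> sum] T])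
         (use total_variation_discretisation_le[OF \<mu> g s] in \<open>simp add: sum_negf\<close>)
    have "complex_measure_integral \<mu> (\<lambda>x. ?F (s x)) - complex_measure_integral \<mu> ?F =
        complex_measure_integral \<mu> (\<lambda>x. ?F (s x) - ?F x)"
      by (rule complex_measure_integral_diff[symmetric, OF simple_function_integral(1)[OF \<mu> s] F_int])
    also have "cmod \<dots> \<le> variation_integral \<mu> (\<lambda>x. cmod (?F (s x) - ?F x))"
      by (rule norm_complex_measure_integral_le)
    also have "\<dots> \<le> variation_integral \<mu> (\<lambda>x. C * translation_distance g x (s x))"
    proof (rule variation_integral_mono)
      show "integrable M (\<lambda>x. cmod (?F (s x) - ?F x))" if M: "M \<in> jordan_measures \<mu>" for M
        using complex_measure_integrable_iff[of \<mu> ?F] complex_measure_integrable_iff[of \<mu> "\<lambda>x. ?F (s x)"]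
          F_int simple_function_integral(1)[OF \<mu> s, of ?F] M
        by (intro integrable_norm Bochner_Integration.integrable_diff) auto
      show "integrable M (\<lambda>x. C * translation_distance g x (s x))" if M: "M \<in> jordan_measures \<mu>" for M
        by (intro integrable_mult_right
            jordan_integrable_bounded[OF \<mu> M borel_measurable_translation_distance[OF g smeas]
              norm_translation_distance_le[OF g]])
      show "cmod (?F (s x) - ?F x) \<le> C * translation_distance g x (s x)" for x
        using F_diff[of x "s x"] by (simp add: norm_minus_commute)
    qed
    also have "\<dots> = C * ?V"
      by (rule variation_integral_cmult)
    finally have 2: "cmod (complex_measure_integral \<mu> (\<lambda>x. ?F (s x)) - complex_measure_integral \<mu> ?F) \<le> C * ?V" .
    show ?thesis
      using norm_diff_triangle_le[OF 1 2] by (simp add: mult.assoc)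
  qed
  obtain s :: "nat \<Rightarrow> 'a \<times> 'a \<Rightarrow> 'a \<times> 'a" where
    s: "\<And>n. simple_function borel (s n)" and s_lim: "\<And>x. (\<lambda>n. s n x) \<longlonglongrightarrow> x"
    using borel_measurable_implies_sequence_metric[of "\<lambda>x. x" borel 0] by auto
  have "(\<lambda>n. variation_integral \<mu> (\<lambda>x. translation_distance g x (s n x))) \<longlonglongrightarrow> variation_integral \<mu> (\<lambda>x. 0)"
  proof (rule variation_integral_dominated_convergence[OF \<mu>])
    show "(\<lambda>x. translation_distance g x (s n x)) \<in> borel_measurable borel" for n
      using s by (intro borel_measurable_translation_distance[OF g] borel_measurable_simple_function)
    show "norm (translation_distance g x (s n x)) \<le> 2 * (LINT y|lborel. cmod (g y))" for n x
      by (rule norm_translation_distance_le[OF g])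
    show "(\<lambda>n. translation_distance g x (s n x)) \<longlonglongrightarrow> 0" for x
      by (rule translation_distance_tendsto[OF g s_lim])
  qed simp
  then have "(\<lambda>n. 2 * C * variation_integral \<mu> (\<lambda>x. translation_distance g x (s n x))) \<longlonglongrightarrow> 2 * C * 0"
    by (intro tendsto_mult_left) (simp add: variation_integral_def)
  then have "cmod (cinner (conv \<mu> ?S \<psi>) \<phi> - complex_measure_integral \<mu> ?F) \<le> 2 * C * 0"
    by (rule LIMSEQ_le_const) (use error[OF s] in auto)
  then show "cinner (conv \<mu> ?S \<psi>) \<phi> = complex_measure_integral \<mu> ?F"
    by simp
qed

lemma weak_formula_add:
  assumes \<mu>: "complex_measure \<mu>" and S: "weak_formula \<mu> S" and T: "weak_formula \<mu> T"
  shows "weak_formula \<mu> (\<lambda>\<psi>. S \<psi> + T \<psi>)"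
proof -
  have tc: "trace_class S" "trace_class T"
    using S T by (auto simp: weak_formula_def)
  show ?thesis
    using S T trace_class_add[OF tc]
      complex_measure_integral_add[OF orbit_integrable[OF \<mu> S] orbit_integrable[OF \<mu> T]]
    by (auto simp: weak_formula_def conv_operator_add[OF \<mu> tc] conv_operator_add[OF complex_measure_dirac tc]
        cinner_add_left intro!: borel_measurable_add)
qed

lemma weak_formula_scaleC:
  assumes \<mu>: "complex_measure \<mu>" and S: "weak_formula \<mu> S" and tc: "trace_class (\<lambda>\<psi>. c *\<^sub>C S \<psi>)"
  shows "weak_formula \<mu> (\<lambda>\<psi>. c *\<^sub>C S \<psi>)"
proof -
  have tcS: "trace_class S"
    using S by (auto simp: weak_formula_def)
  show ?thesis
    using S tc
    by (auto simp: weak_formula_def conv_operator_scaleC[OF \<mu> tcS] conv_operator_scaleC[OF complex_measure_dirac tcS]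
        cinner_scaleC_left complex_measure_integral_cmult intro!: borel_measurable_times)
qed

text \<open>
  The trace-class operator \<open>S\<close> only supplies the zero operator, needed for the empty sum, as the
  convolution of the zero function with \<open>S\<close>.
\<close>

lemma weak_formula_span:
  fixes S :: "'a l2 \<Rightarrow> 'a l2"
  assumes \<mu>: "complex_measure \<mu>" and S: "trace_class S"
    and F: "finite F" "F \<subseteq> {conv (L1_measure f) S |f S. integrable lborel f \<and> trace_class S}"
  shows "weak_formula \<mu> (\<lambda>\<psi>. \<Sum>T\<in>F. c T *\<^sub>C T \<psi>)"
  using F
proof (induction rule: finite_induct)
  case empty
  have zero: "weak_formula \<mu> (conv (L1_measure (\<lambda>_. 0)) S)"
    by (rule weak_formula_L1[OF \<mu> _ S]) simp
  have "L1_measure (\<lambda>_. 0) = (\<lambda>A. 0 * dirac_measure z A)" for z :: "'a \<times> 'a"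
    by (auto simp: L1_measure_def fun_eq_iff set_lebesgue_integral_def)
  then have "conv (L1_measure (\<lambda>_. 0)) S = (\<lambda>\<psi>. 0 *\<^sub>C conv (dirac_measure 0) S \<psi>)"
    using conv_measure_cmult[OF complex_measure_dirac S, of 0] by simp
  also have "\<dots> = (\<lambda>\<psi>. 0)"
    by (simp add: scaleC_conv)
  finally show ?case
    using zero by simp
next
  case (insert T F)
  obtain f R where T: "T = conv (L1_measure f) R" and f: "integrable lborel f" and R: "trace_class R"
    using insert.prems by auto
  have L1: "complex_measure (L1_measure f)"
    by (rule complex_measure_L1[OF f])
  have "trace_class (\<lambda>\<psi>. c T *\<^sub>C T \<psi>)"
    using conv_trace_class[OF complex_measure_cmult[OF L1, of "c T"] R] conv_measure_cmult[OF L1 R, of "c T"]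
    by (simp add: T)
  then have "weak_formula \<mu> (\<lambda>\<psi>. c T *\<^sub>C T \<psi>)"
    using weak_formula_L1[OF \<mu> f R] by (intro weak_formula_scaleC[OF \<mu>]) (simp_all add: T)
  moreover have "weak_formula \<mu> (\<lambda>\<psi>. \<Sum>T\<in>F. c T *\<^sub>C T \<psi>)"
    using insert by simp
  ultimately have "weak_formula \<mu> (\<lambda>\<psi>. c T *\<^sub>C T \<psi> + (\<Sum>T\<in>F. c T *\<^sub>C T \<psi>))"
    by (rule weak_formula_add[OF \<mu>])
  then show ?case
    using insert by simp
qed

lemma weak_formula_approx:
  assumes \<mu>: "complex_measure \<mu>" and S: "trace_class S" and \<epsilon>: "0 < \<epsilon>"
  shows "\<exists>L D. weak_formula \<mu> L \<and> trace_class D \<and> trace_norm D < \<epsilon> \<and> S = (\<lambda>\<psi>. D \<psi> + L \<psi>)"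
proof -
  obtain F c where F: "finite F" "F \<subseteq> {conv (L1_measure f) S |f S. integrable lborel f \<and> trace_class S}"
      and small: "trace_norm (\<lambda>\<psi>. S \<psi> - (\<Sum>T\<in>F. c T *\<^sub>C T \<psi>)) < \<epsilon>"
    using conv_L1_dense[OF S \<epsilon>] unfolding complex_span_def by blast
  have "trace_class (\<lambda>\<psi>. S \<psi> + (\<Sum>T\<in>F. - c T *\<^sub>C T \<psi>))"
    using weak_formula_span[OF \<mu> S F, of "\<lambda>T. - c T"] by (intro trace_class_add S) (simp add: weak_formula_def)
  moreover have "- a *\<^sub>C \<psi> = - (a *\<^sub>C \<psi>)" for a and \<psi> :: "'a l2"
    by (simp add: scaleC_conv)
  then have "(\<Sum>T\<in>F. - c T *\<^sub>C T \<psi>) = - (\<Sum>T\<in>F. c T *\<^sub>C T \<psi>)" for \<psi>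
    by (simp add: sum_negf)
  ultimately have "trace_class (\<lambda>\<psi>. S \<psi> - (\<Sum>T\<in>F. c T *\<^sub>C T \<psi>))"
    by simp
  then show ?thesis
    using weak_formula_span[OF \<mu> S F, of c] small
    by (intro exI[of _ "\<lambda>\<psi>. \<Sum>T\<in>F. c T *\<^sub>C T \<psi>"] exI[of _ "\<lambda>\<psi>. S \<psi> - (\<Sum>T\<in>F. c T *\<^sub>C T \<psi>)"]) simp
qed

text \<open>
  In the decomposition \<open>S = D\<^sub>n + L\<^sub>n\<close> of the previous lemma the orbits of \<open>L\<^sub>n\<close> converge to
  that of \<open>S\<close> uniformly in \<open>z\<close>, because \<open>\<delta>\<^sub>z\<close> has total variation at most \<open>1\<close>.
  Also \<open>\<mu> \<star> L\<^sub>n\<close> tends to \<open>\<mu> \<star> S\<close> in trace norm.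
\<close>

lemma weak_formula_trace_class:
  assumes \<mu>: "complex_measure \<mu>" and S: "trace_class S"
  shows "weak_formula \<mu> S"
  unfolding weak_formula_def
proof (intro conjI allI S)
  fix \<psi> \<phi>
  let ?F = "\<lambda>S z. cinner (conv (dirac_measure z) S \<psi>) \<phi>"
  let ?C = "4 * norm \<psi> * norm \<phi>"
  have "\<forall>n. \<exists>L D. weak_formula \<mu> L \<and> trace_class D \<and> trace_norm D < 1 / real (Suc n) \<and> S = (\<lambda>\<psi>. D \<psi> + L \<psi>)"
    by (intro allI weak_formula_approx[OF \<mu> S]) simp
  then obtain L D where L: "\<And>n. weak_formula \<mu> (L n)" and D: "\<And>n. trace_class (D n)"
      and small: "\<And>n. trace_norm (D n) < 1 / real (Suc n)" and SD: "\<And>n. S = (\<lambda>\<psi>. D n \<psi> + L n \<psi>)"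
    by metis
  have Ltc: "trace_class (L n)" for n
    using L by (simp add: weak_formula_def)
  have split: "cinner (conv \<nu> S \<psi>) \<phi> = cinner (conv \<nu> (D n) \<psi>) \<phi> + cinner (conv \<nu> (L n) \<psi>) \<phi>"
    if "complex_measure \<nu>" for \<nu> n
    by (subst SD[of n]) (simp add: conv_operator_add[OF that D Ltc] cinner_add_left)
  have F_diff: "cmod (?F S z - ?F (L n) z) \<le> ?C * (1 / real (Suc n))" for n z
  proof -
    have "cmod (?F S z - ?F (L n) z) \<le> ?C * trace_norm (D n)"
      using orbit_bounded[OF D, of z n] by (simp add: split[OF complex_measure_dirac, of z n])
    also have "\<dots> \<le> ?C * (1 / real (Suc n))"
      using small[of n] by (intro mult_left_mono) auto
    finally show ?thesis .
  qed
  have null: "(\<lambda>n. c * (1 / real (Suc n))) \<longlonglongrightarrow> 0" for c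
    using tendsto_mult_right_zero[OF LIMSEQ_inverse_real_of_nat, of c] by (simp add: inverse_eq_divide)
  have F_lim: "(\<lambda>n. ?F (L n) z) \<longlonglongrightarrow> ?F S z" for z
  proof -
    have "(\<lambda>n. ?F (L n) z - ?F S z) \<longlonglongrightarrow> 0"
      by (rule Lim_null_comparison[OF _ null[of ?C]]) (use F_diff in \<open>simp add: norm_minus_commute\<close>)
    then show ?thesis
      by (rule LIM_zero_cancel)
  qed
  have L_meas: "?F (L n) \<in> borel_measurable borel" for n
    using L by (simp add: weak_formula_def)
  show F_meas: "?F S \<in> borel_measurable borel"
    by (rule borel_measurable_LIMSEQ_metric[OF L_meas F_lim])
  have "(\<lambda>n. complex_measure_integral \<mu> (?F (L n))) \<longlonglongrightarrow> complex_measure_integral \<mu> (?F S)"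
  proof (rule complex_measure_integral_dominated_convergence[OF \<mu> L_meas F_meas _ F_lim])
    show "cmod (?F (L n) z) \<le> ?C * trace_norm S + ?C * 1" for n z
    proof -
      have "?C * (1 / real (Suc n)) \<le> ?C * 1"
        by (intro mult_left_mono) auto
      then show ?thesis
        using F_diff[of z n] orbit_bounded[OF S, of z \<psi> \<phi>] norm_triangle_ineq3[of "?F (L n) z" "?F S z"]
        by (simp add: norm_minus_commute)
    qed
  qed
  moreover have "(\<lambda>n. cinner (conv \<mu> (L n) \<psi>) \<phi>) \<longlonglongrightarrow> cinner (conv \<mu> S \<psi>) \<phi>"
  proof -
    let ?K = "?C * \<bar>total_variation_norm \<mu>\<bar>"
    have "cmod (cinner (conv \<mu> (L n) \<psi>) \<phi> - cinner (conv \<mu> S \<psi>) \<phi>) \<le> ?K * (1 / real (Suc n))" for n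
    proof -
      have "cmod (cinner (conv \<mu> (L n) \<psi>) \<phi> - cinner (conv \<mu> S \<psi>) \<phi>) \<le>
          ?C * trace_norm (D n) * \<bar>total_variation_norm \<mu>\<bar>"
        using conv_cinner_le[OF \<mu> D abs_ge_self, of n] by (simp add: split[OF \<mu>, of n])
      also have "\<dots> \<le> ?C * (1 / real (Suc n)) * \<bar>total_variation_norm \<mu>\<bar>"
        using small[of n] by (intro mult_right_mono mult_left_mono) auto
      finally show ?thesis
        by (simp add: mult_ac)
    qed
    then have "(\<lambda>n. cinner (conv \<mu> (L n) \<psi>) \<phi> - cinner (conv \<mu> S \<psi>) \<phi>) \<longlonglongrightarrow> 0"
      by (intro Lim_null_comparison[OF _ null[of ?K]]) simp
    then show ?thesis
      by (rule LIM_zero_cancel)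
  qed
  moreover have "complex_measure_integral \<mu> (?F (L n)) = cinner (conv \<mu> (L n) \<psi>) \<phi>" for n
    using L by (simp add: weak_formula_def)
  ultimately show "cinner (conv \<mu> S \<psi>) \<phi> = complex_measure_integral \<mu> (?F S)"
    using LIMSEQ_unique by fastforce
qed

end

theorem theorem3p3:
  fixes conv :: "(((real ^ 'n) \<times> (real ^ 'n)) set \<Rightarrow> complex) \<Rightarrow>
                 ((real ^ 'n) l2 \<Rightarrow> (real ^ 'n) l2) \<Rightarrow> (real ^ 'n) l2 \<Rightarrow> (real ^ 'n) l2"
    and S :: "(real ^ 'n) l2 \<Rightarrow> (real ^ 'n) l2"
    and \<mu> :: "((real ^ 'n) \<times> (real ^ 'n)) set \<Rightarrow> complex"
  assumes "measure_operator_convolution conv"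
    and "trace_class S"
    and "complex_measure \<mu>"
  shows "\<forall>\<psi> \<phi>.
    complex_measure_integrable \<mu>
      (\<lambda>z. cinner ((tf_shift z \<circ> S \<circ> cadjoint (tf_shift z)) \<psi>) \<phi>) \<and>
    cinner (conv \<mu> S \<psi>) \<phi> =
      complex_measure_integral \<mu>
        (\<lambda>z. cinner ((tf_shift z \<circ> S \<circ> cadjoint (tf_shift z)) \<psi>) \<phi>)"
proof (intro allI)
  fix \<psi> \<phi> :: "(real ^ 'n) l2"
  have formula: "weak_formula conv \<mu> S"
    by (rule weak_formula_trace_class[OF assms(1,3,2)])
  then have "complex_measure_integrable \<mu> (\<lambda>z. cinner (conv (dirac_measure z) S \<psi>) \<phi>) \<and>
      cinner (conv \<mu> S \<psi>) \<phi> = complex_measure_integral \<mu> (\<lambda>z. cinner (conv (dirac_measure z) S \<psi>) \<phi>)"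
    using orbit_integrable[OF assms(1,3) formula] by (simp add: weak_formula_def[OF assms(1)])
  then show "complex_measure_integrable \<mu>
      (\<lambda>z. cinner ((tf_shift z \<circ> S \<circ> cadjoint (tf_shift z)) \<psi>) \<phi>) \<and>
    cinner (conv \<mu> S \<psi>) \<phi> =
      complex_measure_integral \<mu>
        (\<lambda>z. cinner ((tf_shift z \<circ> S \<circ> cadjoint (tf_shift z)) \<psi>) \<phi>)"
    by (simp only: conv_dirac[OF assms(1,2)])
qed

end
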